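(* Let $K$ be a field and let $K^\times\hookrightarrow U$ be an extension of abelian groups with factor group $D=U/K^\times$ and universal $D$-graded $K$-algebra $L:=K\langle U\rangle$. The group extension $K^\times\hookrightarrow U$ is co-Galois if and only if the following conditions are fulfilled: 1. $D$ is a torsion group, with $D[\ell^\infty]=0$ if $\operatorname{char}K=\ell>0$. 2. For all primes $p$ with $D[p^\infty]\neq0$, every element of order $p$ in $L^\times$ belongs to $K^\times$. 3. If $D$ and $K\langle U\rangle^\times$ contain elements of order $4$, then $K^\times$ contains an element of order $4$.
   Context: All rings are commutative; $R^\times$ is the group of units of a ring $R$. For an abelian group $G$ and a prime $p$, $G[p^\infty]$ denotes its $p$-primary component (elements of $p$-power order). Universal algebra: let $U$ be an abelian group containing $K^\times$ as a subgroup and put $D=U/K^\times$ (written additively). Choose representatives $x_d\in U$ of the classes $d\in D$. Then $K\langle U\rangle:=\bigoplus_{d\in D}Kx_d$ is the $K$-algebra with $K$-basis $(x_d)_{d\in D}$ and multiplication $x_dx_e=a_{d,e}x_{d+e}$, where $a_{d,e}\in K^\times$ is determined by this equation in $U$ (equivalently, $K\langle U\rangle=K\otimes_{\mathbb Z[K^\times]}\mathbb Z[U]$). It is $D$-graded with components $L_d=Kx_d$, and $U$ is identified with its group of homogeneous units. For a subgroup $D'\subseteq D$ put $L_{D'}=\bigoplus_{d\in D'}L_d$. The group extension $K^\times\hookrightarrow U$ is called co-Galois if (a) $L=K\langle U\rangle$ is a field and $D[\ell^\infty]=0$ if $\operatorname{char}K=\ell>0$; and (b) every intermediate field $K\subseteq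 E\subseteq L$ is graded, i.e. $E=L_{D'}$ for some subgroup $D'\subseteq D$. *)

theory Defs
  imports "HOL-Algebra.Algebra"
begin

definition ring_char :: "('a, 'm) ring_scheme \<Rightarrow> nat" where
  "ring_char R =
     (if \<exists>n::nat. n > 0 \<and> [n] \<cdot>\<^bsub>R\<^esub> \<one>\<^bsub>R\<^esub> = \<zero>\<^bsub>R\<^esub>
      then LEAST n::nat. n > 0 \<and> [n] \<cdot>\<^bsub>R\<^esub> \<one>\<^bsub>R\<^esub> = \<zero>\<^bsub>R\<^esub> else 0)"

definition torsion_group :: "('g, 'n) monoid_scheme \<Rightarrow> bool" where
  "torsion_group G \<longleftrightarrow> (\<forall>g\<in>carrier G. \<exists>n::nat. n > 0 \<and> g [^]\<^bsub>G\<^esub> n = \<one>\<^bsub>G\<^esub>)"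

definition primary_component :: "('g, 'n) monoid_scheme \<Rightarrow> nat \<Rightarrow> 'g set" where
  "primary_component G p = {g \<in> carrier G. \<exists>k::nat. g [^]\<^bsub>G\<^esub> (p ^ k) = \<one>\<^bsub>G\<^esub>}"

text \<open>
  An extension of abelian groups \<open>K\<^sup>\<times> \<hookrightarrow> U\<close> is given by an injective homomorphism
  \<open>\<iota>\<close> from the unit group of \<open>K\<close> to \<open>U\<close>. The factor group \<open>D\<close> is written multiplicatively; its
  elements are cosets, and its trivial element is the image of \<open>\<iota>\<close>. A choice of
  representatives is a function \<open>x\<close> with \<open>x d \<in> d\<close> for every coset \<open>d\<close>.
\<close>

definition ext_quot ::
  "('a, 'm) ring_scheme \<Rightarrow> ('u, 'n) monoid_scheme \<Rightarrow> ('a \<Rightarrow> 'u) \<Rightarrow> 'u set monoid" where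
  "ext_quot K U \<iota> = U Mod (\<iota> ` Units K)"

definition ext_class ::
  "('a, 'm) ring_scheme \<Rightarrow> ('u, 'n) monoid_scheme \<Rightarrow> ('a \<Rightarrow> 'u) \<Rightarrow> 'u \<Rightarrow> 'u set" where
  "ext_class K U \<iota> u = (\<iota> ` Units K) #>\<^bsub>U\<^esub> u"

text \<open>The unique \<open>a \<in> K\<^sup>\<times>\<close> with \<open>u = a x\<^sub>d\<close>, where \<open>d\<close> is the class of \<open>u\<close>.\<close>

definition ext_coord ::
  "('a, 'm) ring_scheme \<Rightarrow> ('u, 'n) monoid_scheme \<Rightarrow> ('a \<Rightarrow> 'u) \<Rightarrow> ('u set \<Rightarrow> 'u) \<Rightarrow> 'u \<Rightarrow> 'a" where
  "ext_coord K U \<iota> x u =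
     (THE a. a \<in> Units K \<and> u = \<iota> a \<otimes>\<^bsub>U\<^esub> x (ext_class K U \<iota> u))"

text \<open>The element \<open>u \<in> U\<close>, viewed as a homogeneous element of the universal algebra.\<close>

definition ualg_homog ::
  "('a, 'm) ring_scheme \<Rightarrow> ('u, 'n) monoid_scheme \<Rightarrow> ('a \<Rightarrow> 'u) \<Rightarrow> ('u set \<Rightarrow> 'u)
    \<Rightarrow> 'u \<Rightarrow> ('u set \<Rightarrow> 'a)" where
  "ualg_homog K U \<iota> x u =
     (\<lambda>d\<in>carrier (ext_quot K U \<iota>).
        if d = ext_class K U \<iota> u then ext_coord K U \<iota> x u else \<zero>\<^bsub>K\<^esub>)"

text \<open>
  The universal algebra: a finitely supported \<open>f\<close> stands for the sum of all \<open>f d \<cdot> x\<^sub>d\<close>. The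
  structure constant \<open>a\<^bsub>d,e\<^esub>\<close> is the coordinate of \<open>x\<^sub>d x\<^sub>e\<close>. The representative of
  the trivial class need not be the identity of \<open>U\<close>, so the identity of the algebra is the
  homogeneous element belonging to the identity of \<open>U\<close>.
\<close>

definition universal_algebra ::
  "('a, 'm) ring_scheme \<Rightarrow> ('u, 'n) monoid_scheme \<Rightarrow> ('a \<Rightarrow> 'u) \<Rightarrow> ('u set \<Rightarrow> 'u)
    \<Rightarrow> ('u set \<Rightarrow> 'a) ring" where
  "universal_algebra K U \<iota> x =
     (let D = ext_quot K U \<iota>; supp = (\<lambda>f. {d \<in> carrier D. f d \<noteq> \<zero>\<^bsub>K\<^esub>}) in
      \<lparr>carrier = {f \<in> carrier D \<rightarrow>\<^sub>E carrier K. finite (supp f)},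
       monoid.mult = (\<lambda>f g. \<lambda>c\<in>carrier D.
         finsum K (\<lambda>(d, e). f d \<otimes>\<^bsub>K\<^esub> g e \<otimes>\<^bsub>K\<^esub> ext_coord K U \<iota> x (x d \<otimes>\<^bsub>U\<^esub> x e))
           {(d, e). d \<in> supp f \<and> e \<in> supp g \<and> d \<otimes>\<^bsub>D\<^esub> e = c}),
       monoid.one = ualg_homog K U \<iota> x \<one>\<^bsub>U\<^esub>,
       ring.zero = (\<lambda>d\<in>carrier D. \<zero>\<^bsub>K\<^esub>),
       ring.add = (\<lambda>f g. \<lambda>d\<in>carrier D. f d \<oplus>\<^bsub>K\<^esub> g d)\<rparr>)"

text \<open>The structure map \<open>K \<rightarrow> L\<close>, sending \<open>a\<close> to \<open>a \<cdot> 1\<^sub>L\<close>.\<close>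

definition ualg_scalar ::
  "('a, 'm) ring_scheme \<Rightarrow> ('u, 'n) monoid_scheme \<Rightarrow> ('a \<Rightarrow> 'u) \<Rightarrow> ('u set \<Rightarrow> 'u)
    \<Rightarrow> 'a \<Rightarrow> ('u set \<Rightarrow> 'a)" where
  "ualg_scalar K U \<iota> x a =
     (\<lambda>d\<in>carrier (ext_quot K U \<iota>). a \<otimes>\<^bsub>K\<^esub> \<one>\<^bsub>universal_algebra K U \<iota> x\<^esub> d)"

text \<open>The graded part \<open>L\<^bsub>D'\<^esub>\<close>: the direct sum of the lines \<open>K x\<^sub>d\<close> with \<open>d \<in> D'\<close>.\<close>

definition ualg_part ::
  "('a, 'm) ring_scheme \<Rightarrow> ('u, 'n) monoid_scheme \<Rightarrow> ('a \<Rightarrow> 'u) \<Rightarrow> ('u set \<Rightarrow> 'u)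
    \<Rightarrow> 'u set set \<Rightarrow> ('u set \<Rightarrow> 'a) set" where
  "ualg_part K U \<iota> x D' =
     {f \<in> carrier (universal_algebra K U \<iota> x).
        \<forall>d\<in>carrier (ext_quot K U \<iota>) - D'. f d = \<zero>\<^bsub>K\<^esub>}"

text \<open>
  The algebra is determined by the extension up to graded isomorphism, so the choice of
  representatives \<open>x\<close> is immaterial here.
\<close>

definition co_galois ::
  "('a, 'm) ring_scheme \<Rightarrow> ('u, 'n) monoid_scheme \<Rightarrow> ('a \<Rightarrow> 'u) \<Rightarrow> ('u set \<Rightarrow> 'u) \<Rightarrow> bool" where
  "co_galois K U \<iota> x \<longleftrightarrow>
     (let L = universal_algebra K U \<iota> x; D = ext_quot K U \<iota> in
      field L \<and>
      (ring_char K > 0 \<longrightarrow> primary_component D (ring_char K) = {\<one>\<^bsub>D\<^esub>}) \<and>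
      (\<forall>E. subfield E L \<and> ualg_scalar K U \<iota> x ` carrier K \<subseteq> E \<longrightarrow>
         (\<exists>D'. subgroup D' D \<and> E = ualg_part K U \<iota> x D')))"

end

theory Submission
  imports Defs "Jordan_Normal_Form.Determinant"
begin

text \<open>
  Suppose the conditions hold. Adjoining homogeneous elements one at a time, each a \<open>q\<close>-th root of some
  element for a prime \<open>q\<close>, only produces fields: \<open>X\<^sup>q - b\<close> can fail to be irreducible over a field only
  if \<open>b\<close> is a \<open>q\<close>-th power there, and as \<open>q\<close>-th roots of unity lie in \<open>K\<close>, the root was then already
  present. So \<open>L\<close> is a field. For an intermediate field \<open>E\<close>, elements of \<open>U E\<^sup>\<times>\<close> in distinct classes
  modulo \<open>E\<^sup>\<times>\<close> are linearly independent over \<open>E\<close> (Kneser). By induction this comes down to one step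
  \<open>E(y)\<close> with \<open>y\<^sup>q \<in> E\<close>, where an element of \<open>U E\<^sup>\<times>\<close> lying in \<open>E(y)\<close> must belong to some \<open>E\<^sup>\<times> y\<^sup>j\<close>;
  norms and traces from \<open>E(y)\<close> to \<open>E\<close> show this. Independence over \<open>E\<close> says that the homogeneous
  components of an element of \<open>E\<close> lie in \<open>E\<close>.

  Conversely, if the extension is co-Galois, an element \<open>w\<close> of infinite order would make \<open>1 + w\<close>
  noninvertible, and a root of unity violating one of the other conditions generates, together with a
  suitable \<open>u \<in> U\<close>, a graded field with more homogeneous classes than its dimension allows.
\<close>

subsection \<open>Determinants over a commutative ring given by a record\<close>


text \<open>That \<open>L\<close> is a field is itself to be proved, so norms have to make sense
  over a mere commutative ring. The norm is a determinant on the span of the vectors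
  \<open>v y\<^sup>i\<close>, for an arbitrary nonzero \<open>v\<close>: this makes all these
  families independent at once, and so gives inverses without irreducible polynomials or quotient
  rings. Since \<open>det\<close> acts on matrices over a type of class \<open>comm_ring_1\<close>
  and \<open>L\<close> is a record with a carrier, determinants are formed in an auxiliary ring of
  terms and then evaluated. Each condition enters at its own place. Roots of unity: an element with
  the same q-th power as some d in E lies in E. Characteristic: the trace of 1 from E(y) to E is q,
  which must not vanish. Order 4: the norm of y is \<open>y\<^sup>q\<close> up to the sign
  (-1)^(q-1), and at q = 2 the norm argument only makes -y^2 a square. This really happens: over the
  rationals y = 2i has y^2 = -4, and 1 + i is a square root of y in the field of y, whence X^4 + 4
  is reducible. The same identity (1 + i)^2 = 2i drives the converse.\<close>

datatype 'b ring_term = RVar 'b | RZero | ROne | RAdd "'b ring_term" "'b ring_term"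
  | RMult "'b ring_term" "'b ring_term" | RNeg "'b ring_term"

text \<open>A variable outside the carrier is read as zero. Every term thus has a value in every
  ring record on \<open>'b\<close>, and the ring laws hold between terms without side
  conditions.\<close>

primrec ring_eval :: "'b ring \<Rightarrow> 'b ring_term \<Rightarrow> 'b" where
  "ring_eval R (RVar a) = (if a \<in> carrier R then a else \<zero>\<^bsub>R\<^esub>)"
| "ring_eval R RZero = \<zero>\<^bsub>R\<^esub>"
| "ring_eval R ROne = \<one>\<^bsub>R\<^esub>"
| "ring_eval R (RAdd s t) = ring_eval R s \<oplus>\<^bsub>R\<^esub> ring_eval R t"
| "ring_eval R (RMult s t) = ring_eval R s \<otimes>\<^bsub>R\<^esub> ring_eval R t"
| "ring_eval R (RNeg s) = \<ominus>\<^bsub>R\<^esub> ring_eval R s"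

primrec int_eval :: "'b ring_term \<Rightarrow> int" where
  "int_eval (RVar a) = 0"
| "int_eval RZero = 0"
| "int_eval ROne = 1"
| "int_eval (RAdd s t) = int_eval s + int_eval t"
| "int_eval (RMult s t) = int_eval s * int_eval t"
| "int_eval (RNeg s) = - int_eval s"

text \<open>
  Terms are identified when they agree in every commutative ring on \<open>'b\<close>, so that the quotient
  evaluates into each of them; agreement in the integers is only there to ensure \<open>0 \<noteq> 1\<close>.
\<close>

definition ring_term_rel :: "'b ring_term \<Rightarrow> 'b ring_term \<Rightarrow> bool" where
  "ring_term_rel s t \<longleftrightarrow>
     (\<forall>R. cring R \<longrightarrow> ring_eval R s = ring_eval R t) \<and> int_eval s = int_eval t"

quotient_type 'b free_ring = "'b ring_term" / ring_term_rel
  by (rule equivpI) (auto simp: reflp_def symp_def transp_def ring_term_rel_def)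

lemma ring_eval_closed: "cring R \<Longrightarrow> ring_eval R t \<in> carrier R"
proof (induction t)
qed (auto intro: cring.cring_simprules)

instantiation free_ring :: (type) comm_ring_1
begin

lift_definition zero_free_ring :: "'a free_ring" is RZero .
lift_definition one_free_ring :: "'a free_ring" is ROne .
lift_definition plus_free_ring :: "'a free_ring \<Rightarrow> 'a free_ring \<Rightarrow> 'a free_ring" is RAdd
  by (auto simp: ring_term_rel_def)
lift_definition times_free_ring :: "'a free_ring \<Rightarrow> 'a free_ring \<Rightarrow> 'a free_ring" is RMult
  by (auto simp: ring_term_rel_def)
lift_definition uminus_free_ring :: "'a free_ring \<Rightarrow> 'a free_ring" is RNeg
  by (auto simp: ring_term_rel_def)
lift_definition minus_free_ring :: "'a free_ring \<Rightarrow> 'a free_ring \<Rightarrow> 'a free_ring"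
  is "\<lambda>s t. RAdd s (RNeg t)"
  by (auto simp: ring_term_rel_def)

instance
proof
  fix a b c :: "'a free_ring"
  show "a + b + c = a + (b + c)"
    by transfer (auto simp: ring_term_rel_def cring.cring_simprules ring_eval_closed)
  show "a + b = b + a"
    by transfer (auto simp: ring_term_rel_def cring.cring_simprules ring_eval_closed)
  show "0 + a = a"
    by transfer (auto simp: ring_term_rel_def cring.cring_simprules ring_eval_closed)
  show "- a + a = 0"
    by transfer (auto simp: ring_term_rel_def cring.cring_simprules ring_eval_closed)
  show "a - b = a + - b"
    by transfer (auto simp: ring_term_rel_def)
  show "a * b * c = a * (b * c)"
    by transfer (auto simp: ring_term_rel_def cring.cring_simprules ring_eval_closed)
  show "a * b = b * a"
    by transfer (auto simp: ring_term_rel_def cring.cring_simprules ring_eval_closed)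
  show "1 * a = a"
    by transfer (auto simp: ring_term_rel_def cring.cring_simprules ring_eval_closed)
  show "(a + b) * c = a * c + b * c"
    by transfer (auto simp: ring_term_rel_def cring.cring_simprules ring_eval_closed
        algebra_simps)
  show "(0::'a free_ring) \<noteq> 1"
    by transfer (auto simp: ring_term_rel_def)
qed

end

definition gen :: "'b \<Rightarrow> 'b free_ring" where "gen a = abs_free_ring (RVar a)"

definition free_eval :: "'b ring \<Rightarrow> 'b free_ring \<Rightarrow> 'b" where
  "free_eval R t = ring_eval R (rep_free_ring t)"

context
  fixes R :: "'b ring" (structure)
  assumes R: "cring R"
begin

interpretation cring R by (rule R)

lemma free_eval_abs: "free_eval R (abs_free_ring t) = ring_eval R t"
  using Quotient3_rep_abs[OF Quotient3_free_ring, of t] R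
  by (simp add: free_eval_def ring_term_rel_def)

lemma free_eval_closed [simp]: "free_eval R t \<in> carrier R"
  by (simp add: free_eval_def R ring_eval_closed)

lemma free_eval_gen [simp]: "a \<in> carrier R \<Longrightarrow> free_eval R (gen a) = a"
  by (simp add: gen_def free_eval_abs)

lemma free_eval_0 [simp]: "free_eval R 0 = \<zero>"
  by (simp add: zero_free_ring.abs_eq free_eval_abs)

lemma free_eval_1 [simp]: "free_eval R 1 = \<one>"
  by (simp add: one_free_ring.abs_eq free_eval_abs)

lemma free_eval_add [simp]: "free_eval R (s + t) = free_eval R s \<oplus> free_eval R t"
  by (induct s, induct t) (simp add: plus_free_ring.abs_eq free_eval_abs)

lemma free_eval_mult [simp]: "free_eval R (s * t) = free_eval R s \<otimes> free_eval R t"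
  by (induct s, induct t) (simp add: times_free_ring.abs_eq free_eval_abs)

lemma free_eval_uminus [simp]: "free_eval R (- t) = \<ominus> free_eval R t"
  by (induct t) (simp add: uminus_free_ring.abs_eq free_eval_abs)

lemma free_eval_power [simp]: "free_eval R (t ^ n) = free_eval R t [^] n"
  by (induct n) (simp_all add: m_comm)

lemma free_eval_sum:
  "free_eval R (sum f A) = (\<Oplus>i\<in>A. free_eval R (f i))" if "finite A"
  using that by induct (simp_all add: Pi_def)

lemma free_eval_prod_cong:
  "(\<And>i. i \<in> A \<Longrightarrow> free_eval R (f i) = free_eval R (g i)) \<Longrightarrow>
    free_eval R (prod f A) = free_eval R (prod g A)"
  by (induct A rule: infinite_finite_induct) simp_all

lemma free_eval_sum_cong:
  "(\<And>i. i \<in> A \<Longrightarrow> free_eval R (f i) = free_eval R (g i)) \<Longrightarrow>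
    free_eval R (sum f A) = free_eval R (sum g A)"
  by (induct A rule: infinite_finite_induct) simp_all

text \<open>By the Leibniz formula the determinant is a polynomial in the entries, so only their
  values in \<open>R\<close> matter. This is needed because \<open>gen\<close> is no homomorphism:
  \<open>gen (a \<oplus> b)\<close> and \<open>gen a + gen b\<close> differ as terms but have the
  same value.\<close>

lemma free_eval_det_cong:
  assumes "A \<in> carrier_mat n n" "B \<in> carrier_mat n n"
    and "\<And>i j. i < n \<Longrightarrow> j < n \<Longrightarrow> free_eval R (A $$ (i,j)) = free_eval R (B $$ (i,j))"
  shows "free_eval R (det A) = free_eval R (det B)"
  unfolding det_def'[OF assms(1)] det_def'[OF assms(2)]
proof (rule free_eval_sum_cong)
  fix p assume "p \<in> {p. p permutes {0..<n}}"
  then have "p i < n" if "i < n" for i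
    using that permutes_in_image[of p "{0..<n}" i] by auto
  then have "free_eval R (\<Prod>i = 0..<n. A $$ (i, p i)) = free_eval R (\<Prod>i = 0..<n. B $$ (i, p i))"
    by (intro free_eval_prod_cong assms) auto
  then show "free_eval R (signof p * (\<Prod>i = 0..<n. A $$ (i, p i)))
      = free_eval R (signof p * (\<Prod>i = 0..<n. B $$ (i, p i)))"
    by simp
qed

text \<open>The Leibniz formula has integer coefficients, so it cannot leave a subring.\<close>

lemma free_eval_det_closed:
  assumes "subring F R" "A \<in> carrier_mat n n"
    and "\<And>i j. i < n \<Longrightarrow> j < n \<Longrightarrow> free_eval R (A $$ (i,j)) \<in> F"
  shows "free_eval R (det A) \<in> F"
proof -
  note F = subringE[OF assms(1)]
  have sum: "free_eval R (sum f I) \<in> F" if "\<And>i. i \<in> I \<Longrightarrow> free_eval R (f i) \<in> F" for f and I :: "'c set"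
    using that by (induct I rule: infinite_finite_induct) (simp_all add: F)
  have prod: "free_eval R (prod f I) \<in> F" if "\<And>i. i \<in> I \<Longrightarrow> free_eval R (f i) \<in> F" for f and I :: "'c set"
    using that by (induct I rule: infinite_finite_induct) (simp_all add: F)
  have sign: "free_eval R (signof p) \<in> F" for p :: "nat \<Rightarrow> nat"
    using F by (cases "evenperm p") (simp_all add: sign_def)
  show ?thesis
    unfolding det_def'[OF assms(2)]
  proof (rule sum)
    fix p assume "p \<in> {p. p permutes {0..<n}}"
    then have "p i < n" if "i < n" for i
      using that permutes_in_image[of p "{0..<n}" i] by auto
    then have "free_eval R (\<Prod>i = 0..<n. A $$ (i, p i)) \<in> F"
      by (intro prod assms) auto
    then show "free_eval R (signof p * (\<Prod>i = 0..<n. A $$ (i, p i))) \<in> F"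
      by (simp add: F sign)
  qed
qed

definition rdet :: "nat \<Rightarrow> (nat \<Rightarrow> nat \<Rightarrow> 'b) \<Rightarrow> 'b" where
  "rdet n a = free_eval R (det (mat n n (\<lambda>(i,j). gen (a i j))))"

lemma rdet_mult:
  assumes "\<And>i j. i < n \<Longrightarrow> j < n \<Longrightarrow> a i j \<in> carrier R"
    and "\<And>i j. i < n \<Longrightarrow> j < n \<Longrightarrow> b i j \<in> carrier R"
    and "\<And>i j. i < n \<Longrightarrow> j < n \<Longrightarrow> c i j = (\<Oplus>l\<in>{..<n}. a i l \<otimes> b l j)"
  shows "rdet n c = rdet n a \<otimes> rdet n b"
proof -
  let ?M = "\<lambda>a. mat n n (\<lambda>(i,j). gen (a i j))"
  \<comment> \<open>The matrix of generators of \<open>c\<close> is not the product of the other two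
    matrices; only the evaluated entries agree.\<close>
  have "rdet n c = free_eval R (det (?M a * ?M b))"
    unfolding rdet_def
  proof (rule free_eval_det_cong)
    fix i j assume ij: "i < n" "j < n"
    have "(\<Oplus>l\<in>{..<n}. free_eval R (gen (a i l) * gen (b l j))) = (\<Oplus>l\<in>{..<n}. a i l \<otimes> b l j)"
      by (rule finsum_cong') (use ij assms(1,2) in auto)
    then have "free_eval R ((?M a * ?M b) $$ (i,j)) = (\<Oplus>l\<in>{..<n}. a i l \<otimes> b l j)"
      using ij by (simp add: scalar_prod_def free_eval_sum atLeast0LessThan)
    moreover have "c i j \<in> carrier R"
      using assms ij by simp
    ultimately show "free_eval R (?M c $$ (i,j)) = free_eval R ((?M a * ?M b) $$ (i,j))"
      using ij assms(3) by simp
  qed auto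
  also have "\<dots> = rdet n a \<otimes> rdet n b"
    unfolding rdet_def by (subst det_mult[of _ n]) auto
  finally show ?thesis .
qed

lemma rdet_closed:
  assumes "subring F R" "\<And>i j. i < n \<Longrightarrow> j < n \<Longrightarrow> a i j \<in> F"
  shows "rdet n a \<in> F"
  unfolding rdet_def
proof (rule free_eval_det_closed[OF assms(1)])
  fix i j assume "i < n" "j < n"
  with assms have "a i j \<in> F" "a i j \<in> carrier R"
    using subringE(1)[OF assms(1)] by auto
  with \<open>i < n\<close> \<open>j < n\<close> show "free_eval R (mat n n (\<lambda>(i, j). gen (a i j)) $$ (i, j)) \<in> F"
    by simp
qed simp

lemma rdet_cong:
  assumes "\<And>i j. i < n \<Longrightarrow> j < n \<Longrightarrow> a i j = b i j"
  shows "rdet n a = rdet n b"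
proof -
  have "mat n n (\<lambda>(i,j). gen (a i j)) = mat n n (\<lambda>(i,j). gen (b i j))"
    by (rule eq_matI) (use assms in auto)
  then show ?thesis by (simp add: rdet_def)
qed

lemma rdet_scalar:
  assumes "c \<in> carrier R"
  shows "rdet n (\<lambda>i j. if i = j then c else \<zero>) = c [^] n"
proof -
  have "rdet n (\<lambda>i j. if i = j then c else \<zero>) = free_eval R (det (gen c \<cdot>\<^sub>m 1\<^sub>m n))"
    unfolding rdet_def by (rule free_eval_det_cong) (use assms in auto)
  then show ?thesis
    using assms by simp
qed

text \<open>This is the companion matrix of X^n - b. In its first row only the last entry
  \<open>b\<close> survives, and the complementary minor is an identity matrix, so the position
  alone decides the sign.\<close>

lemma rdet_cyclic:
  assumes "b \<in> carrier R" and n: "n > 0"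
  shows "rdet n (\<lambda>i j. if i = Suc j then \<one> else if i = 0 \<and> Suc j = n then b else \<zero>)
    = (\<ominus> \<one>) [^] (n - 1) \<otimes> b"
proof -
  define A where "A = mat n n (\<lambda>(i,j).
    if i = Suc j then 1 else if i = 0 \<and> Suc j = n then gen b else 0)"
  have A: "A \<in> carrier_mat n n" by (simp add: A_def)
  have "rdet n (\<lambda>i j. if i = Suc j then \<one> else if i = 0 \<and> Suc j = n then b else \<zero>)
      = free_eval R (det A)"
    unfolding rdet_def A_def by (rule free_eval_det_cong) (use assms in auto)
  moreover have "det A = gen b * (-1) ^ (n - 1)"
  proof -
    have "det A = (\<Sum>j<n. A $$ (0,j) * cofactor A 0 j)"
      using laplace_expansion_row[OF A n] .
    also have "\<dots> = (\<Sum>j\<in>{n-1}. A $$ (0,j) * cofactor A 0 j)"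
    proof (rule sum.mono_neutral_right)
      show "\<forall>j\<in>{..<n} - {n-1}. A $$ (0,j) * cofactor A 0 j = 0"
        using n by (auto simp: A_def)
    qed (use n in auto)
    also have "\<dots> = A $$ (0,n-1) * cofactor A 0 (n-1)"
      by simp
    also have "mat_delete A 0 (n-1) = 1\<^sub>m (n-1)"
      by (rule eq_matI) (auto simp: A_def mat_delete_def)
    then have "cofactor A 0 (n-1) = (-1) ^ (n-1)"
      by (simp add: cofactor_def)
    also have "A $$ (0,n-1) = gen b"
      using n by (auto simp: A_def)
    finally show ?thesis .
  qed
  ultimately show ?thesis
    using assms by (simp add: m_comm)
qed

end

subsection \<open>Norm and trace with respect to a basis\<close>


context ring
begin

primrec lincomb :: "nat \<Rightarrow> (nat \<Rightarrow> 'a) \<Rightarrow> (nat \<Rightarrow> 'a) \<Rightarrow> 'a" where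
  "lincomb 0 c e = \<zero>"
| "lincomb (Suc n) c e = lincomb n c e \<oplus> c n \<otimes> e n"

definition lin_span :: "'a set \<Rightarrow> nat \<Rightarrow> (nat \<Rightarrow> 'a) \<Rightarrow> 'a set" where
  "lin_span F n e = {lincomb n c e | c. \<forall>i<n. c i \<in> F}"

definition lin_indep :: "'a set \<Rightarrow> nat \<Rightarrow> (nat \<Rightarrow> 'a) \<Rightarrow> bool" where
  "lin_indep F n e \<longleftrightarrow> (\<forall>i<n. e i \<in> carrier R) \<and>
     (\<forall>c. (\<forall>i<n. c i \<in> F) \<longrightarrow> lincomb n c e = \<zero> \<longrightarrow> (\<forall>i<n. c i = \<zero>))"

text \<open>Outside the span the chosen value is arbitrary; inside it, independence makes it unique,
  see \<open>coord_eqI\<close>.\<close>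

definition coord :: "'a set \<Rightarrow> nat \<Rightarrow> (nat \<Rightarrow> 'a) \<Rightarrow> 'a \<Rightarrow> nat \<Rightarrow> 'a" where
  "coord F n e v = (SOME c. (\<forall>i<n. c i \<in> F) \<and> v = lincomb n c e)"

lemma lin_indepD:
  "lin_indep F n e \<Longrightarrow> (\<And>i. i < n \<Longrightarrow> c i \<in> F) \<Longrightarrow> lincomb n c e = \<zero> \<Longrightarrow> i < n \<Longrightarrow> c i = \<zero>"
  by (simp add: lin_indep_def)

lemma lincomb_closed [simp]:
  "(\<And>i. i < n \<Longrightarrow> c i \<in> carrier R) \<Longrightarrow> (\<And>i. i < n \<Longrightarrow> e i \<in> carrier R) \<Longrightarrow>
    lincomb n c e \<in> carrier R"
  by (induct n) auto

lemma lincomb_cong: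
  "(\<And>i. i < n \<Longrightarrow> c i = d i) \<Longrightarrow> (\<And>i. i < n \<Longrightarrow> e i = f i) \<Longrightarrow> lincomb n c e = lincomb n d f"
  by (induct n) auto

lemma lincomb_zero:
  "(\<And>i. i < n \<Longrightarrow> c i \<otimes> e i = \<zero>) \<Longrightarrow> lincomb n c e = \<zero>"
  by (induct n) auto

lemma lincomb_single:
  "j < n \<Longrightarrow> (\<And>i. i < n \<Longrightarrow> i \<noteq> j \<Longrightarrow> c i = \<zero>) \<Longrightarrow> (\<And>i. i < n \<Longrightarrow> e i \<in> carrier R) \<Longrightarrow> c j \<in> carrier R \<Longrightarrow>
    lincomb n c e = c j \<otimes> e j"
proof (induct n)
  case (Suc n)
  show ?case
  proof (cases "j = n")
    case True
    have "lincomb n c e = \<zero>"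
      by (rule lincomb_zero) (use Suc True in auto)
    then show ?thesis using Suc.prems True by auto
  next
    case False
    then have "lincomb n c e = c j \<otimes> e j" using Suc by auto
    then show ?thesis using Suc.prems False by auto
  qed
qed simp

lemma lincomb_add:
  "(\<And>i. i < n \<Longrightarrow> c i \<in> carrier R) \<Longrightarrow> (\<And>i. i < n \<Longrightarrow> d i \<in> carrier R) \<Longrightarrow>
   (\<And>i. i < n \<Longrightarrow> e i \<in> carrier R) \<Longrightarrow>
    lincomb n (\<lambda>i. c i \<oplus> d i) e = lincomb n c e \<oplus> lincomb n d e"
proof (induct n)
  case (Suc n)
  then have "lincomb n c e \<in> carrier R" "lincomb n d e \<in> carrier R"
    "c n \<in> carrier R" "d n \<in> carrier R" "e n \<in> carrier R"
    by auto
  with Suc show ?case by (simp add: l_distr a_ac)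
qed simp

lemma lincomb_smult:
  "k \<in> carrier R \<Longrightarrow> (\<And>i. i < n \<Longrightarrow> c i \<in> carrier R) \<Longrightarrow> (\<And>i. i < n \<Longrightarrow> e i \<in> carrier R) \<Longrightarrow>
    lincomb n (\<lambda>i. k \<otimes> c i) e = k \<otimes> lincomb n c e"
  by (induct n) (auto simp: r_distr m_assoc)

lemma lincomb_mem:
  assumes "\<zero> \<in> V" "\<And>u v. u \<in> V \<Longrightarrow> v \<in> V \<Longrightarrow> u \<oplus> v \<in> V"
    and "\<And>i. i < n \<Longrightarrow> c i \<otimes> e i \<in> V"
  shows "lincomb n c e \<in> V"
  using assms(3) by (induct n) (auto intro: assms)

text \<open>Moving everything to one side turns a plain sum into a \<open>lincomb\<close>, so that
  \<open>lincomb_lincomb\<close> can interchange the double sum in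
  \<open>basis_trace_eq\<close>.\<close>

lemma lincomb_ones:
  assumes "\<And>i. i < n \<Longrightarrow> c i \<in> carrier R" "\<And>i. i < n \<Longrightarrow> e i \<in> carrier R"
  shows "lincomb n c e = lincomb n (\<lambda>i. c i \<otimes> e i) (\<lambda>_. \<one>)"
    and "lincomb n c e = lincomb n (\<lambda>_. \<one>) (\<lambda>i. c i \<otimes> e i)"
  using assms by (induct n) auto

lemma lincomb_finsum:
  "(\<And>i. i < n \<Longrightarrow> c i \<in> carrier R) \<Longrightarrow> (\<And>i. i < n \<Longrightarrow> e i \<in> carrier R) \<Longrightarrow>
    (\<Oplus>i\<in>{..<n}. c i \<otimes> e i) = lincomb n c e"
proof (induct n)
  case (Suc n)
  then have "(\<Oplus>i\<in>insert n {..<n}. c i \<otimes> e i) = c n \<otimes> e n \<oplus> (\<Oplus>i\<in>{..<n}. c i \<otimes> e i)"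
    by (intro finsum_insert) auto
  with Suc show ?case by (simp add: lessThan_Suc a_comm)
qed simp

lemma lincomb_lincomb:
  assumes "\<And>j. j < n \<Longrightarrow> c j \<in> carrier R"
    and "\<And>i j. j < n \<Longrightarrow> i < m \<Longrightarrow> d j i \<in> carrier R"
    and "\<And>i. i < m \<Longrightarrow> e i \<in> carrier R"
  shows "lincomb n c (\<lambda>j. lincomb m (d j) e) = lincomb m (\<lambda>i. lincomb n c (\<lambda>j. d j i)) e"
  using assms(1,2)
proof (induct n)
  case 0
  then show ?case by (simp add: assms lincomb_zero)
next
  case (Suc n)
  have "lincomb m (\<lambda>i. lincomb n c (\<lambda>j. d j i) \<oplus> c n \<otimes> d n i) e =
      lincomb m (\<lambda>i. lincomb n c (\<lambda>j. d j i)) e \<oplus> lincomb m (\<lambda>i. c n \<otimes> d n i) e"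
    by (rule lincomb_add) (use Suc.prems assms(3) in auto)
  also have "lincomb m (\<lambda>i. c n \<otimes> d n i) e = c n \<otimes> lincomb m (d n) e"
    by (rule lincomb_smult) (use Suc.prems assms(3) in auto)
  finally show ?case
    using Suc by simp
qed

text \<open>The bridge to the list-based notions \<open>combine\<close>, \<open>Span\<close> and
  \<open>independent\<close>, through which dimension counting is imported.\<close>

lemma combine_map:
  assumes "\<And>i. i < n \<Longrightarrow> c i \<in> carrier R" "\<And>i. i < n \<Longrightarrow> e i \<in> carrier R"
  shows "combine (map c [0..<n]) (map e [0..<n]) = lincomb n c e"
  using assms
proof (induct n)
  case (Suc n)
  have "combine (map c [0..<n] @ [c n]) (map e [0..<n] @ [e n])
      = combine (map c [0..<n]) (map e [0..<n]) \<oplus> combine [c n] [e n]"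
    by (rule combine_append[symmetric]) (use Suc.prems in auto)
  with Suc show ?case by simp
qed simp

context
  fixes F assumes F: "subfield F R"
begin

lemma subfield_carrier: "a \<in> F \<Longrightarrow> a \<in> carrier R"
  using subfieldE(3)[OF F] by auto

lemma lin_span_closed: "(\<And>i. i < n \<Longrightarrow> e i \<in> carrier R) \<Longrightarrow> v \<in> lin_span F n e \<Longrightarrow> v \<in> carrier R"
  unfolding lin_span_def by (auto simp: subfield_carrier)

lemma lin_span_eq_Span:
  assumes "\<And>i. i < n \<Longrightarrow> e i \<in> carrier R"
  shows "lin_span F n e = Span F (map e [0..<n])"
proof -
  have "set (map e [0..<n]) \<subseteq> carrier R" using assms by auto
  note S = Span_eq_combine_set_length_version[OF F this]
  have 1: "\<exists>c. combine Ks (map e [0..<n]) = lincomb n c e \<and> (\<forall>i<n. c i \<in> F)"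
    if "length Ks = n" "set Ks \<subseteq> F" for Ks
  proof (intro exI conjI)
    have *: "Ks ! i \<in> F" if "i < n" for i
      using that \<open>length Ks = n\<close> \<open>set Ks \<subseteq> F\<close> by auto
    then show "\<forall>i<n. Ks ! i \<in> F" by simp
    have "combine (map ((!) Ks) [0..<n]) (map e [0..<n]) = lincomb n ((!) Ks) e"
      by (rule combine_map) (use * subfield_carrier assms in auto)
    then show "combine Ks (map e [0..<n]) = lincomb n ((!) Ks) e"
      using that map_nth[of Ks] by simp
  qed
  have 2: "\<exists>Ks. lincomb n c e = combine Ks (map e [0..<n]) \<and> length Ks = n \<and> set Ks \<subseteq> F"
    if "\<forall>i<n. c i \<in> F" for c
    using that assms subfield_carrier
    by (intro exI[of _ "map c [0..<n]"]) (auto simp: combine_map)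
  show ?thesis
    unfolding S lin_span_def using 1 2 by (intro subset_antisym subsetI) (simp_all, metis+)
qed

lemma lin_indep_imp_independent:
  assumes "lin_indep F n e"
  shows "independent F (map e [0..<n])"
proof (rule ccontr)
  assume dep: "\<not> ?thesis"
  moreover have e: "set (map e [0..<n]) \<subseteq> carrier R"
    using assms by (auto simp: lin_indep_def)
  ultimately obtain Ks where Ks: "length Ks = n" "combine Ks (map e [0..<n]) = \<zero>" "set Ks \<subseteq> F"
    "set Ks \<noteq> {\<zero>}"
    using dependent_imp_non_trivial_combine[OF F e] by (metis length_map length_upt minus_nat.diff_0)
  have *: "Ks ! i \<in> F" if "i < n" for i
    using that Ks(1,3) nth_mem[of i Ks] by blast
  have "combine (map ((!) Ks) [0..<n]) (map e [0..<n]) = lincomb n ((!) Ks) e"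
    by (rule combine_map) (use * subfield_carrier assms in \<open>auto simp: lin_indep_def\<close>)
  then have "lincomb n ((!) Ks) e = \<zero>"
    using Ks map_nth[of Ks] by simp
  then have 0: "Ks ! i = \<zero>" if "i < n" for i
    using that assms * by (auto simp: lin_indep_def)
  then have "set Ks \<subseteq> {\<zero>}"
    using Ks by (auto simp: set_conv_nth)
  with Ks have "n = 0" by (cases Ks) auto
  then have "independent F (map e [0..<n])" by (simp add: independent.intros)
  with dep show False by simp
qed

text \<open>The span of \<open>e\<close> has dimension \<open>n\<close>, and \<open>n\<close>
  independent vectors in it already generate it.\<close>

lemma lin_indep_spans:
  assumes "lin_indep F n e" "lin_indep F n f" "\<And>i. i < n \<Longrightarrow> f i \<in> lin_span F n e"
  shows "lin_span F n f = lin_span F n e"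
proof -
  have c: "\<And>i. i < n \<Longrightarrow> e i \<in> carrier R" "\<And>i. i < n \<Longrightarrow> f i \<in> carrier R"
    using assms by (auto simp: lin_indep_def)
  have "dimension n F (lin_span F n e)"
    using dimension_independent[OF lin_indep_imp_independent[OF assms(1)]] lin_span_eq_Span[of n e] c
    by simp
  from independent_length_eq_dimension[OF F this lin_indep_imp_independent[OF assms(2)]]
  moreover have "set (map f [0..<n]) \<subseteq> lin_span F n e"
    using assms(3) by auto
  ultimately have "Span F (map f [0..<n]) = lin_span F n e"
    by simp
  then show ?thesis
    using lin_span_eq_Span[of n f] c(2) by simp
qed

lemma lin_indep_le:
  assumes "lin_indep F m f" "\<And>i. i < n \<Longrightarrow> e i \<in> carrier R" "lin_indep F n e"
    and "\<And>i. i < m \<Longrightarrow> f i \<in> lin_span F n e"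
  shows "m \<le> n"
proof -
  have "set (map f [0..<m]) \<subseteq> Span F (map e [0..<n])"
  proof
    fix v assume "v \<in> set (map f [0..<m])"
    then obtain i where "i < m" "v = f i" by auto
    with assms(4) have "v \<in> lin_span F n e" by blast
    then show "v \<in> Span F (map e [0..<n])" by (simp only: lin_span_eq_Span[OF assms(2)])
  qed
  from independent_length_le[OF F lin_indep_imp_independent[OF assms(1)]
      lin_indep_imp_independent[OF assms(3)] this]
  show ?thesis by simp
qed

lemma coord_span:
  assumes "v \<in> lin_span F n e"
  shows "\<And>i. i < n \<Longrightarrow> coord F n e v i \<in> F" "lincomb n (coord F n e v) e = v"
proof -
  have "\<exists>c. (\<forall>i<n. c i \<in> F) \<and> v = lincomb n c e"
    using assms by (auto simp: lin_span_def)
  from someI_ex[OF this, folded coord_def]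
  show "\<And>i. i < n \<Longrightarrow> coord F n e v i \<in> F" "lincomb n (coord F n e v) e = v" by auto
qed

lemma lincomb_in_span: "(\<And>i. i < n \<Longrightarrow> c i \<in> F) \<Longrightarrow> lincomb n c e \<in> lin_span F n e"
  unfolding lin_span_def by auto

end

end

text \<open>\<open>L\<close> is only a commutative ring here: in the sufficiency direction its being
  a field is a conclusion.\<close>

locale cring_subfield = cring L for L :: "'b ring" (structure) +
  fixes F
  assumes F: "subfield F L"
begin

lemmas F_simps [simp] = subringE(2,3,5,6,7)[OF subfieldE(1)[OF F]]
lemmas F_carrier [simp] = subfield_carrier[OF F]

lemma F_one_not_zero [simp]: "\<one> \<noteq> \<zero>"
  using subfieldE(6)[OF F] .

lemma F_minus [simp]: "a \<in> F \<Longrightarrow> b \<in> F \<Longrightarrow> a \<ominus> b \<in> F"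
  by (simp add: minus_eq)

lemma F_pow [simp]: "a \<in> F \<Longrightarrow> a [^] (n::nat) \<in> F"
  by (induct n) auto

lemma F_Units: "a \<in> F \<Longrightarrow> a \<noteq> \<zero> \<Longrightarrow> a \<in> Units L"
  using subfield_m_inv[OF F, of a] by (auto simp: Units_def)

lemma F_inv: "a \<in> F \<Longrightarrow> a \<noteq> \<zero> \<Longrightarrow> inv a \<in> F" 
  using subfield_m_inv[OF F, of a] by auto

lemma F_inv_nz: "a \<in> F \<Longrightarrow> a \<noteq> \<zero> \<Longrightarrow> inv a \<noteq> \<zero>"
  using subfield_m_inv[OF F, of a] by auto

lemma coord_eqI:
  assumes e: "lin_indep F n e" and c: "\<And>i. i < n \<Longrightarrow> c i \<in> F" and v: "v = lincomb n c e" and i: "i < n"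
  shows "coord F n e v i = c i"
proof -
  have vs: "v \<in> lin_span F n e"
    unfolding v using c by (rule lincomb_in_span[OF F])
  note d = coord_span[OF F vs]
  have ec: "\<And>i. i < n \<Longrightarrow> e i \<in> carrier L" using e by (simp add: lin_indep_def)
  have "lincomb n (\<lambda>i. coord F n e v i \<oplus> \<ominus> \<one> \<otimes> c i) e
      = lincomb n (coord F n e v) e \<oplus> lincomb n (\<lambda>i. \<ominus> \<one> \<otimes> c i) e"
    by (rule lincomb_add) (use d(1) c ec in auto)
  also have "lincomb n (\<lambda>i. \<ominus> \<one> \<otimes> c i) e = \<ominus> \<one> \<otimes> lincomb n c e"
    by (rule lincomb_smult) (use c ec in auto)
  also have "lincomb n (coord F n e v) e \<oplus> \<ominus> \<one> \<otimes> lincomb n c e = \<zero>"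
    using d(2) v c ec by (simp add: l_minus r_neg)
  finally have 0: "lincomb n (\<lambda>i. coord F n e v i \<oplus> \<ominus> \<one> \<otimes> c i) e = \<zero>" .
  have "coord F n e v i \<oplus> \<ominus> \<one> \<otimes> c i = \<zero>"
    by (rule lin_indepD[OF e _ 0 i]) (simp add: d(1) c)
  then show ?thesis
    using i d(1)[OF i] c[OF i] by (simp add: l_minus flip: minus_eq)
qed

lemma lin_indep_carrier: "lin_indep F n e \<Longrightarrow> i < n \<Longrightarrow> e i \<in> carrier L"
  by (simp add: lin_indep_def)

lemma coord_lincomb:
  assumes e: "lin_indep F n e" and c: "\<And>k. k < m \<Longrightarrow> c k \<in> F"
    and g: "\<And>k. k < m \<Longrightarrow> g k \<in> lin_span F n e" and i: "i < n"
  shows "coord F n e (lincomb m c g) i = lincomb m c (\<lambda>k. coord F n e (g k) i)"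
proof (rule coord_eqI[OF e _ _ i])
  note gc = coord_span[OF F g]
  have "lincomb m c g = lincomb m c (\<lambda>k. lincomb n (coord F n e (g k)) e)"
    using gc(2) by (intro lincomb_cong) auto
  also have "\<dots> = lincomb n (\<lambda>i. lincomb m c (\<lambda>k. coord F n e (g k) i)) e"
    by (rule lincomb_lincomb) (use c gc(1) lin_indep_carrier[OF e] in auto)
  finally show "lincomb m c g = \<dots>" .
  show "lincomb m c (\<lambda>k. coord F n e (g k) i) \<in> F" if "i < n" for i
    by (rule lincomb_mem) (use that c gc(1) in auto)
qed

lemma mult_lincomb:
  "z \<in> carrier L \<Longrightarrow> (\<And>i. i < n \<Longrightarrow> c i \<in> carrier L) \<Longrightarrow> (\<And>i. i < n \<Longrightarrow> e i \<in> carrier L) \<Longrightarrow>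
    z \<otimes> lincomb n c e = lincomb n c (\<lambda>i. z \<otimes> e i)"
  by (induct n) (auto simp: r_distr m_lcomm)

lemma lincomb_comm:
  "(\<And>i. i < n \<Longrightarrow> c i \<in> carrier L) \<Longrightarrow> (\<And>i. i < n \<Longrightarrow> e i \<in> carrier L) \<Longrightarrow>
    lincomb n c e = lincomb n e c"
  by (induct n) (auto simp: m_comm)

lemma mult_span:
  assumes ec: "\<And>j. j < n \<Longrightarrow> e j \<in> carrier L" and "\<And>j. j < n \<Longrightarrow> r \<otimes> e j \<in> lin_span F n e" "r \<in> carrier L" "v \<in> lin_span F n e"
  shows "r \<otimes> v \<in> lin_span F n e"
proof -
  note d = coord_span[OF F assms(4)] and d' = coord_span[OF F assms(2)]
  have "r \<otimes> v = lincomb n (coord F n e v) (\<lambda>j. r \<otimes> e j)"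
    using mult_lincomb[of r n "coord F n e v" e] d assms(3) ec by simp
  also have "\<dots> = lincomb n (coord F n e v) (\<lambda>j. lincomb n (coord F n e (r \<otimes> e j)) e)"
    using d'(2) by (intro lincomb_cong) auto
  also have "\<dots> = lincomb n (\<lambda>i. lincomb n (coord F n e v) (\<lambda>j. coord F n e (r \<otimes> e j) i)) e"
    by (rule lincomb_lincomb) (use d d'(1) ec in auto)
  also have "\<dots> \<in> lin_span F n e"
    by (intro lincomb_in_span[OF F] lincomb_mem) (use d d'(1) in auto)
  finally show ?thesis .
qed

text \<open>The determinant of multiplication by \<open>r\<close> on the span of \<open>e\<close>,
  meaningful as soon as that span is stable under \<open>r\<close>. The span need not be a ring nor
  contain 1.\<close>

definition basis_norm where
  "basis_norm n e r = rdet L n (\<lambda>i j. coord F n e (r \<otimes> e j) i)"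

context
  fixes n e
  assumes e: "lin_indep F n e"
begin

lemma basis_norm_closed:
  assumes "\<And>j. j < n \<Longrightarrow> r \<otimes> e j \<in> lin_span F n e"
  shows "basis_norm n e r \<in> F"
  unfolding basis_norm_def
  by (rule rdet_closed[OF is_cring subfieldE(1)[OF F]]) (rule coord_span(1)[OF F assms])

lemma basis_norm_mult:
  assumes r: "\<And>j. j < n \<Longrightarrow> r \<otimes> e j \<in> lin_span F n e" "r \<in> carrier L"
    and s: "\<And>j. j < n \<Longrightarrow> s \<otimes> e j \<in> lin_span F n e" "s \<in> carrier L"
  shows "basis_norm n e (r \<otimes> s) = basis_norm n e r \<otimes> basis_norm n e s"
  unfolding basis_norm_def
proof (rule rdet_mult[OF is_cring])
  note cr = coord_span(1)[OF F r(1)] and cs = coord_span[OF F s(1)]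
  note ec = lin_indep_carrier[OF e]
  fix i j assume ij: "i < n" "j < n"
  then show "coord F n e (r \<otimes> e j) i \<in> carrier L" "coord F n e (s \<otimes> e j) i \<in> carrier L"
    using cr cs by auto
  have "r \<otimes> s \<otimes> e j = r \<otimes> (s \<otimes> e j)"
    using ij ec r s by (simp add: m_assoc)
  also have "\<dots> = r \<otimes> lincomb n (coord F n e (s \<otimes> e j)) e"
    using cs(2) ij by simp
  also have "\<dots> = lincomb n (coord F n e (s \<otimes> e j)) (\<lambda>l. r \<otimes> e l)"
    by (rule mult_lincomb) (use cs(1) ij ec r in auto)
  also have "coord F n e \<dots> i = lincomb n (coord F n e (s \<otimes> e j)) (\<lambda>l. coord F n e (r \<otimes> e l) i)"
    by (rule coord_lincomb[OF e]) (use cs(1) ij r in auto)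
  also have "\<dots> = lincomb n (\<lambda>l. coord F n e (r \<otimes> e l) i) (coord F n e (s \<otimes> e j))"
    by (rule lincomb_comm) (use cr cs(1) ij in auto)
  also have "\<dots> = (\<Oplus>l\<in>{..<n}. coord F n e (r \<otimes> e l) i \<otimes> coord F n e (s \<otimes> e j) l)"
    by (rule lincomb_finsum[symmetric]) (use cr cs(1) ij in auto)
  finally show "coord F n e (r \<otimes> s \<otimes> e j) i
      = (\<Oplus>l\<in>{..<n}. coord F n e (r \<otimes> e l) i \<otimes> coord F n e (s \<otimes> e j) l)" .
qed

lemma coord_single:
  assumes "j < n" "a \<in> F" "i < n"
  shows "coord F n e (a \<otimes> e j) i = (if i = j then a else \<zero>)"
proof (rule coord_eqI[OF e _ _ assms(3)])
  show "a \<otimes> e j = lincomb n (\<lambda>i. if i = j then a else \<zero>) e"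
    using lincomb_single[of j n "\<lambda>i. if i = j then a else \<zero>" e] assms lin_indep_carrier[OF e] by simp
qed (use assms in simp)

lemma single_in_span: "a \<in> F \<Longrightarrow> j < n \<Longrightarrow> a \<otimes> e j \<in> lin_span F n e"
  using lincomb_single[of j n "\<lambda>i. if i = j then a else \<zero>" e]
    lincomb_in_span[OF F, of n "\<lambda>i. if i = j then a else \<zero>" e] lin_indep_carrier[OF e] by simp

lemma basis_norm_scalar:
  assumes "a \<in> F"
  shows "basis_norm n e a = a [^] n"
proof -
  have "basis_norm n e a = rdet L n (\<lambda>i j. if i = j then a else \<zero>)"
    unfolding basis_norm_def by (rule rdet_cong[OF is_cring]) (use assms in \<open>auto simp: coord_single\<close>)
  then show ?thesis using assms by (simp add: rdet_scalar[OF is_cring])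
qed

text \<open>Multiplication by \<open>y\<close> shifts the basis and closes the cycle with the factor
  \<open>b\<close>, so its matrix is the companion matrix of \<open>rdet_cyclic\<close>.\<close>

lemma basis_norm_cyclic:
  assumes "\<And>j. Suc j < n \<Longrightarrow> y \<otimes> e j = e (Suc j)" "y \<otimes> e (n - 1) = b \<otimes> e 0" "b \<in> F" "n > 0"
  shows "basis_norm n e y = (\<ominus> \<one>) [^] (n - 1) \<otimes> b"
proof -
  have "basis_norm n e y =
      rdet L n (\<lambda>i j. if i = Suc j then \<one> else if i = 0 \<and> Suc j = n then b else \<zero>)"
    unfolding basis_norm_def
  proof (rule rdet_cong[OF is_cring])
    fix i j assume ij: "i < n" "j < n"
    show "coord F n e (y \<otimes> e j) i =
        (if i = Suc j then \<one> else if i = 0 \<and> Suc j = n then b else \<zero>)"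
    proof (cases "Suc j < n")
      case True
      then show ?thesis
        using assms(1)[of j] coord_single[of "Suc j" \<one> i] lin_indep_carrier[OF e] ij by auto
    next
      case False
      then have "j = n - 1" using ij by simp
      then show ?thesis
        using assms coord_single[of 0 b i] ij by auto
    qed
  qed
  then show ?thesis using assms by (simp add: rdet_cyclic[OF is_cring])
qed

end

definition basis_trace where
  "basis_trace n e r = lincomb n (\<lambda>_. \<one>) (\<lambda>i. coord F n e (r \<otimes> e i) i)"

text \<open>With \<open>P\<close> the coordinates of \<open>f\<close> in terms of \<open>e\<close>
  and \<open>Z\<close> those of the vectors \<open>z e\<^sub>i\<close> in terms of \<open>f\<close>,
  both traces are the sum of all \<open>P k i \<otimes> Z i k\<close>: this is tr(AB) =
  tr(BA).\<close>

lemma basis_trace_eq: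
  assumes e: "lin_indep F n e" and f: "lin_indep F n f" and ef: "lin_span F n e = lin_span F n f"
    and z: "z \<in> carrier L" "\<And>i. i < n \<Longrightarrow> z \<otimes> e i \<in> lin_span F n e"
  shows "basis_trace n e z = basis_trace n f z"
proof -
  have fe: "f k \<in> lin_span F n e" if "k < n" for k
    using single_in_span[OF f, of \<one> k] that ef lin_indep_carrier[OF f] by simp
  have zf: "z \<otimes> f k \<in> lin_span F n e" if "k < n" for k
    using mult_span[OF lin_indep_carrier[OF e] z(2) z(1)] fe that by simp
  define P where "P k i = coord F n e (f k) i" for k i
  define Z where "Z i k = coord F n f (z \<otimes> e i) k" for i k
  have P: "P k i \<in> F" if "k < n" "i < n" for k i
    unfolding P_def by (rule coord_span(1)[OF F fe]) (use that in auto)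
  have Z: "Z i k \<in> F" if "k < n" "i < n" for k i
    unfolding Z_def by (rule coord_span(1)[OF F]) (use that z ef in auto)
  note ec = lin_indep_carrier[OF e] and fc = lin_indep_carrier[OF f]
  have PX: "coord F n f (z \<otimes> f k) k = lincomb n (\<lambda>i. P k i \<otimes> Z i k) (\<lambda>_. \<one>)" if k: "k < n" for k
  proof -
    have "z \<otimes> f k = z \<otimes> lincomb n (P k) e"
      unfolding P_def using coord_span(2)[OF F fe[OF k]] by simp
    also have "\<dots> = lincomb n (P k) (\<lambda>i. z \<otimes> e i)"
      by (rule mult_lincomb) (use z P k ec in auto)
    also have "coord F n f \<dots> k = lincomb n (P k) (\<lambda>i. Z i k)"
      unfolding Z_def by (rule coord_lincomb[OF f]) (use z P k ef in auto)
    also have "\<dots> = lincomb n (\<lambda>i. P k i \<otimes> Z i k) (\<lambda>_. \<one>)"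
      by (rule lincomb_ones) (use P Z k in auto)
    finally show ?thesis .
  qed
  have XP: "coord F n e (z \<otimes> e i) i = lincomb n (\<lambda>_. \<one>) (\<lambda>k. P k i \<otimes> Z i k)" if i: "i < n" for i
  proof -
    have "z \<otimes> e i = lincomb n (Z i) f"
      unfolding Z_def using coord_span(2)[OF F, of "z \<otimes> e i" n f] z ef i by simp
    also have "coord F n e \<dots> i = lincomb n (Z i) (\<lambda>k. P k i)"
      unfolding P_def by (rule coord_lincomb[OF e]) (use Z fe i in auto)
    also have "\<dots> = lincomb n (\<lambda>k. P k i) (Z i)"
      by (rule lincomb_comm) (use P Z i in auto)
    also have "\<dots> = lincomb n (\<lambda>_. \<one>) (\<lambda>k. P k i \<otimes> Z i k)"
      by (rule lincomb_ones) (use P Z i in auto)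
    finally show ?thesis .
  qed
  have "basis_trace n f z = lincomb n (\<lambda>_. \<one>) (\<lambda>k. lincomb n (\<lambda>i. P k i \<otimes> Z i k) (\<lambda>_. \<one>))"
    unfolding basis_trace_def by (rule lincomb_cong) (auto simp: PX)
  also have "\<dots> = lincomb n (\<lambda>i. lincomb n (\<lambda>_. \<one>) (\<lambda>k. P k i \<otimes> Z i k)) (\<lambda>_. \<one>)"
    by (rule lincomb_lincomb) (use P Z in auto)
  also have "\<dots> = lincomb n (\<lambda>i. coord F n e (z \<otimes> e i) i) (\<lambda>_. \<one>)"
    by (rule lincomb_cong) (auto simp: XP)
  also have "\<dots> = basis_trace n e z"
    unfolding basis_trace_def by (rule lincomb_comm) (use coord_span(1)[OF F z(2)] in auto)
  finally show ?thesis by simp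
qed

end

subsection \<open>Adjoining a radical\<close>


lemma (in cring) lin_indep_1: "lin_indep F n (\<lambda>i. \<one> \<otimes> y [^] i) \<longleftrightarrow> lin_indep F n (\<lambda>i. y [^] i)"
  if "y \<in> carrier R"
  using that by simp

context cring_subfield
begin

lemma lin_span_add:
  assumes "\<And>j. j < n \<Longrightarrow> e j \<in> carrier L" "u \<in> lin_span F n e" "v \<in> lin_span F n e"
  shows "u \<oplus> v \<in> lin_span F n e"
proof -
  note u = coord_span[OF F assms(2)] and v = coord_span[OF F assms(3)]
  have "lincomb n (\<lambda>i. coord F n e u i \<oplus> coord F n e v i) e = u \<oplus> v"
    by (subst lincomb_add) (use u v assms(1) in auto)
  moreover have "lincomb n (\<lambda>i. coord F n e u i \<oplus> coord F n e v i) e \<in> lin_span F n e"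
    by (rule lincomb_in_span[OF F]) (use u v in auto)
  ultimately show ?thesis by simp
qed

lemma lin_span_smult:
  assumes "\<And>j. j < n \<Longrightarrow> e j \<in> carrier L" "a \<in> F" "v \<in> lin_span F n e"
  shows "a \<otimes> v \<in> lin_span F n e"
proof -
  note v = coord_span[OF F assms(3)]
  have "lincomb n (\<lambda>i. a \<otimes> coord F n e v i) e = a \<otimes> v"
    by (subst lincomb_smult) (use v assms(1,2) in auto)
  moreover have "lincomb n (\<lambda>i. a \<otimes> coord F n e v i) e \<in> lin_span F n e"
    by (rule lincomb_in_span[OF F]) (use v assms(2) in auto)
  ultimately show ?thesis by simp
qed

lemma lin_span_zero: "\<zero> \<in> lin_span F n e" if "\<And>j. j < n \<Longrightarrow> e j \<in> carrier L"
proof -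
  have "lincomb n (\<lambda>_. \<zero>) e = \<zero>"
    by (rule lincomb_zero) (use that in auto)
  then show ?thesis
    using lincomb_in_span[OF F, of n "\<lambda>_. \<zero>" e] by simp
qed

lemma lin_span_base:
  assumes "\<And>j. j < n \<Longrightarrow> e j \<in> carrier L" "j < n"
  shows "e j \<in> lin_span F n e"
proof -
  have "lincomb n (\<lambda>i. if i = j then \<one> else \<zero>) e = e j"
    using lincomb_single[of j n "\<lambda>i. if i = j then \<one> else \<zero>" e] assms by simp
  then show ?thesis
    using lincomb_in_span[OF F, of n "\<lambda>i. if i = j then \<one> else \<zero>" e] by simp
qed

lemma lin_indep_Suc:
  assumes "lin_indep F n e" "e n \<in> carrier L" "e n \<notin> lin_span F n e"
  shows "lin_indep F (Suc n) e"
  unfolding lin_indep_def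
proof (intro conjI allI impI)
  show "e i \<in> carrier L" if "i < Suc n" for i
    using that assms(2) lin_indep_carrier[OF assms(1)] by (cases "i = n") auto
  fix c i assume c: "\<forall>i<Suc n. c i \<in> F" and 0: "lincomb (Suc n) c e = \<zero>" and i: "i < Suc n"
  note ec = lin_indep_carrier[OF assms(1)]
  have lc: "lincomb n c e \<in> carrier L" "c n \<in> F" using c ec by auto
  have "c n = \<zero>"
  proof (rule ccontr)
    assume nz: "c n \<noteq> \<zero>"
    have u: "inv (c n) \<in> F" "inv (c n) \<otimes> c n = \<one>"
      using F_inv[OF lc(2) nz] F_Units[OF lc(2) nz] by auto
    have "c n \<otimes> e n = \<ominus> lincomb n c e"
      using minus_equality[of "lincomb n c e" "c n \<otimes> e n"] 0 lc assms(2) minus_minus[of "c n \<otimes> e n"]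
      by simp
    then have "inv (c n) \<otimes> (c n \<otimes> e n) = inv (c n) \<otimes> (\<ominus> \<one> \<otimes> lincomb n c e)"
      using lc by (simp add: l_minus)
    then have "e n = (inv (c n) \<otimes> \<ominus> \<one>) \<otimes> lincomb n c e"
      using u lc assms(2) by (simp flip: m_assoc)
    also have "\<dots> \<in> lin_span F n e"
      by (rule lin_span_smult) (use ec u c in \<open>auto intro!: lincomb_in_span[OF F]\<close>)
    finally show False using assms(3) by simp
  qed
  moreover from this have "lincomb n c e = \<zero>"
    using 0 lc assms(2) by simp
  ultimately show "c i = \<zero>"
    using lin_indepD[OF assms(1), of c i] c i by (cases "i = n") auto
qed

lemma lin_indep_mono: "lin_indep F m e" if "lin_indep F n e" "m \<le> n"
  unfolding lin_indep_def
proof (intro conjI allI impI)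
  show "e i \<in> carrier L" if "i < m" for i
    using that \<open>m \<le> n\<close> lin_indep_carrier[OF \<open>lin_indep F n e\<close>] by simp
  fix c i assume c: "\<forall>i<m. c i \<in> F" and 0: "lincomb m c e = \<zero>" and i: "i < m"
  let ?c = "\<lambda>i. if i < m then c i else \<zero>"
  have "lincomb (m + d) ?c e = \<zero>" if "m + d \<le> n" for d
    using that
  proof (induct d)
    case 0
    then show ?case using \<open>lincomb m c e = \<zero>\<close> lincomb_cong[of m ?c c e e] by simp
  next
    case (Suc d)
    then show ?case using lin_indep_carrier[OF \<open>lin_indep F n e\<close>] by simp
  qed
  from this[of "n - m"] \<open>m \<le> n\<close> have "lincomb n ?c e = \<zero>" by simp
  from lin_indepD[OF \<open>lin_indep F n e\<close> _ this, of i] c i \<open>m \<le> n\<close> show "c i = \<zero>" by auto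
qed

text \<open>Stands in for a minimal polynomial: \<open>e m\<close> is the first vector that depends
  on its predecessors, so for powers of an element \<open>m\<close> plays the part of the degree.
  The value \<open>m = 0\<close> can occur and has to be excluded at each use.\<close>

lemma lin_indep_maximal:
  assumes "\<not> lin_indep F n e" "\<And>i. i < n \<Longrightarrow> e i \<in> carrier L"
  obtains m where "m < n" "lin_indep F m e" "e m \<in> lin_span F m e"
proof -
  define m where "m = (LEAST m. \<not> lin_indep F (Suc m) e)"
  have 0: "lin_indep F 0 e" by (simp add: lin_indep_def)
  with assms obtain k where k: "n = Suc k" by (cases n) auto
  then have "\<not> lin_indep F (Suc k) e" using assms by simp
  then have m: "\<not> lin_indep F (Suc m) e" "m \<le> k"
    unfolding m_def by (rule LeastI, rule Least_le)
  have "lin_indep F m e"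
  proof (cases m)
    case (Suc j)
    then show ?thesis using not_less_Least[of j "\<lambda>m. \<not> lin_indep F (Suc m) e"] m_def by auto
  qed (simp add: 0)
  with m lin_indep_Suc[of m e] assms(2)[of m] k that[of m] show thesis by auto
qed

text \<open>Since \<open>y\<^sup>n\<close> falls back into the span, the span is stable under
  \<open>y\<close>, hence under all powers of \<open>y\<close> and their combinations.\<close>

lemma power_span_mult:
  assumes y: "y \<in> carrier L" "y [^] n \<in> lin_span F n (\<lambda>i. y [^] i)"
    and u: "u \<in> lin_span F n (\<lambda>i. y [^] i)" and v: "v \<in> lin_span F n (\<lambda>i. y [^] i)"
  shows "u \<otimes> v \<in> lin_span F n (\<lambda>i. y [^] i)"
proof -
  let ?V = "lin_span F n (\<lambda>i. y [^] i)"
  have step: "y \<otimes> y [^] j \<in> ?V" if "j < n" for j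
  proof (cases "Suc j < n")
    case True
    then show ?thesis
      using lin_span_base[of n "\<lambda>i. y [^] i" "Suc j"] y by (simp add: m_comm)
  next
    case False
    then have "n = Suc j" using that by simp
    then show ?thesis using y by (simp add: m_comm)
  qed
  have pw: "y [^] j \<otimes> v \<in> ?V" for j :: nat
  proof (induct j)
    case 0
    then show ?case using v lin_span_closed[OF F, of n "\<lambda>i. y [^] i" v] y by simp
  next
    case (Suc j)
    have "y \<otimes> (y [^] j \<otimes> v) \<in> ?V"
      by (rule mult_span) (use y step Suc in auto)
    then show ?case
      using y v lin_span_closed[OF F, of n "\<lambda>i. y [^] i" v] by (simp add: m_ac)
  qed
  note d = coord_span[OF F u]
  have vc: "v \<in> carrier L" using v lin_span_closed[OF F, of n "\<lambda>i. y [^] i" v] y by simp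
  have "u \<otimes> v = v \<otimes> u" using u v vc lin_span_closed[OF F, of n "\<lambda>i. y [^] i" u] y by (simp add: m_comm)
  also have "\<dots> = v \<otimes> lincomb n (coord F n (\<lambda>i. y [^] i) u) (\<lambda>i. y [^] i)"
    using d(2) by simp
  also have "\<dots> = lincomb n (coord F n (\<lambda>i. y [^] i) u) (\<lambda>i. v \<otimes> y [^] i)"
    by (rule mult_lincomb) (use d(1) y vc in auto)
  also have "\<dots> \<in> ?V"
  proof (rule lincomb_mem)
    show "\<zero> \<in> ?V" using lin_span_zero y by simp
    show "u \<oplus> v \<in> ?V" if "u \<in> ?V" "v \<in> ?V" for u v
      using lin_span_add[OF _ that] y by simp
    show "coord F n (\<lambda>i. y [^] i) u i \<otimes> (v \<otimes> y [^] i) \<in> ?V" if "i < n" for i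
      using lin_span_smult[of n "\<lambda>i. y [^] i" "coord F n (\<lambda>i. y [^] i) u i" "v \<otimes> y [^] i"]
        that d(1) y pw[of i] vc by (simp add: m_comm)
  qed
  finally show ?thesis .
qed

lemma subfield_in_power_span: "a \<in> F \<Longrightarrow> n > 0 \<Longrightarrow> y \<in> carrier L \<Longrightarrow> a \<in> lin_span F n (\<lambda>i. y [^] i)"
  using lin_span_smult[of n "\<lambda>i. y [^] i" a "\<one>"] lin_span_base[of n "\<lambda>i. y [^] i" 0] by simp

lemma generator_in_power_span:
  assumes "y \<in> carrier L" "y [^] n \<in> lin_span F n (\<lambda>i. y [^] i)" "n > 0"
  shows "y \<in> lin_span F n (\<lambda>i. y [^] i)"
proof (cases "n = 1")
  case False
  then show ?thesis using lin_span_base[of n "\<lambda>i. y [^] i" 1] assms by simp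
qed (use assms in simp)

text \<open>The vectors \<open>v y\<^sup>i\<close> span \<open>v V\<close>; their independence makes this all of \<open>V\<close>, so it contains \<open>1\<close>.\<close>

lemma power_span_subfield:
  assumes y: "y \<in> carrier L" "y [^] n \<in> lin_span F n (\<lambda>i. y [^] i)" and n: "n > 0"
    and ind: "\<And>v. v \<in> lin_span F n (\<lambda>i. y [^] i) \<Longrightarrow> v \<noteq> \<zero> \<Longrightarrow> lin_indep F n (\<lambda>i. v \<otimes> y [^] i)"
  shows "subfield (lin_span F n (\<lambda>i. y [^] i)) L"
proof -
  let ?e = "\<lambda>i::nat. y [^] i"
  let ?V = "lin_span F n ?e"
  have Vc: "?V \<subseteq> carrier L" using lin_span_closed[OF F, of n ?e] y by auto
  have one: "\<one> \<in> ?V" using subfield_in_power_span[of \<one> n y] n y by simp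
  have e: "lin_indep F n ?e" using ind[OF one] lin_indep_1[OF y(1)] by simp
  have inv: "\<exists>u\<in>?V. v \<otimes> u = \<one>" if v: "v \<in> ?V" "v \<noteq> \<zero>" for v
  proof -
    have "lin_span F n (\<lambda>i. v \<otimes> y [^] i) = ?V"
    proof (rule lin_indep_spans[OF F e ind[OF v]])
      fix i assume "i < n"
      then show "v \<otimes> y [^] i \<in> ?V"
        using power_span_mult[OF y v(1)] lin_span_base[of n ?e i] y by simp
    qed
    with one have 1: "\<one> \<in> lin_span F n (\<lambda>i. v \<otimes> y [^] i)" by simp
    define u where "u = lincomb n (coord F n (\<lambda>i. v \<otimes> y [^] i) \<one>) ?e"
    note d = coord_span[OF F 1]
    have "u \<in> ?V" unfolding u_def by (rule lincomb_in_span[OF F d(1)])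
    moreover have "v \<otimes> u = lincomb n (coord F n (\<lambda>i. v \<otimes> y [^] i) \<one>) (\<lambda>i. v \<otimes> ?e i)"
      unfolding u_def by (rule mult_lincomb) (use d v Vc y in auto)
    ultimately show ?thesis using d(2) by auto
  qed
  have sub: "subring ?V L"
  proof (rule subringI)
    show "\<ominus> v \<in> ?V" if "v \<in> ?V" for v
      using lin_span_smult[of n ?e "\<ominus> \<one>" v] that y Vc by (auto simp: l_minus)
  qed (use Vc one power_span_mult[OF y] lin_span_add[of n ?e] y in auto)
  show ?thesis
  proof (rule subfieldI)
    show "subcring ?V L"
      using subcringI[OF sub] m_comm Vc by auto
    show "Units (L\<lparr>carrier := ?V\<rparr>) = ?V - {\<zero>}"
    proof
      show "Units (L\<lparr>carrier := ?V\<rparr>) \<subseteq> ?V - {\<zero>}"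
      proof
        fix u assume "u \<in> Units (L\<lparr>carrier := ?V\<rparr>)"
        then obtain w where "u \<in> ?V" "w \<in> ?V" "w \<otimes> u = \<one>" by (auto simp: Units_def)
        moreover from this have "w \<in> carrier L" using Vc by auto
        ultimately show "u \<in> ?V - {\<zero>}" using r_null[of w] F_one_not_zero by (metis Diff_iff singletonD)
      qed
      show "?V - {\<zero>} \<subseteq> Units (L\<lparr>carrier := ?V\<rparr>)"
      proof
        fix v assume v: "v \<in> ?V - {\<zero>}"
        then obtain u where u: "u \<in> ?V" "v \<otimes> u = \<one>" using inv by auto
        with v have "u \<otimes> v = \<one>" using Vc m_comm[of u v] by auto
        with u v show "v \<in> Units (L\<lparr>carrier := ?V\<rparr>)" by (auto simp: Units_def)
      qed
    qed
  qed
qed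

text \<open>Bezout: with m s = p t + 1, b = b^(m s) / b^(p t) = (a^s / b^t)^p.\<close>

lemma (in cring) pow_coprime_root:
  assumes "a \<in> carrier R" "b \<in> Units R" "a [^] p = b [^] m" "coprime m p" "m > 0"
  shows "\<exists>(s::nat) (t::nat). (a [^] s \<otimes> inv b [^] t) [^] (p::nat) = b"
proof -
  obtain s t where st: "m * s = p * t + 1"
    using bezout_nat[of m p] assms(4,5) by (auto simp: coprime_iff_gcd_eq_1)
  have bc: "b \<in> carrier R" using assms by auto
  have "(a [^] s) [^] p = (a [^] p) [^] s"
    using assms(1) by (simp add: nat_pow_pow mult.commute)
  also have "\<dots> = b [^] (p * t + 1)"
    unfolding assms(3) nat_pow_pow[OF bc] st ..
  also have "\<dots> = (b [^] t) [^] p \<otimes> b"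
    using bc by (simp add: nat_pow_pow mult.commute)
  finally have "(a [^] s \<otimes> inv b [^] t) [^] p = ((b [^] t) [^] p \<otimes> b) \<otimes> (inv b [^] t) [^] p"
    using assms by (simp add: nat_pow_distrib)
  also have "\<dots> = ((b [^] t) [^] p \<otimes> (inv b [^] t) [^] p) \<otimes> b"
    using bc assms(2) by (simp add: m_ac)
  also have "(b [^] t) [^] p \<otimes> (inv b [^] t) [^] p = ((b \<otimes> inv b) [^] t) [^] p"
    using bc assms(2) by (simp only: nat_pow_distrib nat_pow_closed Units_inv_closed)
  finally have "(a [^] s \<otimes> inv b [^] t) [^] p = b"
    using bc assms(2) by simp
  then show ?thesis by (intro exI)
qed

lemma basis_norm_pow:
  assumes e: "lin_indep F n e" and r: "\<And>j. j < n \<Longrightarrow> r \<otimes> e j \<in> lin_span F n e" "r \<in> carrier L"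
  shows "basis_norm n e (r [^] (k::nat)) = basis_norm n e r [^] k"
    "\<And>j. j < n \<Longrightarrow> r [^] k \<otimes> e j \<in> lin_span F n e"
proof (induct k)
  case 0
  show "basis_norm n e (r [^] (0::nat)) = basis_norm n e r [^] (0::nat)"
    by (simp add: basis_norm_scalar[OF e])
  show "\<And>j. j < n \<Longrightarrow> r [^] (0::nat) \<otimes> e j \<in> lin_span F n e"
    using single_in_span[OF e, of \<one>] by simp
next
  case (Suc k)
  show "basis_norm n e (r [^] Suc k) = basis_norm n e r [^] Suc k"
    using basis_norm_mult[OF e Suc(2) _ r] Suc(1) r(2) by simp
  show "r [^] Suc k \<otimes> e j \<in> lin_span F n e" if "j < n" for j
    using mult_span[OF lin_indep_carrier[OF e] r Suc(2)[OF that]] that r(2) lin_indep_carrier[OF e]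
    by (simp add: m_ac)
qed

text \<open>
  If \<open>v, v y, \<dots>, v y\<^sup>m\<close> are dependent for a least \<open>m < p\<close>, then the norm of \<open>y\<close> on the span of
  the first \<open>m\<close> of them is a \<open>p\<close>-th root of \<open>b\<^sup>m\<close>, and \<open>m\<close> is prime to \<open>p\<close>.
\<close>

lemma radical_lin_indep:
  assumes p: "Factorial_Ring.prime (p::nat)" and y: "y \<in> carrier L" "y [^] p = b"
    and b: "b \<in> F" "b \<noteq> \<zero>" "\<And>c. c \<in> F \<Longrightarrow> c [^] p \<noteq> b"
    and v: "v \<in> carrier L" "v \<noteq> \<zero>"
  shows "lin_indep F p (\<lambda>i. v \<otimes> y [^] i)"
proof (rule ccontr)
  let ?e = "\<lambda>i::nat. v \<otimes> y [^] i"
  assume "\<not> lin_indep F p ?e"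
  then obtain m where m: "m < p" "lin_indep F m ?e" "?e m \<in> lin_span F m ?e"
    by (rule lin_indep_maximal) (use y v in auto)
  have "m > 0"
  proof (rule ccontr)
    assume "\<not> m > 0"
    with m(3) v y show False by (auto simp: lin_span_def)
  qed
  \<comment> \<open>Stability under \<open>y\<close> is exactly what the first dependence provides:
    the last basis vector goes to \<open>?e m\<close>, which lies in the span.\<close>
  have st: "y \<otimes> ?e j \<in> lin_span F m ?e" if "j < m" for j
  proof (cases "Suc j = m")
    case True
    have "y \<otimes> ?e j = ?e m" unfolding True[symmetric] using y v by (simp add: m_ac)
    then show ?thesis using m(3) by simp
  next
    case False
    then show ?thesis using lin_span_base[of m ?e "Suc j"] that y v by (simp add: m_ac)
  qed
  have "basis_norm m ?e y [^] p = b [^] m"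
    using basis_norm_pow(1)[OF m(2) st y(1), of p] y basis_norm_scalar[OF m(2) b(1)] by simp
  moreover have N: "basis_norm m ?e y \<in> F"
    by (rule basis_norm_closed[OF m(2) st])
  moreover have "coprime m p"
    using p m(1) \<open>m > 0\<close> by (metis coprime_commute nat_dvd_not_less prime_imp_coprime_nat)
  ultimately obtain s t :: nat where "(basis_norm m ?e y [^] s \<otimes> inv b [^] t) [^] p = b"
    using pow_coprime_root[OF _ F_Units, of "basis_norm m ?e y" b p m] b \<open>m > 0\<close> by auto
  moreover have "basis_norm m ?e y [^] s \<otimes> inv b [^] t \<in> F"
    using N F_inv b by simp
  ultimately show False using b(3) by blast
qed

lemma radical_subfield:
  assumes p: "Factorial_Ring.prime (p::nat)" and y: "y \<in> carrier L" "y [^] p = b"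
    and b: "b \<in> F" "b \<noteq> \<zero>" "\<And>c. c \<in> F \<Longrightarrow> c [^] p \<noteq> b"
  shows "subfield (lin_span F p (\<lambda>i. y [^] i)) L" "lin_indep F p (\<lambda>i. y [^] i)"
    "y \<in> lin_span F p (\<lambda>i. y [^] i)" "F \<subseteq> lin_span F p (\<lambda>i. y [^] i)"
proof -
  let ?V = "lin_span F p (\<lambda>i. y [^] i)"
  have p0: "p > 0" using p prime_gt_0_nat by blast
  have bV: "y [^] p \<in> ?V" using subfield_in_power_span[OF b(1) p0 y(1)] y by simp
  show "subfield ?V L"
    by (rule power_span_subfield[OF y(1) bV p0 radical_lin_indep[OF p y b]])
      (use lin_span_closed[OF F, of p "\<lambda>i. y [^] i"] y in auto)
  show "lin_indep F p (\<lambda>i. y [^] i)"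
    using radical_lin_indep[OF p y b, of \<one>] lin_indep_1[OF y(1)] by simp
  show "y \<in> ?V" by (rule generator_in_power_span[OF y(1) bV p0])
  show "F \<subseteq> ?V" using subfield_in_power_span[OF _ p0 y(1)] by auto
qed

lemma power_span_subfield_domain:
  assumes dom: "\<And>u v. u \<in> carrier L \<Longrightarrow> v \<in> carrier L \<Longrightarrow> u \<otimes> v = \<zero> \<Longrightarrow> u = \<zero> \<or> v = \<zero>"
    and y: "y \<in> carrier L" "y [^] n \<in> lin_span F n (\<lambda>i. y [^] i)" and n: "n > 0"
  obtains m where "0 < m" "m \<le> n" "lin_indep F m (\<lambda>i. y [^] i)"
    "subfield (lin_span F m (\<lambda>i. y [^] i)) L" "y \<in> lin_span F m (\<lambda>i. y [^] i)"
    "F \<subseteq> lin_span F m (\<lambda>i. y [^] i)"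
proof -
  let ?e = "\<lambda>i::nat. y [^] i"
  have "\<not> lin_indep F (Suc n) ?e"
  proof
    assume ind: "lin_indep F (Suc n) ?e"
    have "Suc n \<le> n"
    proof (rule lin_indep_le[OF F ind])
      show "lin_indep F n ?e" by (rule lin_indep_mono[OF ind]) simp
      fix i assume "i < Suc n"
      then show "?e i \<in> lin_span F n ?e"
        using lin_span_base[of n ?e i] y by (cases "i = n") auto
    qed (use y in simp)
    then show False by simp
  qed
  then obtain m where m: "m < Suc n" "lin_indep F m ?e" "?e m \<in> lin_span F m ?e"
    by (rule lin_indep_maximal) (use y in auto)
  have m0: "m > 0"
  proof (rule ccontr)
    assume "\<not> m > 0"
    with m(3) y show False by (auto simp: lin_span_def)
  qed
  have "subfield (lin_span F m ?e) L"
  proof (rule power_span_subfield[OF y(1) m(3) m0])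
    fix v assume v: "v \<in> lin_span F m ?e" "v \<noteq> \<zero>"
    have vc: "v \<in> carrier L" using lin_span_closed[OF F, of m ?e] v y by simp
    show "lin_indep F m (\<lambda>i. v \<otimes> ?e i)"
      unfolding lin_indep_def
    proof (intro conjI allI impI)
      fix c i assume c: "\<forall>i<m. c i \<in> F" "lincomb m c (\<lambda>i. v \<otimes> ?e i) = \<zero>" and i: "i < m"
      then have "v \<otimes> lincomb m c ?e = \<zero>"
        using mult_lincomb[of v m c ?e] vc y by simp
      moreover have "lincomb m c ?e \<in> carrier L" using c y by simp
      ultimately have "lincomb m c ?e = \<zero>"
        using dom vc v(2) by blast
      from lin_indepD[OF m(2) _ this i] c show "c i = \<zero>" by simp
    qed (use vc y in simp)
  qed
  then show thesis
    using that[OF m0 _ m(2)] m(1) generator_in_power_span[OF y(1) m(3) m0]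
      subfield_in_power_span[OF _ m0 y(1)] by auto
qed

text \<open>Two computations of one trace. In the basis of powers of \<open>z\<close>,
  multiplication by \<open>z\<close> sends each basis vector to a multiple of another one, as
  \<open>q > 1\<close>, so the trace vanishes. In the basis of powers of \<open>y\<close> every
  diagonal entry is the constant coordinate of \<open>z\<close>, so the trace is q times that
  coordinate.\<close>

lemma radical_trace_zero:
  assumes q: "q > 1" and y: "y \<in> carrier L" "y [^] q \<in> F" "lin_indep F q (\<lambda>i. y [^] i)"
    and z: "z \<in> lin_span F q (\<lambda>i. y [^] i)" "z [^] q \<in> F" "lin_indep F q (\<lambda>i. z [^] i)"
  shows "lincomb q (\<lambda>_. \<one>) (\<lambda>_. coord F q (\<lambda>i. y [^] i) z 0) = \<zero>"
proof -
  let ?e = "\<lambda>i::nat. y [^] i" and ?f = "\<lambda>i::nat. z [^] i"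
  let ?V = "lin_span F q ?e"
  have yV: "y [^] q \<in> ?V" using subfield_in_power_span[OF y(2) _ y(1)] q by simp
  have zc: "z \<in> carrier L" using lin_span_closed[OF F, of q ?e] z y by simp
  have zi: "?f i \<in> ?V" for i
  proof (induct i)
    case 0
    then show ?case using subfield_in_power_span[of \<one> q y] q y by simp
  next
    case (Suc i)
    then show ?case using power_span_mult[OF y(1) yV _ z(1)] by simp
  qed
  have Vz: "lin_span F q ?f = ?V"
    by (rule lin_indep_spans[OF F y(3) z(3)]) (rule zi)
  have "basis_trace q ?e z = basis_trace q ?f z"
  proof (rule basis_trace_eq[OF y(3) z(3) Vz[symmetric] zc])
    fix i assume "i < q"
    then show "z \<otimes> ?e i \<in> ?V"
      using power_span_mult[OF y(1) yV z(1)] lin_span_base[of q ?e i] y by simp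
  qed
  also have "\<dots> = \<zero>"
    unfolding basis_trace_def
  proof (rule lincomb_zero)
    fix i assume i: "i < q"
    have "coord F q ?f (z \<otimes> ?f i) i = \<zero>"
    proof (cases "Suc i = q")
      case True
      then have "z \<otimes> ?f i = z [^] q \<otimes> ?f 0" using zc by (auto simp: m_comm)
      then show ?thesis
        using coord_single[OF z(3), of 0 "z [^] q" i] z(2) i q True by simp
    next
      case False
      then have "z \<otimes> ?f i = \<one> \<otimes> ?f (Suc i)" using zc by (auto simp: m_comm)
      then show ?thesis
        using coord_single[OF z(3), of "Suc i" \<one> i] i False by simp
    qed
    then show "\<one> \<otimes> coord F q ?f (z \<otimes> ?f i) i = \<zero>" by simp
  qed
  also have "basis_trace q ?e z = lincomb q (\<lambda>_. \<one>) (\<lambda>_. coord F q ?e z 0)"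
    unfolding basis_trace_def
  proof (rule lincomb_cong)
    fix i assume i: "i < q"
    note d = coord_span[OF F z(1)]
    \<comment> \<open>Exponents wrap around at \<open>q\<close> at the cost of the scalar
      \<open>y\<^sup>q\<close>; only \<open>j = 0\<close> sends the i-th vector to a multiple of
      itself.\<close>
    have y1: "y [^] j \<otimes> ?e i = (if j + i < q then \<one> \<otimes> ?e (j + i) else y [^] q \<otimes> ?e (j + i - q))" for j
      using y(1) by (auto simp: nat_pow_mult)
    have cj: "coord F q ?e (y [^] j \<otimes> ?e i) i = (if j = 0 then \<one> else \<zero>)" if "j < q" for j
      unfolding y1 using coord_single[OF y(3), of "j + i" \<one> i]
        coord_single[OF y(3), of "j + i - q" "y [^] q" i] i that y(2) by auto
    have "z \<otimes> ?e i = ?e i \<otimes> lincomb q (coord F q ?e z) ?e"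
      using d(2) zc y(1) by (simp add: m_comm)
    also have "\<dots> = lincomb q (coord F q ?e z) (\<lambda>j. ?e i \<otimes> ?e j)"
      by (rule mult_lincomb) (use y d in auto)
    also have "coord F q ?e \<dots> i = lincomb q (coord F q ?e z) (\<lambda>j. coord F q ?e (?e i \<otimes> ?e j) i)"
    proof (rule coord_lincomb[OF y(3) _ _ i])
      fix j assume "j < q"
      then show "?e i \<otimes> ?e j \<in> ?V"
        using power_span_mult[OF y(1) yV] lin_span_base[of q ?e] y i by simp
    qed (use d in auto)
    also have "\<dots> = lincomb q (coord F q ?e z) (\<lambda>j. if j = 0 then \<one> else \<zero>)"
      by (rule lincomb_cong) (use cj y(1) in \<open>auto simp: m_comm\<close>)
    also have "\<dots> = lincomb q (\<lambda>j. if j = 0 then \<one> else \<zero>) (coord F q ?e z)"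
      by (rule lincomb_comm) (use d in auto)
    also have "\<dots> = coord F q ?e z 0"
      using lincomb_single[of 0 q "\<lambda>j. if j = 0 then \<one> else \<zero>" "coord F q ?e z"] q d by simp
    finally show "coord F q ?e (z \<otimes> ?e i) i = coord F q ?e z 0" .
  qed simp
  finally show ?thesis .
qed

text \<open>Hides the basis: these four properties are all that \<open>prime_step\<close> takes from
  the norm. The sign in the last one is the source of the condition on elements of order 4.\<close>

lemma radical_norm:
  assumes q: "q > 0" and y: "y \<in> carrier L" "y [^] q \<in> F" "lin_indep F q (\<lambda>i. y [^] i)"
  obtains N where "\<And>v. v \<in> lin_span F q (\<lambda>i. y [^] i) \<Longrightarrow> N v \<in> F"
    "\<And>u v. u \<in> lin_span F q (\<lambda>i. y [^] i) \<Longrightarrow> v \<in> lin_span F q (\<lambda>i. y [^] i) \<Longrightarrow> N (u \<otimes> v) = N u \<otimes> N v"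
    "\<And>a. a \<in> F \<Longrightarrow> N a = a [^] q"
    "N y = (\<ominus> \<one>) [^] (q - 1) \<otimes> y [^] q"
proof -
  let ?e = "\<lambda>i::nat. y [^] i"
  let ?V = "lin_span F q ?e"
  have yV: "y [^] q \<in> ?V" using subfield_in_power_span[OF y(2) q y(1)] .
  have st: "v \<otimes> ?e j \<in> ?V" if "v \<in> ?V" "j < q" for v j
    using power_span_mult[OF y(1) yV that(1)] lin_span_base[of q ?e j] that y by simp
  have Vc: "v \<in> carrier L" if "v \<in> ?V" for v
    using lin_span_closed[OF F, of q ?e] that y by simp
  show thesis
  proof (rule that[of "basis_norm q ?e"])
    show "basis_norm q ?e v \<in> F" if "v \<in> ?V" for v
      by (rule basis_norm_closed[OF y(3)]) (rule st[OF that])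
    show "basis_norm q ?e (u \<otimes> v) = basis_norm q ?e u \<otimes> basis_norm q ?e v"
      if "u \<in> ?V" "v \<in> ?V" for u v
      by (rule basis_norm_mult[OF y(3)]) (simp_all add: st that Vc)
    show "basis_norm q ?e a = a [^] q" if "a \<in> F" for a
      by (rule basis_norm_scalar[OF y(3) that])
    show "basis_norm q ?e y = (\<ominus> \<one>) [^] (q - 1) \<otimes> y [^] q"
    proof (rule basis_norm_cyclic[OF y(3)])
      show "y \<otimes> y [^] j = y [^] Suc j" for j :: nat
        using y(1) by (simp add: m_comm)
      have "y \<otimes> y [^] (q - 1) = y [^] Suc (q - 1)"
        using y(1) by (simp add: m_comm)
      then show "y \<otimes> y [^] (q - 1) = y [^] q \<otimes> y [^] (0::nat)"
        using y(1) q by simp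
    qed (use y q in auto)
  qed
qed

end

subsection \<open>Graded algebras and radical extensions\<close>


text \<open>Two units are proportional over a subfield \<open>E\<close> when they have the same class modulo \<open>E\<^sup>\<times>\<close>.\<close>

definition (in ring) proportional :: "'a set \<Rightarrow> 'a \<Rightarrow> 'a \<Rightarrow> bool" where
  "proportional E v w \<longleftrightarrow> (\<exists>c\<in>E - {\<zero>}. w = c \<otimes> v)"

lemma (in cring_subfield) subfield_cring_subfield: "subfield E L \<Longrightarrow> cring_subfield L E"
  by (intro cring_subfield.intro cring_subfield_axioms.intro is_cring)

lemma (in cring_subfield) proportional_refl: "v \<in> carrier L \<Longrightarrow> proportional F v v"
  unfolding proportional_def by (rule bexI[of _ \<one>]) auto

lemma (in cring_subfield) proportional_sym:
  assumes "v \<in> carrier L" "proportional F v w"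
  shows "proportional F w v"
proof -
  obtain c where c: "c \<in> F" "c \<noteq> \<zero>" "w = c \<otimes> v" using assms by (auto simp: proportional_def)
  have "v = inv c \<otimes> w" using c assms(1) F_Units[of c] by (simp flip: m_assoc)
  then show ?thesis using c F_inv F_inv_nz by (auto simp: proportional_def)
qed

lemma (in cring_subfield) F_mult_nz: "a \<in> F \<Longrightarrow> b \<in> F \<Longrightarrow> a \<noteq> \<zero> \<Longrightarrow> b \<noteq> \<zero> \<Longrightarrow> a \<otimes> b \<noteq> \<zero>"
  using subfieldE(5)[OF F] by blast

lemma (in cring_subfield) proportional_trans:
  assumes "u \<in> carrier L" "proportional F u v" "proportional F v w"
  shows "proportional F u w"
proof -
  obtain c d where "c \<in> F - {\<zero>}" "v = c \<otimes> u" "d \<in> F - {\<zero>}" "w = d \<otimes> v"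
    using assms by (auto simp: proportional_def)
  then have "d \<otimes> c \<in> F - {\<zero>}" "w = (d \<otimes> c) \<otimes> u"
    using assms(1) F_mult_nz by (auto simp: m_assoc)
  then show ?thesis unfolding proportional_def by blast
qed

text \<open>An additive map that kills all terms but one isolates that term. The set
  \<open>V\<close> is explicit because coordinate maps are additive only on a span.\<close>

lemma (in abelian_monoid) finsum_functional:
  assumes "finite T" "t \<in> T" "\<And>u. u \<in> T \<Longrightarrow> f u \<in> V" "V \<subseteq> carrier G" "\<zero> \<in> V"
    and "\<And>u v. u \<in> V \<Longrightarrow> v \<in> V \<Longrightarrow> u \<oplus> v \<in> V"
    and add: "\<And>u v. u \<in> V \<Longrightarrow> v \<in> V \<Longrightarrow> \<phi> (u \<oplus> v) = \<phi> u \<oplus> \<phi> v"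
    and zero: "\<phi> \<zero> = \<zero>" and \<phi>: "\<phi> (f t) \<in> carrier G"
    and other: "\<And>u. u \<in> T \<Longrightarrow> u \<noteq> t \<Longrightarrow> \<phi> (f u) = \<zero>"
  shows "\<phi> (\<Oplus>u\<in>T. f u) = \<phi> (f t)" "(\<Oplus>u\<in>T. f u) \<in> V"
proof -
  have *: "(\<Oplus>u\<in>S. f u) \<in> V \<and> \<phi> (\<Oplus>u\<in>S. f u) = \<zero>" if "S \<subseteq> T - {t}" for S
    using finite_subset[OF that finite_Diff[OF assms(1)]] that
  proof (induct S rule: finite_induct)
    case (insert s S)
    have fV: "f s \<in> V" "\<And>u. u \<in> S \<Longrightarrow> f u \<in> V" using insert assms(3) by auto
    then have "(\<Oplus>u\<in>insert s S. f u) = f s \<oplus> (\<Oplus>u\<in>S. f u)"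
      using insert assms(4) by (intro finsum_insert) auto
    then show ?case using insert fV(1) other[of s] add assms(6) by auto
  qed (use assms zero in auto)
  have "(\<Oplus>u\<in>insert t (T - {t}). f u) = f t \<oplus> (\<Oplus>u\<in>T - {t}. f u)"
    by (rule finsum_insert) (use assms in auto)
  moreover have "insert t (T - {t}) = T" using assms(2) by auto
  ultimately have "(\<Oplus>u\<in>T. f u) = f t \<oplus> (\<Oplus>u\<in>T - {t}. f u)" by simp
  then show "\<phi> (\<Oplus>u\<in>T. f u) = \<phi> (f t)" "(\<Oplus>u\<in>T. f u) \<in> V"
    using *[of "T - {t}"] add[of "f t" "\<Oplus>u\<in>T - {t}. f u"] assms(3)[OF assms(2)] assms(6) \<phi> by auto
qed

text \<open>
  \<open>W\<close> is the group of homogeneous units. The map \<open>\<phi>\<close> in the last axiom stands for the projection to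
  the homogeneous component of \<open>w\<close>.
\<close>

locale graded_algebra = cring_subfield L k for L :: "'b ring" (structure) and k +
  fixes W
  assumes W_Units: "w \<in> W \<Longrightarrow> w \<in> Units L"
    and W_mult: "v \<in> W \<Longrightarrow> w \<in> W \<Longrightarrow> v \<otimes> w \<in> W"
    and W_inv: "w \<in> W \<Longrightarrow> inv w \<in> W"
    and k_W: "c \<in> k \<Longrightarrow> c \<noteq> \<zero> \<Longrightarrow> c \<in> W"
    and W_generate: "f \<in> carrier L \<Longrightarrow> \<exists>S. finite S \<and> S \<subseteq> W \<and>
      (\<forall>s\<in>S. \<forall>t\<in>S. s \<noteq> t \<longrightarrow> \<not> proportional k s t) \<and> f = (\<Oplus>s\<in>S. s)"
    and W_component: "w \<in> W \<Longrightarrow> \<exists>\<phi>. \<phi> w \<in> carrier L \<and> \<phi> w \<noteq> \<zero> \<and> \<phi> \<zero> = \<zero> \<and>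
      (\<forall>f\<in>carrier L. \<forall>g\<in>carrier L. \<phi> (f \<oplus> g) = \<phi> f \<oplus> \<phi> g) \<and>
      (\<forall>v\<in>W. \<not> proportional k w v \<longrightarrow> \<phi> v = \<zero>)"
begin

declare Units_closed [simp]

lemma W_carrier: "w \<in> W \<Longrightarrow> w \<in> carrier L"
  using W_Units by blast

lemma W_pow: "w \<in> W \<Longrightarrow> w [^] (n::nat) \<in> W"
  using k_W[of \<one>] by (induct n) (auto intro: W_mult)

lemma component:
  assumes "w \<in> W"
  obtains \<phi> where "\<phi> w \<in> carrier L" "\<phi> w \<noteq> \<zero>" "\<phi> \<zero> = \<zero>"
    "\<And>f g. f \<in> carrier L \<Longrightarrow> g \<in> carrier L \<Longrightarrow> \<phi> (f \<oplus> g) = \<phi> f \<oplus> \<phi> g"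
    "\<And>v. v \<in> W \<Longrightarrow> \<not> proportional k w v \<Longrightarrow> \<phi> v = \<zero>"
  using W_component[OF assms]
proof (elim exE conjE)
  fix \<phi>
  assume *: "\<phi> w \<in> carrier L" "\<phi> w \<noteq> \<zero>" "\<phi> \<zero> = \<zero>"
    "\<forall>f\<in>carrier L. \<forall>g\<in>carrier L. \<phi> (f \<oplus> g) = \<phi> f \<oplus> \<phi> g"
    "\<forall>v\<in>W. \<not> proportional k w v \<longrightarrow> \<phi> v = \<zero>"
  show thesis by (rule that[OF *(1-3)]) (use *(4,5) in \<open>simp_all\<close>)
qed

text \<open>The projection belonging to any \<open>t\<close> in \<open>S\<close> kills the other
  terms and leaves a nonzero value.\<close>

lemma W_indep:
  assumes "finite S" "S \<subseteq> W" "S \<noteq> {}"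
    "\<And>s t. s \<in> S \<Longrightarrow> t \<in> S \<Longrightarrow> s \<noteq> t \<Longrightarrow> \<not> proportional k s t"
  shows "(\<Oplus>s\<in>S. s) \<noteq> \<zero>"
proof
  assume 0: "(\<Oplus>s\<in>S. s) = \<zero>"
  obtain t where t: "t \<in> S" using assms by auto
  then have "t \<in> W" using assms(2) by auto
  then obtain \<phi> where \<phi>: "\<phi> t \<in> carrier L" "\<phi> t \<noteq> \<zero>" "\<phi> \<zero> = \<zero>"
    "\<And>f g. f \<in> carrier L \<Longrightarrow> g \<in> carrier L \<Longrightarrow> \<phi> (f \<oplus> g) = \<phi> f \<oplus> \<phi> g"
    "\<And>v. v \<in> W \<Longrightarrow> \<not> proportional k t v \<Longrightarrow> \<phi> v = \<zero>"
    by (rule component) (rule that)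
  have "\<phi> (\<Oplus>s\<in>S. s) = \<phi> t"
    by (rule finsum_functional(1)[OF assms(1) t, where V = "carrier L"])
      (use \<phi> assms t W_carrier in auto)
  then show False using \<phi> 0 by simp
qed

end

text \<open>
  In the application \<open>Q\<close> is the set of primes \<open>p\<close> with \<open>D[p\<^sup>\<infinity>] \<noteq> 0\<close>, and \<open>lincomb r 1 1\<close> is \<open>r \<cdot> 1\<close>.
\<close>

locale radical_extension = graded_algebra L k W for L :: "'b ring" (structure) and k W +
  fixes Q :: "nat set"
  assumes Q_root: "r \<in> Q \<Longrightarrow> z \<in> carrier L \<Longrightarrow> z [^] r = \<one> \<Longrightarrow> z \<in> k"
    and Q_char: "r \<in> Q \<Longrightarrow> lincomb r (\<lambda>_. \<one>) (\<lambda>_. \<one>) \<noteq> \<zero>"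
    and W_torsion: "w \<in> W \<Longrightarrow> \<exists>n>0. w [^] n \<in> k \<and>
      (\<forall>r. Factorial_Ring.prime r \<longrightarrow> r dvd n \<longrightarrow> r \<in> Q) \<and>
      (4 dvd n \<longrightarrow> (\<forall>i\<in>carrier L. i \<otimes> i = \<ominus> \<one> \<longrightarrow> i \<in> k))"
begin

text \<open>The quotient of \<open>x\<close> by \<open>d\<close> is an r-th root of unity, so it
  lies in \<open>k\<close> by \<open>Q_root\<close>.\<close>

lemma root_in_subfield:
  assumes E: "subfield E L" "k \<subseteq> E" and r: "r \<in> Q"
    and x: "x \<in> carrier L" "x [^] r = d [^] r" and d: "d \<in> E" "d \<noteq> \<zero>"
  shows "x \<in> E"
proof -
  interpret E: cring_subfield L E by (rule subfield_cring_subfield[OF E(1)])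
  have du: "d \<in> Units L" using E.F_Units d by simp
  have "(x \<otimes> inv d) [^] r = (d \<otimes> inv d) [^] r"
    using x d du by (simp only: nat_pow_distrib Units_closed Units_inv_closed)
  then have "x \<otimes> inv d \<in> k"
    using Q_root[OF r, of "x \<otimes> inv d"] x du by simp
  then have "x \<otimes> inv d \<otimes> d \<in> E" using E(2) d by auto
  then show ?thesis using x du by (simp add: m_assoc)
qed

text \<open>This is the hypothesis under which \<open>radical_subfield\<close> adjoins
  \<open>y\<close>. If \<open>y\<^sup>q\<close> were the q-th power of an element of
  \<open>E\<close>, then \<open>root_in_subfield\<close> would put \<open>y\<close> itself into
  \<open>E\<close>.\<close>

lemma not_power_in_subfield:
  assumes E: "subfield E L" "k \<subseteq> E" and q: "q \<in> Q" "q > 0" and y: "y \<in> Units L" "y \<notin> E"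
    and c: "c \<in> E"
  shows "c [^] q \<noteq> y [^] q"
proof
  interpret E: cring_subfield L E by (rule subfield_cring_subfield[OF E(1)])
  assume eq: "c [^] q = y [^] q"
  have "y [^] q \<noteq> \<zero>"
  proof
    assume "y [^] q = \<zero>"
    then have "inv y [^] q \<otimes> y [^] q = \<zero>" using y by simp
    moreover have "inv y [^] q \<otimes> y [^] q = (inv y \<otimes> y) [^] q"
      using y by (simp only: nat_pow_distrib Units_closed Units_inv_closed)
    ultimately show False using y F_one_not_zero by simp
  qed
  then have "c \<noteq> \<zero>" using eq q(2) by (auto simp: nat_pow_zero)
  from root_in_subfield[OF E q(1) _ eq[symmetric] c this] y show False by auto
qed

lemma radical_subfield_E:
  assumes E: "subfield E L" "k \<subseteq> E" and q: "q \<in> Q" "Factorial_Ring.prime q"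
    and y: "y \<in> Units L" "y \<notin> E" "y [^] q \<in> E"
  shows "subfield (lin_span E q (\<lambda>i. y [^] i)) L" "lin_indep E q (\<lambda>i. y [^] i)"
    "y \<in> lin_span E q (\<lambda>i. y [^] i)" "E \<subseteq> lin_span E q (\<lambda>i. y [^] i)"
proof -
  interpret E: cring_subfield L E by (rule subfield_cring_subfield[OF E(1)])
  have q0: "q > 0" using q(2) prime_gt_0_nat by blast
  note np = not_power_in_subfield[OF E q(1) q0 y(1,2)]
  have "y [^] q \<noteq> \<zero>" using np[of \<zero>] q0 by (simp add: nat_pow_zero)
  note * = E.radical_subfield[OF q(2) _ refl y(3) this np]
  show "subfield (lin_span E q (\<lambda>i. y [^] i)) L" "lin_indep E q (\<lambda>i. y [^] i)"
    "y \<in> lin_span E q (\<lambda>i. y [^] i)" "E \<subseteq> lin_span E q (\<lambda>i. y [^] i)"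
    using * y(1) by auto
qed

text \<open>Induction on the exponent: for a prime q dividing n, the power \<open>y\<^sup>q\<close>
  has the smaller exponent n / q and is adjoined first; after that \<open>y\<close> is a q-th root
  of an element of the new field.\<close>

lemma adjoin_one:
  assumes "subfield E L" "k \<subseteq> E" "y \<in> W" "y [^] (n::nat) \<in> E" "n > 0"
    "\<forall>r. Factorial_Ring.prime r \<longrightarrow> r dvd n \<longrightarrow> r \<in> Q"
  shows "\<exists>E'. subfield E' L \<and> E \<subseteq> E' \<and> y \<in> E'"
  using assms
proof (induct n arbitrary: y E rule: less_induct)
  case (less n)
  show ?case
  proof (cases "n = 1")
    case True
    then show ?thesis using less W_carrier by auto
  next
    case False
    then obtain q where q: "Factorial_Ring.prime q" "q dvd n" using prime_factor_nat by blast
    then obtain m where n: "n = q * m" by auto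
    have m: "m > 0" "m < n" using \<open>n > 0\<close> q n prime_gt_1_nat by auto
    have yc: "y \<in> carrier L" using less W_carrier by auto
    have "(y [^] q) [^] m \<in> E" using less(5) yc by (simp add: nat_pow_pow n)
    then obtain E1 where E1: "subfield E1 L" "E \<subseteq> E1" "y [^] q \<in> E1"
      using less(1)[OF m(2) less(2,3) W_pow[OF less(4)], of q] m less(7) n by auto
    show ?thesis
    proof (cases "y \<in> E1")
      case True
      then show ?thesis using E1 by auto
    next
      case False
      have kE: "k \<subseteq> E1" using less(3) E1 by auto
      have "q \<in> Q" using less(7) q by auto
      from radical_subfield_E[OF E1(1) kE this q(1) W_Units[OF less(4)] False E1(3)] E1(2)
      show ?thesis by (intro exI[of _ "lin_span E1 q (\<lambda>i. y [^] i)"]) auto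
    qed
  qed
qed

lemma adjoin_finite: "finite S \<Longrightarrow> S \<subseteq> W \<Longrightarrow> \<exists>E. subfield E L \<and> k \<subseteq> E \<and> S \<subseteq> E"
proof (induct S rule: finite_induct)
  case empty
  then show ?case using F by auto
next
  case (insert y S)
  then obtain E where E: "subfield E L" "k \<subseteq> E" "S \<subseteq> E" by auto
  obtain n :: nat where n: "n > 0" "y [^] n \<in> k" "\<forall>r. Factorial_Ring.prime r \<longrightarrow> r dvd n \<longrightarrow> r \<in> Q"
    using W_torsion[of y] insert by auto
  obtain E' where "subfield E' L" "E \<subseteq> E'" "y \<in> E'"
    using adjoin_one[OF E(1,2) _ _ n(1,3), of y] insert n(2) E by auto
  then show ?case using E by (intro exI[of _ E']) auto
qed

text \<open>An element has finitely many homogeneous components, and \<open>adjoin_finite\<close>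
  encloses them in a subfield, which contains the inverse.\<close>

lemma nonzero_Units:
  assumes "f \<in> carrier L" "f \<noteq> \<zero>"
  shows "f \<in> Units L"
proof -
  obtain S where S: "finite S" "S \<subseteq> W" "f = (\<Oplus>s\<in>S. s)"
    using W_generate[OF assms(1)] by auto
  obtain E where E: "subfield E L" "S \<subseteq> E" using adjoin_finite[OF S(1,2)] by auto
  interpret E: cring_subfield L E by (rule subfield_cring_subfield[OF E(1)])
  have "(\<Oplus>s\<in>S. s) \<in> E"
    using S(1) E(2)
  proof (induct S rule: finite_induct)
    case (insert s S)
    then have "(\<Oplus>s\<in>insert s S. s) = s \<oplus> (\<Oplus>s\<in>S. s)"
      by (intro finsum_insert) auto
    with insert show ?case by auto
  qed simp
  then show ?thesis using E.F_Units S(3) assms(2) by simp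
qed

lemma is_field: "field L"
proof (rule cring_fieldI)
  show "Units L = carrier L - {\<zero>}"
  proof
    show "Units L \<subseteq> carrier L - {\<zero>}"
    proof
      fix u assume u: "u \<in> Units L"
      have "u \<noteq> \<zero>"
        using Units_r_inv[OF u] l_null[OF Units_inv_closed[OF u]] F_one_not_zero by metis
      with u show "u \<in> carrier L - {\<zero>}" by auto
    qed
  qed (use nonzero_Units in auto)
qed

end

text \<open>From here on zero divisors are excluded, which the trace argument in
  \<open>prime_step\<close> relies on.\<close>

sublocale radical_extension \<subseteq> field L
  by (rule is_field)

subsection \<open>Homogeneous elements of a radical extension\<close>


text \<open>\<open>radical_trace_zero\<close> speaks only of the coordinate at 0. Multiplication by
  \<open>y [^] (q - j)\<close> carries the j-th coordinate there, up to the nonzero factor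
  \<open>y\<^sup>q\<close>.\<close>

lemma (in cring_subfield) coord_shift:
  assumes y: "y \<in> carrier L" "y [^] q \<in> F" "lin_indep F q (\<lambda>i. y [^] i)"
    and v: "v \<in> lin_span F q (\<lambda>i. y [^] i)" and j: "j < q"
  shows "coord F q (\<lambda>i. y [^] i) (v \<otimes> y [^] (q - j)) 0 = coord F q (\<lambda>i. y [^] i) v j \<otimes> y [^] q"
proof -
  let ?e = "\<lambda>i::nat. y [^] i"
  let ?c = "coord F q ?e v"
  note d = coord_span[OF F v]
  have q: "q > 0" using j by simp
  have vc: "v \<in> carrier L" using lin_span_closed[OF F _ v] y by simp
  have yl: "?e (q - j) \<otimes> ?e l = (if l < j then \<one> \<otimes> ?e (q - j + l) else y [^] q \<otimes> ?e (l - j))" for l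
    using y(1) j by (auto simp: nat_pow_mult)
  have cl: "coord F q ?e (?e (q - j) \<otimes> ?e l) 0 = (if l = j then y [^] q else \<zero>)" if "l < q" for l
    unfolding yl using coord_single[OF y(3), of "q - j + l" \<one> 0]
      coord_single[OF y(3), of "l - j" "y [^] q" 0] j that y(2) by auto
  have "v \<otimes> ?e (q - j) = ?e (q - j) \<otimes> lincomb q ?c ?e"
    using d(2) vc y(1) by (simp add: m_comm)
  also have "\<dots> = lincomb q ?c (\<lambda>l. ?e (q - j) \<otimes> ?e l)"
    by (rule mult_lincomb) (use y d in auto)
  also have "coord F q ?e \<dots> 0 = lincomb q ?c (\<lambda>l. coord F q ?e (?e (q - j) \<otimes> ?e l) 0)"
  proof (rule coord_lincomb[OF y(3) _ _ q])
    fix l assume "l < q"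
    then show "?e (q - j) \<otimes> ?e l \<in> lin_span F q ?e"
      unfolding yl using single_in_span[OF y(3), of \<one> "q - j + l"]
        single_in_span[OF y(3), of "y [^] q" "l - j"] y(2) j by auto
  qed (use d in auto)
  also have "\<dots> = lincomb q ?c (\<lambda>l. if l = j then y [^] q else \<zero>)"
    by (rule lincomb_cong) (use cl in auto)
  also have "\<dots> = lincomb q (\<lambda>l. if l = j then y [^] q else \<zero>) ?c"
    by (rule lincomb_comm) (use d y in auto)
  also have "\<dots> = y [^] q \<otimes> ?c j"
    using lincomb_single[of j q "\<lambda>l. if l = j then y [^] q else \<zero>" ?c] j d y by simp
  finally show ?thesis using d(1)[OF j] y by (simp add: m_comm)
qed

context radical_extension
begin

text \<open>The group \<open>W E\<^sup>\<times>\<close>.\<close>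

definition scaled :: "'b set \<Rightarrow> 'b set" where
  "scaled E = {w \<otimes> c | w c. w \<in> W \<and> c \<in> E \<and> c \<noteq> \<zero>}"

lemma scaled_Units:
  assumes "subfield E L" "v \<in> scaled E"
  shows "v \<in> Units L"
proof -
  interpret E: cring_subfield L E by (rule subfield_cring_subfield[OF assms(1)])
  show ?thesis using assms(2) E.F_Units W_Units by (auto simp: scaled_def)
qed

lemma Units_pow: "u \<in> Units L \<Longrightarrow> u [^] (n::nat) \<in> Units L"
  by (induct n) auto

lemma Units_nz: "u \<in> Units L \<Longrightarrow> u \<noteq> \<zero>"
  using field_Units by auto

lemma scaled_mult:
  assumes E: "subfield E L" and "u \<in> scaled E" "v \<in> scaled E"
  shows "u \<otimes> v \<in> scaled E"
proof -
  interpret E: cring_subfield L E by (rule subfield_cring_subfield[OF E])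
  obtain w c w' c' where "u = w \<otimes> c" "w \<in> W" "c \<in> E" "c \<noteq> \<zero>"
    and "v = w' \<otimes> c'" "w' \<in> W" "c' \<in> E" "c' \<noteq> \<zero>"
    using assms by (auto simp: scaled_def)
  moreover from this have "u \<otimes> v = (w \<otimes> w') \<otimes> (c \<otimes> c')"
    using W_carrier by (simp add: m_ac)
  moreover have "w \<otimes> w' \<in> W" "c \<otimes> c' \<in> E" "c \<otimes> c' \<noteq> \<zero>"
    using calculation W_mult E.F_mult_nz[of c c'] by simp_all
  ultimately show ?thesis
    unfolding scaled_def by blast
qed

lemma scaled_inv:
  assumes E: "subfield E L" and "u \<in> scaled E"
  shows "inv u \<in> scaled E"
proof -
  interpret E: cring_subfield L E by (rule subfield_cring_subfield[OF E])
  obtain w c where *: "u = w \<otimes> c" "w \<in> W" "c \<in> E" "c \<noteq> \<zero>"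
    using assms by (auto simp: scaled_def)
  have cu: "c \<in> Units L" using * E.F_Units by simp
  have "inv u = inv w \<otimes> inv c"
  proof -
    have wu: "w \<in> Units L" using W_Units * by simp
    have "w \<otimes> c \<otimes> (inv w \<otimes> inv c) = (w \<otimes> inv w) \<otimes> (c \<otimes> inv c)"
      using wu cu by (simp add: m_ac del: Units_r_inv Units_l_inv)
    then show ?thesis unfolding *(1) using wu cu by (intro comm_inv_char) auto
  qed
  moreover have "inv w \<in> W" "inv c \<in> E" "inv c \<noteq> \<zero>"
    using * W_inv E.F_inv E.F_inv_nz by simp_all
  ultimately show ?thesis
    unfolding scaled_def by blast
qed

lemma scaled_base: "c \<in> E \<Longrightarrow> c \<noteq> \<zero> \<Longrightarrow> subfield E L \<Longrightarrow> c \<in> scaled E"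
proof -
  assume c: "c \<in> E" "c \<noteq> \<zero>" "subfield E L"
  have "c \<in> carrier L" by (rule subsetD[OF subfieldE(3)[OF c(3)] c(1)])
  then have "c = \<one> \<otimes> c" by simp
  moreover have "\<one> \<in> W" using k_W[of \<one>] by simp
  ultimately show ?thesis using c unfolding scaled_def by blast
qed

lemma scaled_pow: "subfield E L \<Longrightarrow> u \<in> scaled E \<Longrightarrow> u [^] (n::nat) \<in> scaled E"
  using scaled_base[of \<one> E] subringE(3)[OF subfieldE(1), of E L]
  by (induct n) (auto intro: scaled_mult)

lemma scaled_mono: "E \<subseteq> E' \<Longrightarrow> scaled E \<subseteq> scaled E'"
  by (auto simp: scaled_def)

lemma inv_pow: "u \<in> Units L \<Longrightarrow> u [^] (n::nat) \<otimes> inv u [^] n = \<one>"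
  by (simp flip: nat_pow_distrib)

text \<open>
  The case \<open>v\<^sup>2 = c y\<^sup>i\<close> with \<open>i\<close> odd, where \<open>v\<close> has order divisible by \<open>4\<close> modulo \<open>E\<close>.
\<close>

lemma square_root_minus_one:
  assumes E: "subfield E L" "k \<subseteq> E" and y: "y \<in> Units L" "y \<notin> E" "y [^] (2::nat) \<in> E"
    and v: "v \<in> scaled E" "v [^] (2::nat) = c \<otimes> y [^] (i::nat)" "c \<in> E" "odd i"
    and z: "z \<in> carrier L" "z \<otimes> z = \<ominus> \<one>"
  shows "z \<in> k"
proof -
  interpret E: cring_subfield L E by (rule subfield_cring_subfield[OF E(1)])
  obtain w e where w: "v = w \<otimes> e" "w \<in> W" "e \<in> E" "e \<noteq> \<zero>"
    using v by (auto simp: scaled_def)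
  obtain n :: nat where n: "n > 0" "w [^] n \<in> k" "4 dvd n \<longrightarrow> z \<in> k"
    using W_torsion[OF w(2)] z by auto
  have wc: "w \<in> carrier L" using W_carrier w by auto
  have vn: "v [^] n \<in> E"
    using n(2) E w wc by (auto simp: nat_pow_distrib)
  have vc: "v \<in> Units L" using scaled_Units[OF E(1) v(1)] .
  have c0: "c \<noteq> \<zero>"
  proof
    assume "c = \<zero>"
    then have "v [^] (2::nat) = \<zero>" using v y by simp
    then show False using Units_nz[OF Units_pow[OF vc]] by simp
  qed
  have odd_pow: "y [^] m \<notin> E" if m: "odd m" for m :: nat
  proof
    assume "y [^] m \<in> E"
    obtain l where l: "m = 2 * l + 1" by (rule oddE[OF m])
    have "(y [^] (2::nat)) [^] l \<otimes> y \<in> E"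
      using \<open>y [^] m \<in> E\<close> y(1) by (simp add: l nat_pow_pow)
    moreover have "(y [^] (2::nat)) [^] l \<noteq> \<zero>"
      using Units_nz[OF Units_pow[OF Units_pow[OF y(1)]]] by simp
    ultimately have "y \<in> E"
      using subfield_m_inv_simprule[OF E(1), of "(y [^] (2::nat)) [^] l" y] y by auto
    with y show False by simp
  qed
  \<comment> \<open>Otherwise n is l or 2 l with l odd, so v^(2 l) = c^l y^(i l) lies in
    \<open>E\<close>; but i l is odd, against \<open>odd_pow\<close>.\<close>
  have even_half: "\<exists>l. n = 2 * l \<and> even l"
  proof (rule ccontr)
    assume "\<not> ?thesis"
    then obtain l where l: "odd l" "n = l \<or> n = 2 * l" by (metis evenE)
    have "v [^] (2 * l) \<in> E"
    proof (cases "n = l")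
      case True
      then have "v [^] (2 * l) = v [^] n \<otimes> v [^] n" using vc by (simp add: nat_pow_mult mult_2)
      then show ?thesis using vn by simp
    qed (use l vn in auto)
    then have cy: "c [^] l \<otimes> y [^] (i * l) \<in> E"
      using v vc y(1) by (simp add: nat_pow_distrib nat_pow_pow flip: nat_pow_pow[of v 2 l])
    have "c [^] l \<in> E - {\<zero>}"
      using Units_nz[OF Units_pow[OF E.F_Units[OF v(3) c0]]] v(3) by simp
    from subfield_m_inv_simprule[OF E(1) this _ cy] y(1) have "y [^] (i * l) \<in> E" by simp
    with odd_pow[of "i * l"] l(1) v(4) show False by simp
  qed
  then obtain l where "n = 2 * l" "even l" by auto
  then have "4 dvd n" by auto
  with n show ?thesis by simp
qed

text \<open>
  For \<open>r \<noteq> q\<close> the norm to \<open>E\<close> turns \<open>v\<^sup>r \<in> E\<close> into an \<open>r\<close>-th root of \<open>v\<^sup>r\<close> in \<open>E\<close>. For \<open>r = q\<close>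
  and \<open>v\<^sup>q \<in> E\<close>, some \<open>z = v y\<^bsup>q - j\<^esup>\<close> has nonzero trace, so that \<open>z\<^sup>q \<in> E\<close> forces \<open>z \<in> E\<close>. In the
  remaining case the norm of \<open>v\<close> makes \<open>\<plusminus> y\<^sup>q\<close> a \<open>q\<close>-th power in \<open>E\<close>, which only the fourth roots of
  unity could explain.
\<close>

lemma prime_step:
  assumes E: "subfield E L" "k \<subseteq> E" and q: "q \<in> Q" "Factorial_Ring.prime q"
    and y: "y \<in> Units L" "y \<notin> E" "y [^] q \<in> E"
    and v: "v \<in> lin_span E q (\<lambda>i. y [^] i)" "v \<in> scaled E"
    and r: "r \<in> Q" "Factorial_Ring.prime r" and vr: "v [^] r = c \<otimes> y [^] (i::nat)" "c \<in> E"
  shows "\<exists>a\<in>E. \<exists>j::nat. v = a \<otimes> y [^] j"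
proof -
  let ?V = "lin_span E q (\<lambda>i. y [^] i)"
  note rs = radical_subfield_E[OF E q y]
  interpret E: cring_subfield L E by (rule subfield_cring_subfield[OF E(1)])
  interpret V: cring_subfield L ?V by (rule subfield_cring_subfield[OF rs(1)])
  have q0: "q > 0" and q1: "q > 1" and r0: "r > 0"
    using q(2) r(2) prime_gt_0_nat prime_gt_1_nat by blast+
  have vu: "v \<in> Units L" using scaled_Units[OF E(1) v(2)] .
  have yc: "y \<in> carrier L" using y by simp
  have b: "y [^] q \<noteq> \<zero>" "y [^] q \<in> Units L" using Units_nz Units_pow[OF y(1)] by auto
  have c0: "c \<noteq> \<zero>"
  proof
    assume "c = \<zero>"
    then have "v [^] r = \<zero>" using vr y by simp
    then show False using Units_nz[OF Units_pow[OF vu]] by simp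
  qed
  have cu: "c \<in> Units L" using E.F_Units[OF vr(2) c0] .
  obtain N where NE: "\<And>v. v \<in> ?V \<Longrightarrow> N v \<in> E"
    and Nmult: "\<And>u v. u \<in> ?V \<Longrightarrow> v \<in> ?V \<Longrightarrow> N (u \<otimes> v) = N u \<otimes> N v"
    and Nsc: "\<And>a. a \<in> E \<Longrightarrow> N a = a [^] q"
    and Ny: "N y = (\<ominus> \<one>) [^] (q - 1) \<otimes> y [^] q"
    using E.radical_norm[OF q0 yc y(3) rs(2)] by metis
  have Npow: "N (u [^] (n::nat)) = N u [^] n" if "u \<in> ?V" for u n
    by (induct n) (simp_all add: Nsc Nmult that)
  note np = not_power_in_subfield[OF E q(1) q0 y(1,2)]
  show ?thesis
  proof (cases "r = q")
    case False
    then have "coprime r q" using q r by (simp add: primes_coprime)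
    then obtain s t where st: "r * s = q * t + 1"
      using bezout_nat[of r q] r0 by (auto simp: coprime_iff_gcd_eq_1)
    \<comment> \<open>As r s = q t + 1, the r-th power of y^(s i) is y^i times a power of y^q.
      Dividing \<open>v\<close> by y^(s i) therefore leaves an element whose r-th power is in
      \<open>E\<close>.\<close>
    let ?j = "s * i" and ?m = "t * i"
    have rj: "?j * r = i + q * ?m"
      using arg_cong[OF st, of "\<lambda>x. x * i"] by (simp add: algebra_simps)
    define v' where "v' = v \<otimes> inv y [^] ?j"
    define c' where "c' = c \<otimes> inv (y [^] q) [^] ?m"
    have c': "c' \<in> E" "c' \<noteq> \<zero>" "c' \<in> Units L"
      using vr(2) y(3) b E.F_inv cu Units_nz[of c'] Units_pow[of "inv (y [^] q)"]
      by (auto simp: c'_def)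
    have iy: "inv y \<in> ?V" by (rule V.F_inv[OF rs(3) Units_nz[OF y(1)]])
    have v'V: "v' \<in> ?V" unfolding v'_def using v(1) iy by simp
    have iq: "inv (y [^] q) = inv y [^] q"
      using inv_pow[OF y(1), of q] y(1) b by (intro comm_inv_char) auto
    have "v' [^] r = v [^] r \<otimes> inv y [^] (i + q * ?m)"
      unfolding v'_def using vu y(1) by (simp only: nat_pow_distrib nat_pow_pow rj Units_closed
          Units_inv_closed nat_pow_closed)
    also have "\<dots> = c \<otimes> (y [^] i \<otimes> inv y [^] i) \<otimes> (inv y [^] q) [^] ?m"
      using vr cu y(1) by (simp add: nat_pow_mult[symmetric] nat_pow_pow m_assoc)
    also have "\<dots> = c'"
      using cu y(1) by (simp add: inv_pow c'_def iq)
    finally have v'r: "v' [^] r = c'" .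
    \<comment> \<open>The norm of \<open>c'\<close> is its q-th power; q is prime to r, so
      \<open>c'\<close> itself becomes an r-th power in \<open>E\<close>.\<close>
    have "N v' [^] r = c' [^] q"
      using Npow[OF v'V, of r] v'r Nsc[OF c'(1)] by simp
    then obtain s' t' :: nat where e: "(N v' [^] s' \<otimes> inv c' [^] t') [^] r = c'"
      using pow_coprime_root[of "N v'" c' r q] NE[OF v'V] c' q0 \<open>coprime r q\<close>
      by (auto simp: coprime_commute)
    let ?d = "N v' [^] s' \<otimes> inv c' [^] t'"
    have d: "?d \<in> E" using NE[OF v'V] E.F_inv[OF c'(1,2)] by simp
    have "?d \<noteq> \<zero>" using e c' r0 by (auto simp: nat_pow_zero)
    from root_in_subfield[OF E r(1) _ _ d this, of v'] v'r e v'V have "v' \<in> E" by simp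
    moreover have "v = v' \<otimes> y [^] ?j"
      unfolding v'_def using vu y(1) inv_pow[OF y(1), of ?j] by (simp add: m_ac)
    ultimately show ?thesis by blast
  next
    case rq: True
    show ?thesis
    proof (cases "q dvd i")
      case True
      then obtain m where i: "i = q * m" by auto
      define c' where "c' = c \<otimes> (y [^] q) [^] m"
      have c': "c' \<in> E" "v [^] q = c'"
        using vr(2) y(3) apply (simp add: c'_def)
        using vr(1) yc by (simp add: c'_def i rq nat_pow_pow)
      note d = coord_span[OF E(1) v(1)]
      have "\<exists>j<q. coord E q (\<lambda>i. y [^] i) v j \<noteq> \<zero>"
      proof (rule ccontr)
        assume "\<not> ?thesis"
        then have "lincomb q (coord E q (\<lambda>i. y [^] i) v) (\<lambda>i. y [^] i) = \<zero>"
          by (intro lincomb_zero) (use yc in auto)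
        then show False using d(2) Units_nz[OF vu] by simp
      qed
      then obtain j where j: "j < q" "coord E q (\<lambda>i. y [^] i) v j \<noteq> \<zero>" by auto
      define z where "z = v \<otimes> y [^] (q - j)"
      have zV: "z \<in> ?V" unfolding z_def using v(1) rs(3) by simp
      have zu: "z \<in> Units L" unfolding z_def using vu Units_pow[OF y(1)] by auto
      have "(y [^] (q - j)) [^] q = (y [^] q) [^] (q - j)"
        using yc by (simp add: nat_pow_pow mult.commute)
      then have "z [^] q = c' \<otimes> (y [^] q) [^] (q - j)"
        unfolding z_def using vu yc by (simp add: nat_pow_distrib c')
      then have zq: "z [^] q \<in> E" using c' y(3) by simp
      have "z \<in> E"
      proof (rule ccontr)
        assume "z \<notin> E"
        note rz = radical_subfield_E(2)[OF E q zu this zq]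
        have 0: "lincomb q (\<lambda>_. \<one>) (\<lambda>_. coord E q (\<lambda>i. y [^] i) z 0) = \<zero>"
          by (rule E.radical_trace_zero[OF q1 yc y(3) rs(2) zV zq rz])
        let ?a = "coord E q (\<lambda>i. y [^] i) z 0"
        have a: "?a \<in> E" by (rule coord_span(1)[OF E(1) zV q0])
        have "?a = coord E q (\<lambda>i. y [^] i) v j \<otimes> y [^] q"
          unfolding z_def by (rule E.coord_shift[OF yc y(3) rs(2) v(1) j(1)])
        then have a0: "?a \<noteq> \<zero>"
          using E.F_mult_nz[OF d(1)[OF j(1)] y(3) j(2) b(1)] by simp
        have "lincomb q (\<lambda>_. \<one>) (\<lambda>_. ?a) = ?a \<otimes> lincomb q (\<lambda>_. \<one>) (\<lambda>_. \<one>)"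
          using mult_lincomb[of ?a q "\<lambda>_. \<one>" "\<lambda>_. \<one>"] a by simp
        then have "?a \<otimes> lincomb q (\<lambda>_. \<one>) (\<lambda>_. \<one>) = \<zero>" using 0 by simp
        then show False
          using integral[of ?a "lincomb q (\<lambda>_. \<one>) (\<lambda>_. \<one>)"] a a0 Q_char[OF q(1)] by simp
      qed
      then have "z \<otimes> inv (y [^] q) \<in> E" using E.F_inv[OF y(3) b(1)] by simp
      moreover have "v = z \<otimes> inv (y [^] q) \<otimes> y [^] j"
      proof -
        have "y [^] (q - j) \<otimes> y [^] j = y [^] q" using yc j by (simp add: nat_pow_mult)
        then have "z \<otimes> y [^] j = v \<otimes> y [^] q"
          unfolding z_def using vu yc by (simp add: m_assoc)
        then have "(z \<otimes> y [^] j) \<otimes> inv (y [^] q) = v"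
          using vu b by (simp add: m_assoc)
        then show ?thesis using zu b yc by (simp add: m_ac)
      qed
      ultimately show ?thesis by blast
    next
      case False
      have cop: "coprime i q"
        using False q by (metis coprime_commute prime_imp_coprime_nat)
      have i0: "i > 0" using False by (cases i) auto
      let ?b = "(\<ominus> \<one>) [^] (q - 1) \<otimes> y [^] q"
      have m1: "\<ominus> \<one> \<in> Units L"
        by (rule F_Units) (simp_all add: add.inv_eq_1_iff)
      have bE: "?b \<in> E" using y(3) by simp
      have bu: "?b \<in> Units L" using Units_pow[OF m1] b by simp
      \<comment> \<open>The norm of v^q = c y^i, where \<open>?b\<close> is the norm of
        \<open>y\<close>. Since i is prime to q, \<open>?b\<close> turns out to be a q-th power in
        \<open>E\<close>.\<close>
      have "N v [^] q = c [^] q \<otimes> ?b [^] i"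
        using Npow[OF v(1), of q] Npow[OF rs(3), of i] vr Ny rs(3,4) Nsc[OF vr(2)]
        by (auto simp: rq Nmult)
      then have "(N v \<otimes> inv c) [^] q = (c [^] q \<otimes> ?b [^] i) \<otimes> inv c [^] q"
        using NE[OF v(1)] cu by (simp add: nat_pow_distrib)
      also have "\<dots> = ?b [^] i \<otimes> (c [^] q \<otimes> inv c [^] q)"
        using cu bu by (simp add: m_ac)
      also have "\<dots> = ?b [^] i" using cu bu by (simp add: inv_pow)
      finally obtain s t :: nat where e: "((N v \<otimes> inv c) [^] s \<otimes> inv ?b [^] t) [^] q = ?b"
        using pow_coprime_root[of "N v \<otimes> inv c" ?b q i] NE[OF v(1)] cu bu cop i0 by auto
      let ?d = "(N v \<otimes> inv c) [^] s \<otimes> inv ?b [^] t"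
      have d: "?d \<in> E"
        using NE[OF v(1)] E.F_inv[OF vr(2) c0] E.F_inv[OF bE Units_nz[OF bu]] by simp
      show ?thesis
      proof (cases "q = 2")
        case False
        then have "odd q" using prime_odd_nat[OF q(2)] q1 by auto
        then obtain l where l: "q = 2 * l + 1" by (rule oddE)
        \<comment> \<open>For odd q the sign disappears, and \<open>y\<^sup>q\<close> would be a
          q-th power in \<open>E\<close>.\<close>
        have "((\<ominus> \<one>) [^] (2::nat)) [^] l = \<one>" by (simp add: numeral_2_eq_2 l_minus)
        then have "(\<ominus> \<one>) [^] (q - 1) = \<one>" by (simp add: l nat_pow_pow)
        then have "?b = y [^] q" using yc by simp
        with np[OF d] e show ?thesis by simp
      next
        case 2: True
        have bb: "?b = \<ominus> (y [^] q)" using yc by (simp add: 2 l_minus)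
        have du: "?d \<in> Units L"
        proof (rule E.F_Units[OF d])
          show "?d \<noteq> \<zero>" using e Units_nz[OF bu] q0 by (auto simp: nat_pow_zero)
        qed
        \<comment> \<open>For q = 2 only -y^2 = d^2 is known, so y / d is a square root of -1. It
          lies in \<open>k\<close> because \<open>v\<close> has order divisible by 4, and this
          forces \<open>y\<close> into \<open>E\<close>.\<close>
        let ?z = "y \<otimes> inv ?d"
        have d2: "?d [^] (2::nat) = \<ominus> (y [^] (2::nat))" using e bb 2 by simp
        have "?z \<otimes> ?z = y [^] (2::nat) \<otimes> inv ?d [^] (2::nat)"
          using yc du by (simp add: numeral_2_eq_2 m_ac)
        also have "y [^] (2::nat) = \<ominus> (?d [^] (2::nat))"
          unfolding d2 using yc by simp
        also have "\<ominus> (?d [^] (2::nat)) \<otimes> inv ?d [^] (2::nat) = \<ominus> \<one>"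
          using inv_pow[OF du, of 2] du by (simp add: l_minus)
        finally have zz: "?z \<otimes> ?z = \<ominus> \<one>" .
        have "odd i" using False 2 by simp
        have "?z \<in> k"
          by (rule square_root_minus_one[OF E y(1,2) _ v(2) _ vr(2) \<open>odd i\<close> _ zz])
            (use y(3) vr(1) rq 2 yc du in auto)
        then have "?z \<otimes> ?d \<in> E" using E(2) d by auto
        then have "y \<in> E" using yc du by (simp add: m_assoc)
        with y show ?thesis by simp
      qed
    qed
  qed
qed

text \<open>Induction on an exponent n with v^n = c y^i. For a prime r dividing n,
  \<open>prime_step\<close> applied to v^(n / r) gives an equation of the same shape with exponent n
  / r. This is why the factor y^i is carried along, although at the start v^n is in
  \<open>E\<close>.\<close>

lemma radical_extension_homogeneous:
  assumes E: "subfield E L" "k \<subseteq> E" and q: "q \<in> Q" "Factorial_Ring.prime q"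
    and y: "y \<in> scaled E" "y \<notin> E" "y [^] q \<in> E"
    and v: "v \<in> lin_span E q (\<lambda>i. y [^] i)" "v \<in> scaled E"
  shows "\<exists>a\<in>E. \<exists>j<q. v = a \<otimes> y [^] j"
proof -
  let ?V = "lin_span E q (\<lambda>i. y [^] i)"
  have yu: "y \<in> Units L" using scaled_Units[OF E(1) y(1)] .
  note rs = radical_subfield_E[OF E q yu y(2,3)]
  interpret E: cring_subfield L E by (rule subfield_cring_subfield[OF E(1)])
  interpret V: cring_subfield L ?V by (rule subfield_cring_subfield[OF rs(1)])
  have *: "\<exists>a\<in>E. \<exists>j::nat. v = a \<otimes> y [^] j"
    if "n > 0" "\<forall>r. Factorial_Ring.prime r \<longrightarrow> r dvd n \<longrightarrow> r \<in> Q" "v [^] n = c \<otimes> y [^] (i::nat)" "c \<in> E"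
      "v \<in> ?V" "v \<in> scaled E" for n :: nat and v c i
    using that
  proof (induct n arbitrary: v c i rule: less_induct)
    case (less n)
    show ?case
    proof (cases "n = 1")
      case True
      have "v \<in> carrier L" using less by simp
      then show ?thesis using less True by auto
    next
      case False
      then obtain r where r: "Factorial_Ring.prime r" "r dvd n" using prime_factor_nat by blast
      then obtain m where n: "n = m * r" by (auto simp: mult.commute)
      have m: "m > 0" "m < n" using \<open>n > 0\<close> r n prime_gt_1_nat by auto
      have vc: "v \<in> carrier L" using less by simp
      have "(v [^] m) [^] r = c \<otimes> y [^] i" using less(4) vc by (simp add: n nat_pow_pow)
      moreover have "r \<in> Q" using less(3) r by auto
      ultimately obtain a j where "a \<in> E" "v [^] m = a \<otimes> y [^] (j::nat)"
        using prime_step[OF E q yu y(2,3) _ _ _ r(1), of "v [^] m" c i] less(5,6,7)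
          scaled_pow[OF E(1)] by auto
      then show ?thesis
        using less(1)[OF m(2,1) _ _ _ less(6,7), of a j] less(3) n by auto
    qed
  qed
  obtain w e where w: "v = w \<otimes> e" "w \<in> W" "e \<in> E" "e \<noteq> \<zero>"
    using v by (auto simp: scaled_def)
  obtain n :: nat where n: "n > 0" "w [^] n \<in> k" "\<forall>r. Factorial_Ring.prime r \<longrightarrow> r dvd n \<longrightarrow> r \<in> Q"
    using W_torsion[OF w(2)] by auto
  have "v [^] n \<in> E"
    using n(2) E w W_carrier[OF w(2)] by (auto simp: nat_pow_distrib)
  then obtain a j where aj: "a \<in> E" "v = a \<otimes> y [^] (j::nat)"
    using *[OF n(1,3) _ _ v, of "v [^] n" 0] by auto
  \<comment> \<open>Full multiples of q in the exponent are absorbed into the coefficient.\<close>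
  have "y [^] j = (y [^] q) [^] (j div q) \<otimes> y [^] (j mod q)"
    using yu by (simp add: nat_pow_pow nat_pow_mult)
  then have "v = (a \<otimes> (y [^] q) [^] (j div q)) \<otimes> y [^] (j mod q)"
    using aj yu by (simp add: m_assoc)
  moreover have "a \<otimes> (y [^] q) [^] (j div q) \<in> E" using aj y(3) by simp
  moreover have "j mod q < q" using q(2) prime_gt_0_nat by simp
  ultimately show ?thesis by blast
qed

end

subsection \<open>Linear independence of homogeneous elements\<close>


lemma (in cring_subfield) finsum_in_F:
  assumes "\<And>i. i \<in> I \<Longrightarrow> f i \<in> F"
  shows "(\<Oplus>i\<in>I. f i) \<in> F"
  using assms
proof (induct I rule: infinite_finite_induct)
  case (insert x A)
  then have "(\<Oplus>u\<in>insert x A. f u) = f x \<oplus> (\<Oplus>u\<in>A. f u)"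
    by (intro finsum_insert) auto
  with insert show ?case by simp
qed auto

context cring_subfield
begin

lemma proportional_class_sum:
  assumes "finite A" "\<And>i. i \<in> A \<Longrightarrow> proportional F v (f i)" "v \<in> Units L"
  shows "\<exists>h\<in>F. (\<Oplus>i\<in>A. f i) = v \<otimes> h"
proof -
  have "\<exists>c. \<forall>i\<in>A. c i \<in> F \<and> f i = c i \<otimes> v"
    using assms(2) unfolding proportional_def by (intro bchoice) auto
  then obtain c where c: "\<And>i. i \<in> A \<Longrightarrow> c i \<in> F" "\<And>i. i \<in> A \<Longrightarrow> f i = c i \<otimes> v" by auto
  have vc: "v \<in> carrier L" using assms(3) by auto
  have "(\<Oplus>i\<in>A. f i) = (\<Oplus>i\<in>A. v \<otimes> c i)"
    by (rule finsum_cong') (use c vc in \<open>auto simp: m_comm\<close>)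
  also have "\<dots> = v \<otimes> (\<Oplus>i\<in>A. c i)"
    by (rule finsum_rdistr[symmetric]) (use assms(1) c vc in auto)
  finally show ?thesis using finsum_in_F[of A c] c(1) by (intro bexI) auto
qed

text \<open>Summing a family over its proportionality classes.\<close>

lemma class_sums:
  assumes I: "finite I" and f: "\<And>i. i \<in> I \<Longrightarrow> f i \<in> Units L"
    and nz: "\<And>t. t \<in> I \<Longrightarrow> (\<Oplus>i\<in>{i\<in>I. proportional F (f t) (f i)}. f i) \<noteq> \<zero>"
  obtains R g where "R \<subseteq> I" "\<And>t. t \<in> R \<Longrightarrow> \<exists>h\<in>F. h \<noteq> \<zero> \<and> g t = f t \<otimes> h"
    "\<And>s t. s \<in> R \<Longrightarrow> t \<in> R \<Longrightarrow> s \<noteq> t \<Longrightarrow> \<not> proportional F (g s) (g t)"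
    "(\<Oplus>i\<in>I. f i) = (\<Oplus>t\<in>R. g t)" "\<And>i. i \<in> I \<Longrightarrow> \<exists>t\<in>R. proportional F (f t) (f i)"
proof -
  \<comment> \<open>The predicate under \<open>SOME\<close> depends only on the class of
    \<open>f i\<close>, so \<open>rep\<close> is constant on classes (\<open>rep_eq\<close>) and its
    image is a transversal.\<close>
  define rep where "rep i = (SOME j. j \<in> I \<and> proportional F (f j) (f i))" for i
  define R where "R = rep ` I"
  define A where "A t = {i\<in>I. proportional F (f t) (f i)}" for t
  define g where "g t = (\<Oplus>i\<in>A t. f i)" for t
  have fc: "f i \<in> carrier L" if "i \<in> I" for i using f[OF that] by auto
  have rep: "rep i \<in> I" "proportional F (f (rep i)) (f i)" if "i \<in> I" for i
  proof -
    have "\<exists>j. j \<in> I \<and> proportional F (f j) (f i)"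
      using that proportional_refl[OF fc[OF that]] by auto
    from someI_ex[OF this] show "rep i \<in> I" "proportional F (f (rep i)) (f i)"
      unfolding rep_def by auto
  qed
  have rep_eq: "rep i = rep j" if "i \<in> I" "j \<in> I" "proportional F (f i) (f j)" for i j
  proof -
    have "proportional F (f l) (f i) = proportional F (f l) (f j)" if "l \<in> I" for l
    proof
      assume "proportional F (f l) (f i)"
      then show "proportional F (f l) (f j)"
        by (rule proportional_trans[OF fc[OF \<open>l \<in> I\<close>] _ \<open>proportional F (f i) (f j)\<close>])
    next
      assume "proportional F (f l) (f j)"
      then show "proportional F (f l) (f i)"
        by (rule proportional_trans[OF fc[OF \<open>l \<in> I\<close>] _
              proportional_sym[OF fc[OF \<open>i \<in> I\<close>] \<open>proportional F (f i) (f j)\<close>]])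
    qed
    then show ?thesis unfolding rep_def by metis
  qed
  have Rdist: "s = t" if st: "s \<in> R" "t \<in> R" "proportional F (f s) (f t)" for s t
  proof -
    obtain i j where ij: "i \<in> I" "s = rep i" "j \<in> I" "t = rep j" using st by (auto simp: R_def)
    have "rep s = rep i" using rep_eq[of s i] rep ij by auto
    moreover have "rep t = rep j" using rep_eq[of t j] rep ij by auto
    moreover have "rep s = rep t" using rep_eq[of s t] rep ij st by auto
    ultimately show ?thesis using ij by simp
  qed
  have RI: "R \<subseteq> I" using rep by (auto simp: R_def)
  have hg: "\<exists>h\<in>F. h \<noteq> \<zero> \<and> g t = f t \<otimes> h" if "t \<in> R" for t
  proof -
    have tI: "t \<in> I" using that RI by auto
    have "\<exists>h\<in>F. g t = f t \<otimes> h"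
      unfolding g_def by (rule proportional_class_sum) (simp_all add: A_def I f[OF tI])
    then obtain h where h: "h \<in> F" "g t = f t \<otimes> h" by blast
    have "g t \<noteq> \<zero>" using nz[OF tI] by (simp only: g_def A_def not_False_eq_True)
    then have "h \<noteq> \<zero>" using h(2) fc[OF tI] by auto
    with h show ?thesis by blast
  qed
  have fg: "proportional F (f t) (g t)" if t: "t \<in> R" for t
  proof -
    obtain h where "h \<in> F" "h \<noteq> \<zero>" "g t = f t \<otimes> h" using hg[OF t] by auto
    then show ?thesis using fc[of t] t RI unfolding proportional_def
      by (intro bexI[of _ h]) (auto simp: m_comm)
  qed
  have gdist: "\<not> proportional F (g s) (g t)" if st: "s \<in> R" "t \<in> R" "s \<noteq> t" for s t
  proof
    assume p: "proportional F (g s) (g t)"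
    have c: "f s \<in> carrier L" "f t \<in> carrier L" using fc st RI by auto
    have "proportional F (f s) (f t)"
      using proportional_trans[OF c(1) proportional_trans[OF c(1) fg[OF st(1)] p]
          proportional_sym[OF c(2) fg[OF st(2)]]] .
    then show False using Rdist st by auto
  qed
  have cover: "\<exists>t\<in>R. proportional F (f t) (f i)" if "i \<in> I" for i
    using rep[OF that] that by (auto simp: R_def)
  have "I = (\<Union>t\<in>R. A t)" using cover by (auto simp: A_def)
  moreover have "(\<Oplus>i\<in>(\<Union>t\<in>R. A t). f i) = (\<Oplus>t\<in>R. (\<Oplus>i\<in>A t. f i))"
  proof (rule add.finprod_UN_disjoint)
    show "finite R" using I by (simp add: R_def)
    show "finite (A t)" for t using I by (simp add: A_def)
    show "pairwise (\<lambda>s t. disjnt (A s) (A t)) R"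
    proof (rule pairwiseI)
      fix s t assume st: "s \<in> R" "t \<in> R" "s \<noteq> t"
      have c: "f s \<in> carrier L" "f t \<in> carrier L" using fc st RI by auto
      have False if "i \<in> A s" "i \<in> A t" for i
        using Rdist[OF st(1,2) proportional_trans[OF c(1) _ proportional_sym[OF c(2)], of "f i"]] that st
        by (auto simp: A_def)
      then show "disjnt (A s) (A t)" by (auto simp: disjnt_def)
    qed
    show "f i \<in> carrier L" if "t \<in> R" "i \<in> A t" for t i
      using that fc by (auto simp: A_def)
  qed
  ultimately have "(\<Oplus>i\<in>I. f i) = (\<Oplus>t\<in>R. g t)" by (simp add: g_def)
  from that[OF RI hg gdist this cover] show thesis .
qed

end

context radical_extension
begin

text \<open>Each term is a multiple of a single power of \<open>y\<close> below q, and terms that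
  are not proportional have different exponents. Hence a coordinate of the sum in the basis of
  powers receives just one nonzero contribution.\<close>

lemma homogeneous_sum_nonzero:
  assumes E: "subfield E L" "k \<subseteq> E" and q: "q \<in> Q" "Factorial_Ring.prime q"
    and y: "y \<in> scaled E" "y \<notin> E" "y [^] q \<in> E"
    and T: "finite T" "T \<noteq> {}" "\<And>t. t \<in> T \<Longrightarrow> f t \<in> lin_span E q (\<lambda>i. y [^] i)"
      "\<And>t. t \<in> T \<Longrightarrow> f t \<in> scaled E"
      "\<And>s t. s \<in> T \<Longrightarrow> t \<in> T \<Longrightarrow> s \<noteq> t \<Longrightarrow> \<not> proportional E (f s) (f t)"
  shows "(\<Oplus>t\<in>T. f t) \<noteq> \<zero>"
proof
  assume 0: "(\<Oplus>t\<in>T. f t) = \<zero>"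
  let ?e = "\<lambda>i::nat. y [^] i"
  let ?V = "lin_span E q ?e"
  have yu: "y \<in> Units L" using scaled_Units[OF E(1) y(1)] .
  note rs = radical_subfield_E[OF E q yu y(2,3)]
  interpret E: cring_subfield L E by (rule subfield_cring_subfield[OF E(1)])
  interpret V: cring_subfield L ?V by (rule subfield_cring_subfield[OF rs(1)])
  obtain t where t: "t \<in> T" using T by auto
  obtain a j where a: "a \<in> E" "j < q" "f t = a \<otimes> y [^] j"
    using radical_extension_homogeneous[OF E q y T(3,4)[OF t]] by auto
  have a0: "a \<noteq> \<zero>"
    using Units_nz[OF scaled_Units[OF E(1) T(4)[OF t]]] a yu by auto
  let ?\<phi> = "\<lambda>v. coord E q ?e v j"
  have \<phi>t: "?\<phi> (f t) = a" using E.coord_single[OF rs(2) a(2,1,2)] a(3) by simp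
  have \<phi>0: "?\<phi> \<zero> = \<zero>" using E.coord_single[OF rs(2) a(2) E.F_simps(1) a(2)] yu by simp
  have "?\<phi> (\<Oplus>t\<in>T. f t) = ?\<phi> (f t)"
  proof (rule finsum_functional(1)[OF T(1) t, where V = ?V])
    fix u v assume uv: "u \<in> ?V" "v \<in> ?V"
    note du = coord_span[OF E(1) uv(1)] and dv = coord_span[OF E(1) uv(2)]
    show "?\<phi> (u \<oplus> v) = ?\<phi> u \<oplus> ?\<phi> v"
    proof (rule E.coord_eqI[OF rs(2) _ _ a(2)])
      have "lincomb q (\<lambda>i. coord E q ?e u i \<oplus> coord E q ?e v i) ?e
          = lincomb q (coord E q ?e u) ?e \<oplus> lincomb q (coord E q ?e v) ?e"
        by (rule lincomb_add) (use du dv yu in auto)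
      then show "u \<oplus> v = lincomb q (\<lambda>i. coord E q ?e u i \<oplus> coord E q ?e v i) ?e"
        using du dv by simp
    qed (use du dv in auto)
  next
    fix u assume u: "u \<in> T" "u \<noteq> t"
    obtain b l where b: "b \<in> E" "l < q" "f u = b \<otimes> y [^] l"
      using radical_extension_homogeneous[OF E q y T(3,4)[OF u(1)]] by auto
    have b0: "b \<noteq> \<zero>"
      using Units_nz[OF scaled_Units[OF E(1) T(4)[OF u(1)]]] b yu by auto
    have "l \<noteq> j"
    proof
      assume "l = j"
      then have "f u = (b \<otimes> inv a) \<otimes> f t"
        using a b yu E.F_Units[OF a(1) a0] by (simp add: m_assoc flip: m_assoc[of "inv a"])
      moreover have "b \<otimes> inv a \<in> E - {\<zero>}"
        using E.F_mult_nz b b0 E.F_inv E.F_inv_nz a a0 by simp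
      ultimately have "proportional E (f t) (f u)" unfolding proportional_def by auto
      then show False using T(5) t u by auto
    qed
    then show "?\<phi> (f u) = \<zero>" using E.coord_single[OF rs(2) b(2,1) a(2)] b(3) by simp
  qed (use T a \<phi>t \<phi>0 in auto)
  then show False using 0 \<phi>0 \<phi>t a0 by simp
qed

text \<open>For a unit some power of which lies in the subfield \<open>E\<close>, this is its order
  modulo the units of \<open>E\<close>; the sum of these orders is the measure in
  \<open>kneser\<close>.\<close>

definition order_mod :: "'b set \<Rightarrow> 'b \<Rightarrow> nat" where
  "order_mod E v = (LEAST n. n > 0 \<and> v [^] n \<in> E)"

lemma order_mod:
  assumes "v [^] (n::nat) \<in> E" "n > 0"
  shows "order_mod E v > 0" "v [^] order_mod E v \<in> E" "order_mod E v \<le> n"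
  using LeastI[of "\<lambda>n. n > 0 \<and> v [^] n \<in> E" n] Least_le[of "\<lambda>n. n > 0 \<and> v [^] n \<in> E" n] assms
  by (auto simp: order_mod_def)

lemma order_mod_dvd:
  assumes E: "subfield E L" and v: "v \<in> Units L" "v [^] (n::nat) \<in> E" "n > 0"
  shows "order_mod E v dvd n"
proof (rule ccontr)
  interpret E: cring_subfield L E by (rule subfield_cring_subfield[OF E])
  let ?m = "order_mod E v"
  note m = order_mod[OF v(2,3)]
  assume "\<not> ?thesis"
  then have r: "n mod ?m > 0" "n mod ?m < ?m" using m by (auto simp: dvd_eq_mod_eq_0)
  have "(v [^] ?m) [^] (n div ?m) \<otimes> v [^] (n mod ?m) = v [^] n"
    using v(1) by (simp add: nat_pow_pow nat_pow_mult)
  moreover have "(v [^] ?m) [^] (n div ?m) \<in> E - {\<zero>}"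
    using m(2) Units_nz[OF Units_pow[OF Units_pow[OF v(1)]]] by simp
  ultimately have "v [^] (n mod ?m) \<in> E"
    using subfield_m_inv_simprule[OF E, of "(v [^] ?m) [^] (n div ?m)" "v [^] (n mod ?m)"] v by simp
  from order_mod(3)[OF this r(1)] r show False by simp
qed

lemma scaled_torsion:
  assumes E: "subfield E L" "k \<subseteq> E" and v: "v \<in> scaled E"
  obtains n :: nat where "n > 0" "v [^] n \<in> E" "\<forall>r. Factorial_Ring.prime r \<longrightarrow> r dvd n \<longrightarrow> r \<in> Q"
proof -
  interpret E: cring_subfield L E by (rule subfield_cring_subfield[OF E(1)])
  obtain w e where w: "v = w \<otimes> e" "w \<in> W" "e \<in> E" "e \<noteq> \<zero>"
    using v by (auto simp: scaled_def)
  obtain n :: nat where n: "n > 0" "w [^] n \<in> k" "\<forall>r. Factorial_Ring.prime r \<longrightarrow> r dvd n \<longrightarrow> r \<in> Q"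
    using W_torsion[OF w(2)] by auto
  have "v [^] n \<in> E"
    using n(2) E w W_carrier[OF w(2)] by (auto simp: nat_pow_distrib)
  with n that show thesis by blast
qed

text \<open>
  Kneser's theorem. A power \<open>y\<close> of some \<open>f i\<close> has prime order modulo \<open>E\<close>; passing to \<open>E(y)\<close> and
  adding up the terms proportional over \<open>E(y)\<close> lowers the total order.
\<close>

lemma kneser:
  assumes "subfield E L" "k \<subseteq> E" "finite I" "I \<noteq> {}" "\<And>i. i \<in> I \<Longrightarrow> f i \<in> scaled E"
    "\<And>i j. i \<in> I \<Longrightarrow> j \<in> I \<Longrightarrow> i \<noteq> j \<Longrightarrow> \<not> proportional E (f i) (f j)"
  shows "(\<Oplus>i\<in>I. f i) \<noteq> \<zero>"
  using assms
proof (induct "\<Sum>i\<in>I. order_mod E (f i)" arbitrary: E I f rule: less_induct)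
  case less
  note E = less(2,3) and I = less(4,5) and f = less(6) and dist = less(7)
  interpret E: cring_subfield L E by (rule subfield_cring_subfield[OF E(1)])
  have fu: "f i \<in> Units L" if "i \<in> I" for i using scaled_Units[OF E(1) f[OF that]] .
  show ?case
  proof (cases "\<exists>i\<in>I. f i \<notin> E")
    case False
    \<comment> \<open>If all terms lie in \<open>E\<close>, they are pairwise proportional, so there
      is only one of them.\<close>
    obtain i where i: "i \<in> I" using I by auto
    have "j = i" if j: "j \<in> I" for j
    proof (rule ccontr)
      assume "j \<noteq> i"
      have fij: "f i \<in> E" "f i \<noteq> \<zero>" "f j \<in> E" "f j \<noteq> \<zero>"
        using False i j Units_nz[OF fu] by auto
      have "f j = (f j \<otimes> inv (f i)) \<otimes> f i" using fu i j by (simp add: m_assoc)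
      moreover have "f j \<otimes> inv (f i) \<in> E - {\<zero>}"
        using E.F_mult_nz fij E.F_inv E.F_inv_nz by simp
      ultimately have "proportional E (f i) (f j)" unfolding proportional_def by blast
      then show False using dist i j \<open>j \<noteq> i\<close> by auto
    qed
    then have Ii: "I = {i}" using i by blast
    then have "(\<Oplus>i\<in>I. f i) = f i" using fu[OF i] by simp
    then show ?thesis using Units_nz[OF fu[OF i]] by simp
  next
    case True
    then obtain i0 where i0: "i0 \<in> I" "f i0 \<notin> E" by auto
    define n where "n = order_mod E (f i0)"
    obtain m :: nat where m: "m > 0" "f i0 [^] m \<in> E" "\<forall>r. Factorial_Ring.prime r \<longrightarrow> r dvd m \<longrightarrow> r \<in> Q"
      by (rule scaled_torsion[OF E f[OF i0(1)]])
    have n: "n > 0" "f i0 [^] n \<in> E" "n dvd m"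
      unfolding n_def by (fact order_mod(1,2)[OF m(2,1)] order_mod_dvd[OF E(1) fu[OF i0(1)] m(2,1)])+
    have "n \<noteq> 1" using n i0 fu by auto
    then obtain q where q: "Factorial_Ring.prime q" "q dvd n" using prime_factor_nat by blast
    then have qQ: "q \<in> Q" using m n by (meson dvd_trans)
    obtain l where l: "n = l * q" using q by (auto simp: mult.commute)
    have ln: "l > 0" "l < n" using n(1) l prime_gt_1_nat[OF q(1)] by auto
    \<comment> \<open>The order of \<open>f i0\<close> is n = l q, so this power has order exactly q
      modulo \<open>E\<close>.\<close>
    define y where "y = f i0 [^] l"
    have y: "y \<in> scaled E" "y \<notin> E" "y [^] q \<in> E"
    proof -
      show "y \<in> scaled E" unfolding y_def by (rule scaled_pow[OF E(1) f[OF i0(1)]])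
      show "y \<notin> E" using order_mod(3)[of "f i0" l E] ln by (auto simp: y_def n_def)
      show "y [^] q \<in> E" using n(2) fu[OF i0(1)] by (simp add: y_def l nat_pow_pow)
    qed
    have yu: "y \<in> Units L" using scaled_Units[OF E(1) y(1)] .
    let ?V = "lin_span E q (\<lambda>i. y [^] i)"
    note rs = radical_subfield_E[OF E qQ q(1) yu y(2,3)]
    interpret V: cring_subfield L ?V by (rule subfield_cring_subfield[OF rs(1)])
    have kV: "k \<subseteq> ?V" using E(2) rs(4) by auto
    \<comment> \<open>Division by \<open>f t\<close> moves a whole class into E(y), where
      \<open>homogeneous_sum_nonzero\<close> applies; the quotients are still not proportional over
      \<open>E\<close>.\<close>
    have class_nz: "(\<Oplus>i\<in>{i\<in>I. proportional ?V (f t) (f i)}. f i) \<noteq> \<zero>" if t: "t \<in> I" for t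
    proof -
      let ?A = "{i\<in>I. proportional ?V (f t) (f i)}"
      let ?g = "\<lambda>i. f i \<otimes> inv (f t)"
      have "(\<Oplus>i\<in>?A. ?g i) \<noteq> \<zero>"
      proof (rule homogeneous_sum_nonzero[OF E qQ q(1) y])
        show "finite ?A" using I by simp
        show "?A \<noteq> {}" using t V.proportional_refl fu by auto
        fix i assume i: "i \<in> ?A"
        then obtain c where c: "c \<in> ?V" "f i = c \<otimes> f t" by (auto simp: proportional_def)
        then have "?g i = c" using fu t by (simp add: m_assoc)
        then show "?g i \<in> ?V" using c by simp
        show "?g i \<in> scaled E" using i t f by (auto intro: scaled_mult[OF E(1)] scaled_inv[OF E(1)])
        fix j assume j: "j \<in> ?A" "i \<noteq> j"
        show "\<not> proportional E (?g i) (?g j)"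
        proof
          assume "proportional E (?g i) (?g j)"
          then obtain c where c: "c \<in> E - {\<zero>}" "?g j = c \<otimes> ?g i" by (auto simp: proportional_def)
          have "f j = ?g j \<otimes> f t" using fu i j t by (simp add: m_assoc)
          also have "\<dots> = c \<otimes> f i" unfolding c(2) using fu i j t c(1) by (simp add: m_assoc)
          finally have "proportional E (f i) (f j)" using c(1) by (auto simp: proportional_def)
          then show False using dist i j by auto
        qed
      qed
      moreover have "(\<Oplus>i\<in>?A. ?g i) = (\<Oplus>i\<in>?A. f i) \<otimes> inv (f t)"
        by (rule finsum_ldistr[symmetric]) (use I fu t in auto)
      ultimately show ?thesis using fu t by auto
    qed
    obtain R g where R: "R \<subseteq> I" "\<And>t. t \<in> R \<Longrightarrow> \<exists>h\<in>?V. h \<noteq> \<zero> \<and> g t = f t \<otimes> h"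
      "\<And>s t. s \<in> R \<Longrightarrow> t \<in> R \<Longrightarrow> s \<noteq> t \<Longrightarrow> \<not> proportional ?V (g s) (g t)"
      "(\<Oplus>i\<in>I. f i) = (\<Oplus>t\<in>R. g t)" "\<And>i. i \<in> I \<Longrightarrow> \<exists>t\<in>R. proportional ?V (f t) (f i)"
      by (rule V.class_sums[OF I(1) fu class_nz]) blast+
    have finR: "finite R" by (rule finite_subset[OF R(1) I(1)])
    have gs: "g t \<in> scaled ?V" if t: "t \<in> R" for t
    proof -
      obtain h where h: "h \<in> ?V" "h \<noteq> \<zero>" "g t = f t \<otimes> h" using R(2)[OF t] by auto
      have "f t \<in> scaled ?V" using scaled_mono[OF rs(4)] f t R(1) by auto
      then show ?thesis unfolding h(3) using scaled_mult[OF rs(1) _ scaled_base[OF h(1,2) rs(1)]] by simp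
    qed
    have ord_le: "order_mod ?V (g t) \<le> j" if t: "t \<in> R" and j: "j > 0" "f t [^] j \<in> ?V" for t j
    proof -
      obtain h where h: "h \<in> ?V" "g t = f t \<otimes> h" using R(2)[OF t] by auto
      have "g t [^] j \<in> ?V"
        using j(2) h fu t R(1) by (auto simp: nat_pow_distrib)
      then show ?thesis using order_mod(3) j by auto
    qed
    have ordE: "order_mod E (f i) > 0" "f i [^] order_mod E (f i) \<in> ?V" if i: "i \<in> I" for i
    proof -
      obtain m :: nat where "m > 0" "f i [^] m \<in> E" using scaled_torsion[OF E f[OF i]] by metis
      from order_mod[OF this(2,1)] rs(4) show "order_mod E (f i) > 0" "f i [^] order_mod E (f i) \<in> ?V"
        by auto
    qed
    \<comment> \<open>Terms merged into another representative count 0, so that both totals run over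
      \<open>I\<close>. At \<open>i0\<close> the total drops strictly in either case: the new order
      is 0 or at most l, because \<open>f i0 [^] l\<close> is \<open>y\<close>.\<close>
    define w where "w i = (if i \<in> R then order_mod ?V (g i) else 0)" for i
    have "(\<Sum>t\<in>R. order_mod ?V (g t)) = (\<Sum>i\<in>I. w i)"
      unfolding w_def using R(1) I(1) by (simp add: sum.If_cases Int_absorb1)
    also have "\<dots> < (\<Sum>i\<in>I. order_mod E (f i))"
    proof (rule sum_strict_mono_ex1)
      show "\<forall>i\<in>I. w i \<le> order_mod E (f i)" using ord_le ordE by (auto simp: w_def)
      have "w i0 < n"
      proof (cases "i0 \<in> R")
        case True
        have "f i0 [^] l \<in> ?V" using rs(3) by (simp add: y_def)
        then show ?thesis using ord_le[OF True ln(1)] ln True by (simp add: w_def)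
      qed (use n in \<open>simp add: w_def\<close>)
      then show "\<exists>a\<in>I. w a < order_mod E (f a)" using i0 n_def by auto
    qed (use I in simp)
    finally have "(\<Oplus>t\<in>R. g t) \<noteq> \<zero>"
      by (rule less(1)[OF _ rs(1) kV finR _ gs R(3)]) (use R(5) I in auto)
    then show ?thesis using R(4) by simp
  qed
qed

text \<open>Group the components by classes modulo \<open>E\<close>. The classes inside
  \<open>E\<close> can be subtracted, so the others sum to some \<open>h\<close> in
  \<open>E\<close>. Together with the term -h, which belongs to the trivial class, they form a
  vanishing sum that \<open>kneser\<close> forbids.\<close>

lemma intermediate_graded:
  assumes E: "subfield E L" "k \<subseteq> E" and S: "finite S" "S \<subseteq> W"
    "\<And>s t. s \<in> S \<Longrightarrow> t \<in> S \<Longrightarrow> s \<noteq> t \<Longrightarrow> \<not> proportional k s t"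
    and sum: "(\<Oplus>s\<in>S. s) \<in> E"
  shows "S \<subseteq> E"
proof (rule ccontr)
  assume "\<not> ?thesis"
  then obtain s0 where s0: "s0 \<in> S" "s0 \<notin> E" by auto
  interpret E: cring_subfield L E by (rule subfield_cring_subfield[OF E(1)])
  have SU: "s \<in> Units L" if "s \<in> S" for s using that S(2) W_Units by auto
  have nz: "(\<Oplus>i\<in>{i\<in>S. proportional E t i}. i) \<noteq> \<zero>" if t: "t \<in> S" for t
  proof (rule W_indep)
    show "{i \<in> S. proportional E t i} \<noteq> {}" using t E.proportional_refl SU by auto
  qed (use S in auto)
  obtain R g where R: "R \<subseteq> S" "\<And>t. t \<in> R \<Longrightarrow> \<exists>h\<in>E. h \<noteq> \<zero> \<and> g t = t \<otimes> h"
    "\<And>s t. s \<in> R \<Longrightarrow> t \<in> R \<Longrightarrow> s \<noteq> t \<Longrightarrow> \<not> proportional E (g s) (g t)"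
    "(\<Oplus>i\<in>S. i) = (\<Oplus>t\<in>R. g t)" "\<And>i. i \<in> S \<Longrightarrow> \<exists>t\<in>R. proportional E t i"
    by (rule E.class_sums[OF S(1) SU nz]) blast+
  have finR: "finite R" by (rule finite_subset[OF R(1) S(1)])
  have gE: "g t \<in> E \<longleftrightarrow> t \<in> E" if t: "t \<in> R" for t
  proof -
    obtain h where h: "h \<in> E" "h \<noteq> \<zero>" "g t = t \<otimes> h" using R(2)[OF t] by auto
    have tU: "t \<in> Units L" using SU R(1) t by auto
    show ?thesis
      using subfield_m_inv_simprule[OF E(1), of h t] h tU by (auto simp: m_comm)
  qed
  have gs: "g t \<in> scaled E" if t: "t \<in> R" for t
    using R(2)[OF t] R(1) S(2) t unfolding scaled_def by blast
  have gc: "g t \<in> carrier L" if t: "t \<in> R" for t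
    using scaled_Units[OF E(1) gs[OF t]] by simp
  define R' where "R' = {t\<in>R. t \<notin> E}"
  have R'R: "R' \<subseteq> R" "finite R'" using finR by (auto simp: R'_def)
  obtain t0 where t0: "t0 \<in> R" "proportional E t0 s0" using R(5)[OF s0(1)] by auto
  have "t0 \<notin> E"
    using t0(2) s0(2) by (auto simp: proportional_def)
  then have R'0: "R' \<noteq> {}" using t0 by (auto simp: R'_def)
  define h where "h = (\<Oplus>t\<in>R'. g t)"
  have hc: "h \<in> carrier L" unfolding h_def using gc R'R by (intro finsum_closed) auto
  define h' where "h' = (\<Oplus>t\<in>R - R'. g t)"
  have h'E: "h' \<in> E" unfolding h'_def by (rule E.finsum_in_F) (auto simp: R'_def gE)
  have "R = R' \<union> (R - R')" using R'R by auto
  then have "(\<Oplus>t\<in>R. g t) = (\<Oplus>t\<in>R' \<union> (R - R'). g t)" by simp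
  also have "\<dots> = h \<oplus> h'"
    unfolding h_def h'_def
    by (rule finsum_Un_disjoint) (use finR R'R gc in auto)
  finally have hh: "h \<oplus> h' \<in> E" using sum R(4) by simp
  have "h = (h \<oplus> h') \<oplus> \<ominus> h'" using hc h'E by (simp add: a_assoc r_neg)
  also have "\<dots> \<in> E" by (intro E.F_simps hh h'E)
  finally have hE: "h \<in> E" .
  show False
  \<comment> \<open>For \<open>h = 0\<close> there is no unit -h to add, but the remaining classes
    already sum to zero.\<close>
  proof (cases "h = \<zero>")
    case True
    moreover have "h \<noteq> \<zero>"
      unfolding h_def by (rule kneser[OF E R'R(2) R'0 gs R(3)]) (use R'R in auto)
    ultimately show False by simp
  next
    case False
    \<comment> \<open>The index 1 is free, as it is in \<open>E\<close> and hence outside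
      \<open>R'\<close>; it is given to the extra term -h.\<close>
    define f where "f t = (if t = \<one> then \<ominus> h else g t)" for t
    have 1: "\<one> \<notin> R'" by (simp add: R'_def)
    have mh: "\<ominus> h \<in> E" "\<ominus> h \<noteq> \<zero>" using hE False hc by (auto simp: add.inv_eq_1_iff)
    have ft: "f t = g t" if "t \<in> R'" for t using that 1 by (auto simp: f_def)
    have "(\<Oplus>t\<in>insert \<one> R'. f t) = f \<one> \<oplus> (\<Oplus>t\<in>R'. f t)"
      by (rule finsum_insert) (use 1 R'R mh gc ft in \<open>auto simp: f_def\<close>)
    also have "(\<Oplus>t\<in>R'. f t) = h"
      unfolding h_def by (rule finsum_cong') (use R'R gc ft in auto)
    also have "f \<one> \<oplus> h = \<zero>" using hc by (simp add: f_def l_neg)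
    finally have "(\<Oplus>t\<in>insert \<one> R'. f t) = \<zero>" .
    moreover have "(\<Oplus>t\<in>insert \<one> R'. f t) \<noteq> \<zero>"
    proof (rule kneser[OF E])
      show "f t \<in> scaled E" if "t \<in> insert \<one> R'" for t
        using that gs R'R scaled_base[OF mh E(1)] by (auto simp: f_def)
      have no: "\<not> proportional E (\<ominus> h) (g t)" if "t \<in> R'" for t
      proof
        assume "proportional E (\<ominus> h) (g t)"
        then have "g t \<in> E" using mh by (auto simp: proportional_def)
        then show False using that gE R'R by (auto simp: R'_def)
      qed
      show "\<not> proportional E (f s) (f t)" if "s \<in> insert \<one> R'" "t \<in> insert \<one> R'" "s \<noteq> t" for s t
      proof (cases "s = \<one>")
        case True
        then show ?thesis using that ft no by (auto simp: f_def)
      next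
        case s: False
        then have sR: "s \<in> R'" using that by simp
        show ?thesis
        proof (cases "t = \<one>")
          case True
          show ?thesis
          proof
            assume "proportional E (f s) (f t)"
            then have "proportional E (g s) (\<ominus> h)" using ft[OF sR] True by (simp add: f_def)
            then show False using E.proportional_sym[of "g s" "\<ominus> h"] no[OF sR] gc sR R'R by auto
          qed
        next
          case False
          then show ?thesis using that ft sR R(3)[of s t] R'R by auto
        qed
      qed
    qed (use R'R in auto)
    ultimately show False by simp
  qed
qed

end

subsection \<open>Necessity of the conditions\<close>


context graded_algebra
begin

lemma W_lin_indep:
  assumes f: "\<And>i. i < n \<Longrightarrow> f i \<in> W"
    and dist: "\<And>i j. i < n \<Longrightarrow> j < n \<Longrightarrow> i \<noteq> j \<Longrightarrow> \<not> proportional k (f i) (f j)"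
  shows "lin_indep k n f"
  unfolding lin_indep_def
proof (intro conjI allI impI)
  show "f i \<in> carrier L" if "i < n" for i using f[OF that] W_carrier by simp
  fix c j assume c: "\<forall>i<n. c i \<in> k" and 0: "lincomb n c f = \<zero>" and j: "j < n"
  have fc: "f i \<in> carrier L" if "i < n" for i using f[OF that] W_carrier by simp
  show "c j = \<zero>"
  proof (rule ccontr)
    assume cj: "c j \<noteq> \<zero>"
    have cW: "c i \<otimes> f i \<in> W" if "i < n" "c i \<noteq> \<zero>" for i
      using that c f k_W W_mult by simp
    have jW: "c j \<otimes> f j \<in> W" by (rule cW[OF j cj])
    then obtain \<phi> where \<phi>: "\<phi> (c j \<otimes> f j) \<in> carrier L" "\<phi> (c j \<otimes> f j) \<noteq> \<zero>" "\<phi> \<zero> = \<zero>"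
      "\<And>f g. f \<in> carrier L \<Longrightarrow> g \<in> carrier L \<Longrightarrow> \<phi> (f \<oplus> g) = \<phi> f \<oplus> \<phi> g"
      "\<And>v. v \<in> W \<Longrightarrow> \<not> proportional k (c j \<otimes> f j) v \<Longrightarrow> \<phi> v = \<zero>"
      by (rule component) (rule that)
    have pr: "proportional k (f i) (c i \<otimes> f i)" if "i < n" "c i \<noteq> \<zero>" for i
      using that c by (auto simp: proportional_def)
    have "\<phi> (\<Oplus>i\<in>{..<n}. c i \<otimes> f i) = \<phi> (c j \<otimes> f j)"
    proof (rule finsum_functional(1)[where V = "carrier L"])
      fix i assume i: "i \<in> {..<n}" "i \<noteq> j"
      show "\<phi> (c i \<otimes> f i) = \<zero>"
      proof (cases "c i = \<zero>")
        case True
        then show ?thesis using \<phi>(3) fc i by simp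
      next
        case False
        have i': "i < n" using i by simp
        have "\<not> proportional k (c j \<otimes> f j) (c i \<otimes> f i)"
        proof
          assume "proportional k (c j \<otimes> f j) (c i \<otimes> f i)"
          then have "proportional k (f j) (f i)"
            using proportional_trans[OF fc[OF j] proportional_trans[OF fc[OF j] pr[OF j cj]]
                proportional_sym[OF fc[OF i'] pr[OF i' False]]] by blast
          then show False using dist[OF j i'] i by simp
        qed
        then show ?thesis by (rule \<phi>(5)[OF cW[OF i' False]])
      qed
    qed (use \<phi> c fc j in auto)
    also have "(\<Oplus>i\<in>{..<n}. c i \<otimes> f i) = \<zero>"
      using lincomb_finsum[of n c f] 0 c fc by simp
    finally show False using \<phi> by simp
  qed
qed

lemma pow_coprime_mem:
  assumes x: "x \<in> Units L" "x [^] (a::nat) \<in> k" "x [^] (b::nat) \<in> k" "coprime a b"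
  shows "x \<in> k"
proof (cases "a = 0")
  case True
  then show ?thesis using x by simp
next
  case False
  then obtain s t where st: "a * s = b * t + 1"
    using bezout_nat[of a b] x(4) by (auto simp: coprime_iff_gcd_eq_1)
  have nz: "(x [^] b) [^] t \<noteq> \<zero>"
  proof
    assume 0: "(x [^] b) [^] t = \<zero>"
    have "(x [^] b) [^] t \<otimes> (inv x [^] b) [^] t = ((x \<otimes> inv x) [^] b) [^] t"
      using x(1) by (simp only: nat_pow_distrib Units_closed Units_inv_closed nat_pow_closed)
    then show False using 0 x(1) F_one_not_zero by simp
  qed
  have "(x [^] b) [^] t \<otimes> x = (x [^] a) [^] s"
    using x(1) by (simp add: nat_pow_pow st)
  then have "(x [^] b) [^] t \<otimes> x \<in> k" using x(2) by simp
  from subfield_m_inv_simprule[OF F _ _ this] show ?thesis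
    using nz x by simp
qed

lemma W_cancel:
  assumes "s \<in> W" "v \<in> carrier L" "w \<in> carrier L" "proportional k (s \<otimes> v) (s \<otimes> w)"
  shows "proportional k v w"
proof -
  obtain c where c: "c \<in> k - {\<zero>}" "s \<otimes> w = c \<otimes> (s \<otimes> v)" using assms by (auto simp: proportional_def)
  have sU: "s \<in> Units L" using W_Units assms by simp
  have "w = inv s \<otimes> (s \<otimes> w)" using sU assms(3) by (simp flip: m_assoc)
  also have "\<dots> = (inv s \<otimes> s) \<otimes> (c \<otimes> v)" unfolding c(2)
    using sU assms(2) c(1) by (simp add: m_ac del: Units_l_inv Units_r_inv)
  also have "\<dots> = c \<otimes> v" using sU assms(2) c(1) by simp
  finally show ?thesis using c by (auto simp: proportional_def)
qed

text \<open>Cancelling the smaller power leaves the difference of exponents. One of the two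
  truncated differences is 0, and \<open>e > 0\<close> selects the other.\<close>

lemma proportional_powers:
  assumes w: "w \<in> W" and p: "proportional k (w [^] (i::nat)) (w [^] (j::nat))" and ij: "i \<noteq> j"
  obtains e :: nat where "e > 0" "w [^] e \<in> k" "e = j - i \<or> e = i - j"
proof -
  have *: "w [^] (b - a) \<in> k" if "proportional k (w [^] a) (w [^] b)" "a < b" for a b :: nat
  proof -
    have wc: "w \<in> carrier L" using w W_carrier by simp
    have "w [^] a \<otimes> w [^] (b - a) = w [^] b" using wc that by (simp add: nat_pow_mult)
    then have "proportional k (w [^] a \<otimes> \<one>) (w [^] a \<otimes> w [^] (b - a))" using that wc by simp
    from W_cancel[OF W_pow[OF w] _ _ this] wc have "proportional k \<one> (w [^] (b - a))" by simp
    then show ?thesis by (auto simp: proportional_def)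
  qed
  show thesis
  proof (cases "i < j")
    case True
    then show thesis using *[OF p True] that[of "j - i"] by simp
  next
    case False
    then have "j < i" using ij by simp
    then show thesis
      using *[OF proportional_sym[OF _ p]] that[of "i - j"] w W_carrier by simp
  qed
qed

text \<open>If multiplication by \<open>w\<close> sent every class of the finite set
  \<open>S\<close> to a class of \<open>S\<close>, then by the pigeonhole principle two powers of
  \<open>w\<close> would be proportional and some positive power of \<open>w\<close> would lie in
  \<open>k\<close>.\<close>

lemma orbit_end:
  assumes w: "w \<in> W" "\<And>n::nat. n > 0 \<Longrightarrow> w [^] n \<notin> k" and S: "finite S" "S \<subseteq> W" "S \<noteq> {}"
  shows "\<exists>m\<in>S. \<forall>s\<in>S. \<not> proportional k (w \<otimes> m) s"
proof (rule ccontr)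
  assume "\<not> ?thesis"
  then have nx: "\<exists>s\<in>S. proportional k (w \<otimes> m) s" if "m \<in> S" for m using that by auto
  obtain m where m: "m \<in> S" using S by auto
  have wc: "w \<in> carrier L" using w W_carrier by simp
  have Sc: "s \<in> carrier L" if "s \<in> S" for s using that S W_carrier by auto
  have "\<exists>s\<in>S. proportional k (w [^] n \<otimes> m) s" for n :: nat
  proof (induct n)
    case 0
    then show ?case using m Sc proportional_refl by auto
  next
    case (Suc n)
    then obtain s where s: "s \<in> S" "proportional k (w [^] n \<otimes> m) s" by auto
    then obtain c where c: "c \<in> k - {\<zero>}" "s = c \<otimes> (w [^] n \<otimes> m)" by (auto simp: proportional_def)
    have "w \<otimes> s = c \<otimes> (w [^] Suc n \<otimes> m)"
      unfolding c(2) using wc Sc[OF m] c(1) by (simp add: m_ac)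
    then have p: "proportional k (w [^] Suc n \<otimes> m) (w \<otimes> s)" using c(1) by (auto simp: proportional_def)
    obtain s' where s': "s' \<in> S" "proportional k (w \<otimes> s) s'" using nx[OF s(1)] by auto
    have "proportional k (w [^] Suc n \<otimes> m) s'"
      by (rule proportional_trans[OF _ p s'(2)]) (use wc Sc m in simp)
    then show ?case using s' by blast
  qed
  then obtain g :: "nat \<Rightarrow> 'b" where g: "\<And>n. g n \<in> S" "\<And>n. proportional k (w [^] n \<otimes> m) (g n)"
    by metis
  have "finite (range g)" by (rule finite_subset[OF _ S(1)]) (use g(1) in auto)
  then have "\<not> inj g" using finite_imageD infinite_UNIV_nat by blast
  then obtain i j where ij: "i \<noteq> j" "g i = g j" by (auto simp: inj_def)
  have c: "w [^] n \<otimes> m \<in> carrier L" for n :: nat using wc Sc m by simp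
  have "proportional k (w [^] i \<otimes> m) (w [^] j \<otimes> m)"
    by (rule proportional_trans[OF c g(2) proportional_sym[OF c]]) (use g(2)[of j] ij in simp)
  then have "proportional k (w [^] i) (w [^] j)"
    using W_cancel[of m "w [^] i" "w [^] j"] m S(2) wc Sc by (auto simp: m_comm)
  from proportional_powers[OF w(1) this ij(1)] w(2) show False by metis
qed

end

text \<open>Condition (b) of co-Galois is expressed through homogeneous components, so that the
  arguments below need neither \<open>D\<close> nor its subgroups.\<close>

locale graded_field = graded_algebra L k W + field L for L :: "'b ring" (structure) and k W +
  assumes graded: "subfield E L \<Longrightarrow> k \<subseteq> E \<Longrightarrow> finite S \<Longrightarrow> S \<subseteq> W \<Longrightarrow>
    (\<And>s t. s \<in> S \<Longrightarrow> t \<in> S \<Longrightarrow> s \<noteq> t \<Longrightarrow> \<not> proportional k s t) \<Longrightarrow> (\<Oplus>s\<in>S. s) \<in> E \<Longrightarrow> S \<subseteq> E"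
begin

text \<open>
  If \<open>w\<close> has infinite order modulo \<open>k\<close>, then \<open>1 + w\<close> has no inverse \<open>g\<close>: the extreme terms of
  \<open>(1 + w) g\<close> do not cancel and are not proportional.
\<close>

lemma W_torsion:
  assumes w: "w \<in> W"
  shows "\<exists>n>0. w [^] (n::nat) \<in> k"
proof (rule ccontr)
  assume nt: "\<not> ?thesis"
  have wU: "w \<in> Units L" and wc: "w \<in> carrier L" using w W_Units by auto
  have wk: "\<not> proportional k \<one> w" "\<not> proportional k w \<one>"
  proof -
    show "\<not> proportional k \<one> w"
      using nt[simplified, rule_format, of 1] wc by (auto simp: proportional_def)
    then show "\<not> proportional k w \<one>" using proportional_sym[OF wc] by blast
  qed
  have 1: "\<one> \<in> W" using k_W[of \<one>] by simp
  have ne: "\<one> \<noteq> w" using nt[simplified, rule_format, of 1] by auto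
  have "(\<Oplus>s\<in>{\<one>, w}. s) \<noteq> \<zero>"
    by (rule W_indep) (use wk w 1 in auto)
  then have "\<one> \<oplus> w \<noteq> \<zero>" using ne wc by simp
  then have wu: "\<one> \<oplus> w \<in> Units L" using wc field_Units by simp
  define g where "g = inv (\<one> \<oplus> w)"
  have g: "g \<in> carrier L" "(\<one> \<oplus> w) \<otimes> g = \<one>"
    unfolding g_def by (rule Units_inv_closed[OF wu], rule Units_r_inv[OF wu])
  obtain S where S: "finite S" "S \<subseteq> W" "g = (\<Oplus>s\<in>S. s)"
    "\<And>s t. s \<in> S \<Longrightarrow> t \<in> S \<Longrightarrow> s \<noteq> t \<Longrightarrow> \<not> proportional k s t"
    using W_generate[OF g(1)] by auto
  have S0: "S \<noteq> {}" using g wc S by auto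
  have Sc: "s \<in> carrier L" if "s \<in> S" for s using that S W_carrier by auto
  have "(\<Oplus>s\<in>S. s) \<oplus> (\<Oplus>s\<in>S. w \<otimes> s) = (\<one> \<oplus> w) \<otimes> g"
    using finsum_rdistr[of S w "\<lambda>s. s"] S(1,3) wc Sc g(1) by (simp add: l_distr Pi_def)
  with g have eq: "(\<Oplus>s\<in>S. s) \<oplus> (\<Oplus>s\<in>S. w \<otimes> s) = \<one>" by simp
  have zero_sum: "\<phi> (\<Oplus>s\<in>S. f s) = \<zero>"
    if "\<phi> \<zero> = \<zero>" "\<And>f g. f \<in> carrier L \<Longrightarrow> g \<in> carrier L \<Longrightarrow> \<phi> (f \<oplus> g) = \<phi> f \<oplus> \<phi> g"
      "\<And>s. s \<in> S \<Longrightarrow> \<phi> (f s) = \<zero>" "\<And>s. s \<in> S \<Longrightarrow> f s \<in> carrier L" for \<phi> f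
  proof -
    obtain s where "s \<in> S" using S0 by auto
    then show ?thesis
      using finsum_functional(1)[OF S(1), of s f "carrier L" \<phi>] that by simp
  qed
  have nt': "w [^] n \<notin> k" if "n > 0" for n :: nat using nt that by blast
  obtain m where m: "m \<in> S" "\<And>s. s \<in> S \<Longrightarrow> \<not> proportional k (w \<otimes> m) s"
    using orbit_end[OF w nt' S(1,2) S0] by blast
  have iw: "inv w [^] (n::nat) \<notin> k" if n: "n > 0" for n
  proof
    assume "inv w [^] n \<in> k"
    moreover have pw: "inv w [^] n \<otimes> w [^] n = \<one>" using wU by (simp flip: nat_pow_distrib)
    then have "inv w [^] n \<noteq> \<zero>" using wc by auto
    ultimately have "inv w [^] n \<in> k - {\<zero>}" by simp
    from subfield_m_inv_simprule[OF F this] have "w [^] n \<in> k" using pw wc by simp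
    then show False using nt'[OF n] by simp
  qed
  obtain m' where m': "m' \<in> S" "\<And>s. s \<in> S \<Longrightarrow> \<not> proportional k (inv w \<otimes> m') s"
    using orbit_end[OF W_inv[OF w] iw S(1,2) S0] by blast
  \<comment> \<open>The class of w m occurs exactly once in (1 + w) g = 1: no element of
    \<open>S\<close> has it, and no other w s does. So it is the class of 1. The same is then shown
    for \<open>m'\<close>, chosen as the end in the other direction.\<close>
  have wm1: "proportional k (w \<otimes> m) \<one>"
  proof (rule ccontr)
    assume np: "\<not> proportional k (w \<otimes> m) \<one>"
    have "w \<otimes> m \<in> W" using W_mult w m S by auto
    then obtain \<phi> where \<phi>: "\<phi> (w \<otimes> m) \<in> carrier L" "\<phi> (w \<otimes> m) \<noteq> \<zero>" "\<phi> \<zero> = \<zero>"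
      "\<And>f g. f \<in> carrier L \<Longrightarrow> g \<in> carrier L \<Longrightarrow> \<phi> (f \<oplus> g) = \<phi> f \<oplus> \<phi> g"
      "\<And>v. v \<in> W \<Longrightarrow> \<not> proportional k (w \<otimes> m) v \<Longrightarrow> \<phi> v = \<zero>"
      by (rule component) (rule that)
    have a: "\<phi> (\<Oplus>s\<in>S. s) = \<zero>"
      by (rule zero_sum) (use \<phi> m S Sc in auto)
    have b: "\<phi> (\<Oplus>s\<in>S. w \<otimes> s) = \<phi> (w \<otimes> m)"
    proof (rule finsum_functional(1)[OF S(1) m(1), where V = "carrier L"])
      fix s assume s: "s \<in> S" "s \<noteq> m"
      show "\<phi> (w \<otimes> s) = \<zero>"
        by (rule \<phi>(5)) (use s S w W_mult W_cancel[OF w Sc[OF m(1)] Sc[OF s(1)]] S(4)[OF m(1) s(1)] in auto)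
    qed (use \<phi> Sc wc in auto)
    have "\<phi> \<one> = \<phi> (\<Oplus>s\<in>S. s) \<oplus> \<phi> (\<Oplus>s\<in>S. w \<otimes> s)"
      unfolding eq[symmetric] by (rule \<phi>(4)) (use Sc wc in \<open>auto intro!: finsum_closed\<close>)
    then have "\<phi> \<one> = \<phi> (w \<otimes> m)" using a b \<phi>(1) by simp
    then show False using \<phi>(2,5) 1 np by auto
  qed
  have m'1: "proportional k m' \<one>"
  proof (rule ccontr)
    assume np: "\<not> proportional k m' \<one>"
    have "m' \<in> W" using m' S by auto
    then obtain \<phi> where \<phi>: "\<phi> m' \<in> carrier L" "\<phi> m' \<noteq> \<zero>" "\<phi> \<zero> = \<zero>"
      "\<And>f g. f \<in> carrier L \<Longrightarrow> g \<in> carrier L \<Longrightarrow> \<phi> (f \<oplus> g) = \<phi> f \<oplus> \<phi> g"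
      "\<And>v. v \<in> W \<Longrightarrow> \<not> proportional k m' v \<Longrightarrow> \<phi> v = \<zero>"
      by (rule component) (rule that)
    have a: "\<phi> (\<Oplus>s\<in>S. s) = \<phi> m'"
      by (rule finsum_functional(1)[OF S(1) m'(1), where V = "carrier L"])
        (use \<phi> Sc S(2,4) m'(1) in auto)
    have b: "\<phi> (\<Oplus>s\<in>S. w \<otimes> s) = \<zero>"
    proof (rule zero_sum)
      fix s assume s: "s \<in> S"
      have "\<not> proportional k m' (w \<otimes> s)"
      proof
        assume "proportional k m' (w \<otimes> s)"
        moreover have "m' = w \<otimes> (inv w \<otimes> m')" using wU Sc[OF m'(1)] by (simp flip: m_assoc)
        ultimately have "proportional k (w \<otimes> (inv w \<otimes> m')) (w \<otimes> s)" by simp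
        from W_cancel[OF w _ _ this] m'(2)[OF s] show False using wU Sc[OF m'(1)] Sc[OF s] by simp
      qed
      then show "\<phi> (w \<otimes> s) = \<zero>" using \<phi>(5) W_mult w s S(2) by auto
    qed (use \<phi> Sc wc in auto)
    have "\<phi> \<one> = \<phi> (\<Oplus>s\<in>S. s) \<oplus> \<phi> (\<Oplus>s\<in>S. w \<otimes> s)"
      unfolding eq[symmetric] by (rule \<phi>(4)) (use Sc wc in \<open>auto intro!: finsum_closed\<close>)
    then have "\<phi> \<one> = \<phi> m'" using a b \<phi>(1) by simp
    then show False using \<phi>(2,5) 1 np by auto
  qed
  \<comment> \<open>Both extreme classes are that of 1, hence equal, against the choice of
    \<open>m\<close>.\<close>
  have "proportional k (w \<otimes> m) m'"
    by (rule proportional_trans[OF _ wm1 proportional_sym[OF _ m'1]]) (use wc Sc m m' in auto)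
  then show False using m(2) m'(1) by blast
qed

text \<open>The counting device behind the remaining contradictions: E = k(y) has dimension at most
  n, and homogeneous elements of different classes are independent, so E meets at most n
  classes.\<close>

lemma graded_simple:
  assumes y: "y \<in> carrier L" "y [^] n \<in> lin_span k n (\<lambda>i. y [^] i)" "n > 0"
  obtains E where "subfield E L" "k \<subseteq> E" "y \<in> E"
    "\<And>(m::nat) f. (\<And>i. i < m \<Longrightarrow> f i \<in> W \<and> f i \<in> E) \<Longrightarrow>
      (\<And>i j. i < m \<Longrightarrow> j < m \<Longrightarrow> i \<noteq> j \<Longrightarrow> \<not> proportional k (f i) (f j)) \<Longrightarrow> m \<le> n"
proof -
  obtain d where d: "0 < d" "d \<le> n" "lin_indep k d (\<lambda>i. y [^] i)"
    "subfield (lin_span k d (\<lambda>i. y [^] i)) L" "y \<in> lin_span k d (\<lambda>i. y [^] i)"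
    "k \<subseteq> lin_span k d (\<lambda>i. y [^] i)"
    by (rule power_span_subfield_domain[OF _ y]) (use integral in auto)
  show thesis
  proof (rule that[OF d(4,6,5)])
    fix m :: nat and f
    assume f: "\<And>i. i < m \<Longrightarrow> f i \<in> W \<and> f i \<in> lin_span k d (\<lambda>i. y [^] i)"
      and "\<And>i j. i < m \<Longrightarrow> j < m \<Longrightarrow> i \<noteq> j \<Longrightarrow> \<not> proportional k (f i) (f j)"
    then have "lin_indep k m f" by (intro W_lin_indep) auto
    then have "m \<le> d" by (rule lin_indep_le[OF F _ _ d(3)]) (use y f in auto)
    then show "m \<le> n" using d(2) by simp
  qed
qed

lemma lin_span_scalar_power:
  assumes "y \<in> carrier L" "y [^] n \<in> k" "n > 0"
  shows "y [^] n \<in> lin_span k n (\<lambda>i. y [^] i)"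
  by (rule subfield_in_power_span[OF assms(2,3,1)])

text \<open>
  If \<open>z \<notin> k\<close>, then \<open>k(z)\<close> has dimension less than \<open>p\<close> and contains a homogeneous \<open>s \<notin> k\<close>. The field
  \<open>k(z u)\<close>, of dimension at most \<open>p\<close>, contains \<open>s u\<close>, whose order modulo \<open>k\<close> is larger than \<open>p\<close>.
\<close>

lemma prime_root_of_unity:
  assumes p: "Factorial_Ring.prime (p::nat)" and u: "u \<in> W" "u [^] p \<in> k" "u \<notin> k"
    and z: "z \<in> carrier L" "z [^] p = \<one>"
  shows "z \<in> k"
proof (rule ccontr)
  assume zk: "z \<notin> k"
  have p1: "p > 1" using p prime_gt_1_nat by blast
  have z1: "z \<noteq> \<one>" using zk by auto
  let ?e = "\<lambda>i::nat. z [^] i"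
  \<comment> \<open>The geometric sum 1 + z + ... + z^(p-1) vanishes, so z^(p-1) depends on the
    lower powers and k(z) has dimension at most p - 1.\<close>
  have geo: "(z \<ominus> \<one>) \<otimes> lincomb n (\<lambda>_. \<one>) ?e = z [^] n \<ominus> \<one>" for n
  proof (induct n)
    case 0
    then show ?case using z by (simp add: minus_eq r_neg)
  next
    case (Suc n)
    have "(z \<ominus> \<one>) \<otimes> lincomb (Suc n) (\<lambda>_. \<one>) ?e = (z [^] n \<ominus> \<one>) \<oplus> (z \<ominus> \<one>) \<otimes> z [^] n"
      using Suc z by (simp add: r_distr)
    also have "\<dots> = (z [^] n \<oplus> \<ominus> \<one>) \<oplus> (z [^] Suc n \<oplus> \<ominus> (z [^] n))"
      using z(1) by (simp add: minus_eq l_distr l_minus m_comm[of z])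
    also have "\<dots> = (z [^] n \<oplus> \<ominus> (z [^] n)) \<oplus> (z [^] Suc n \<oplus> \<ominus> \<one>)"
      using z(1) by (simp only: a_ac nat_pow_closed one_closed a_inv_closed a_closed)
    also have "\<dots> = z [^] Suc n \<ominus> \<one>"
      using z(1) by (simp add: minus_eq r_neg)
    finally show ?case .
  qed
  have zm: "z \<ominus> \<one> \<noteq> \<zero>" using z(1) z1 r_right_minus_eq[of z \<one>] by simp
  have "(z \<ominus> \<one>) \<otimes> lincomb p (\<lambda>_. \<one>) ?e = \<zero>"
    using geo[of p] z by (simp add: minus_eq r_neg)
  then have "lincomb p (\<lambda>_. \<one>) ?e = \<zero>"
    using integral[of "z \<ominus> \<one>" "lincomb p (\<lambda>_. \<one>) ?e"] z(1) zm by simp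
  moreover obtain p' where p': "p = Suc p'" using p1 by (cases p) auto
  ultimately have "lincomb p' (\<lambda>_. \<one>) ?e \<oplus> z [^] p' = \<zero>" using z by simp
  then have "z [^] p' = \<ominus> \<one> \<otimes> lincomb p' (\<lambda>_. \<one>) ?e"
    using z minus_equality[of "z [^] p'" "lincomb p' (\<lambda>_. \<one>) ?e"]
    by (simp add: l_minus a_comm)
  moreover have "\<ominus> \<one> \<otimes> lincomb p' (\<lambda>_. \<one>) ?e \<in> lin_span k p' ?e"
    by (rule lin_span_smult) (use z in \<open>auto intro!: lincomb_in_span[OF F]\<close>)
  ultimately have "z [^] p' \<in> lin_span k p' ?e" by simp
  moreover have "p' > 0" using p1 p' by simp
  ultimately obtain E1 where E1: "subfield E1 L" "k \<subseteq> E1" "z \<in> E1"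
    and dim1: "\<And>(m::nat) f. (\<And>i. i < m \<Longrightarrow> f i \<in> W \<and> f i \<in> E1) \<Longrightarrow>
      (\<And>i j. i < m \<Longrightarrow> j < m \<Longrightarrow> i \<noteq> j \<Longrightarrow> \<not> proportional k (f i) (f j)) \<Longrightarrow> m \<le> p'"
    by (rule graded_simple[OF z(1)]) blast
  interpret E1: cring_subfield L E1 by (rule subfield_cring_subfield[OF E1(1)])
  obtain S where S: "finite S" "S \<subseteq> W" "z = (\<Oplus>s\<in>S. s)"
    "\<And>s t. s \<in> S \<Longrightarrow> t \<in> S \<Longrightarrow> s \<noteq> t \<Longrightarrow> \<not> proportional k s t"
    using W_generate[OF z(1)] by auto
  have SE1: "S \<subseteq> E1"
    by (rule graded[OF E1(1,2) S(1,2,4)]) (use S(3) E1(3) in auto)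
  have "\<exists>s\<in>S. s \<notin> k"
  proof (rule ccontr)
    assume "\<not> ?thesis"
    then have "z \<in> k" unfolding S(3) by (intro finsum_in_F) auto
    with zk show False by simp
  qed
  then obtain s where s: "s \<in> S" "s \<notin> k" by auto
  have sW: "s \<in> W" using s S by auto
  have sU: "s \<in> Units L" and uU: "u \<in> Units L" using W_Units sW u by auto
  \<comment> \<open>The p powers of \<open>s\<close> below exponent p cannot all have different
    classes in dimension p - 1, so some s^d with 0 < d < p lies in \<open>k\<close>.\<close>
  have "\<exists>i<p. \<exists>j<p. i \<noteq> j \<and> proportional k (s [^] i) (s [^] j)"
  proof (rule ccontr)
    assume "\<not> ?thesis"
    then have "p \<le> p'" by (intro dim1[of p "\<lambda>i. s [^] i"]) (use W_pow[OF sW] SE1 s in auto)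
    then show False using p' by simp
  qed
  then obtain i j where ij: "i < p" "j < p" "i \<noteq> j" "proportional k (s [^] i) (s [^] j)" by auto
  then obtain d :: nat where d: "d > 0" "d < p" "s [^] d \<in> k"
    using proportional_powers[OF sW ij(4,3)] by (metis less_imp_diff_less)
  define t where "t = s \<otimes> u"
  have tW: "t \<in> W" using W_mult sW u by (simp add: t_def)
  have u_dvd: "p dvd e" if "u [^] e \<in> k" for e
  proof (rule ccontr)
    assume "\<not> p dvd e"
    then have "coprime p e" using p by (simp add: prime_imp_coprime_nat)
    then show False using pow_coprime_mem[OF uU u(2) that] u(3) by simp
  qed
  have knz: "x [^] (n::nat) \<in> k - {\<zero>}" if "x \<in> Units L" "x [^] n \<in> k" for x n
  proof -
    have "x [^] n \<otimes> inv x [^] n = \<one>" using that by (simp flip: nat_pow_distrib)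
    then show ?thesis using that by auto
  qed
  \<comment> \<open>Raising t^e to the power d removes \<open>s\<close> modulo \<open>k\<close> and
    leaves u^(e d), so p divides e, as d < p. For e = p also s^p would be in \<open>k\<close>, and
    with s^d even \<open>s\<close>.\<close>
  have t_pow: "e > p" if e: "e > 0" "t [^] e \<in> k" for e :: nat
  proof (rule ccontr)
    assume "\<not> e > p"
    have ted: "(t [^] e) [^] d = (s [^] d) [^] e \<otimes> u [^] (e * d)"
      using sU uU by (simp add: t_def nat_pow_distrib nat_pow_pow mult.commute)
    have "(s [^] d) [^] e \<otimes> u [^] (e * d) \<in> k"
      unfolding ted[symmetric] using e(2) by simp
    moreover have "s [^] (d * e) \<in> k - {\<zero>}"
      by (rule knz[OF sU]) (use d(3) sU in \<open>simp flip: nat_pow_pow\<close>)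
    then have "(s [^] d) [^] e \<in> k - {\<zero>}" using sU by (simp add: nat_pow_pow)
    ultimately have "u [^] (e * d) \<in> k"
      by (rule subfield_m_inv_simprule[OF F, rotated 2]) (use uU in simp)
    from u_dvd[OF this] have "p dvd e"
      using p d by (auto simp: prime_dvd_mult_iff dest: dvd_imp_le)
    then have "e = p" using \<open>\<not> e > p\<close> e(1) by (simp add: dvd_imp_le antisym)
    then have "u [^] p \<otimes> s [^] p \<in> k"
      using e(2) sU uU by (simp add: t_def nat_pow_distrib m_comm)
    then have "s [^] p \<in> k"
      by (rule subfield_m_inv_simprule[OF F knz[OF uU u(2)], rotated]) (use sU in simp)
    moreover have "coprime d p"
      using d p by (metis coprime_commute nat_dvd_not_less prime_imp_coprime_nat)
    ultimately show False using pow_coprime_mem[OF sU d(3)] s(2) by simp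
  qed
  have zu: "z \<otimes> u \<in> carrier L" using z uU by simp
  have "(z \<otimes> u) [^] p \<in> k" using z u uU by (simp add: nat_pow_distrib)
  then obtain E2 where E2: "subfield E2 L" "k \<subseteq> E2" "z \<otimes> u \<in> E2"
    and dim2: "\<And>(m::nat) f. (\<And>i. i < m \<Longrightarrow> f i \<in> W \<and> f i \<in> E2) \<Longrightarrow>
      (\<And>i j. i < m \<Longrightarrow> j < m \<Longrightarrow> i \<noteq> j \<Longrightarrow> \<not> proportional k (f i) (f j)) \<Longrightarrow> m \<le> p"
    using graded_simple[OF zu lin_span_scalar_power[OF zu, of p]] p1 by (metis gr_implies_not0 gr0I)
  interpret E2: cring_subfield L E2 by (rule subfield_cring_subfield[OF E2(1)])
  have Sc: "x \<in> carrier L" if "x \<in> S" for x using that S W_carrier by auto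
  \<comment> \<open>The components of \<open>z u\<close> are those of \<open>z\<close> multiplied by
    \<open>u\<close>, so gradedness puts \<open>s u\<close> into the field generated by
    \<open>z u\<close>.\<close>
  have "(\<lambda>x. u \<otimes> x) ` S \<subseteq> E2"
  proof (rule graded[OF E2(1,2)])
    show "(\<lambda>x. u \<otimes> x) ` S \<subseteq> W" using W_mult u S by auto
    have inj: "inj_on (\<lambda>x. u \<otimes> x) S"
      using uU Sc by (auto simp: inj_on_def)
    have "(\<Oplus>x\<in>(\<lambda>x. u \<otimes> x) ` S. x) = (\<Oplus>x\<in>S. u \<otimes> x)"
      by (rule finsum_reindex[OF _ inj]) (use uU Sc in auto)
    also have "\<dots> = u \<otimes> z"
      unfolding S(3) by (rule finsum_rdistr[symmetric]) (use S uU Sc in auto)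
    finally show "(\<Oplus>x\<in>(\<lambda>x. u \<otimes> x) ` S. x) \<in> E2" using E2(3) z uU by (simp add: m_comm)
    show "\<not> proportional k v w" if vw: "v \<in> (\<lambda>x. u \<otimes> x) ` S" "w \<in> (\<lambda>x. u \<otimes> x) ` S" "v \<noteq> w" for v w
    proof
      assume p: "proportional k v w"
      obtain a b where ab: "a \<in> S" "v = u \<otimes> a" "b \<in> S" "w = u \<otimes> b" using vw by auto
      have "proportional k a b"
        by (rule W_cancel[OF u(1)]) (use p ab Sc in auto)
      then show False using S(4)[OF ab(1,3)] ab vw(3) by auto
    qed
  qed (use S in auto)
  then have tE2: "t \<in> E2" using s uU sU by (auto simp: t_def m_comm)
  have "Suc p \<le> p"
  proof (rule dim2[of "Suc p" "\<lambda>i. t [^] i"])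
    show "t [^] i \<in> W \<and> t [^] i \<in> E2" for i :: nat using W_pow[OF tW] tE2 by simp
    fix i j assume ij: "i < Suc p" "j < Suc p" "i \<noteq> j"
    show "\<not> proportional k (t [^] i) (t [^] j)"
    proof
      assume "proportional k (t [^] i) (t [^] j)"
      then obtain e :: nat where "e > 0" "t [^] e \<in> k" "e = j - i \<or> e = i - j"
        by (rule proportional_powers[OF tW _ ij(3)])
      with t_pow[of e] ij show False by auto
    qed
  qed
  then show False by simp
qed


text \<open>
  If \<open>i \<notin> k\<close>, then \<open>i\<close> is homogeneous, and the field generated by \<open>t = (1 + i) u\<close>, with \<open>t\<^sup>4 \<in> k\<close>,
  contains \<open>u\<close> and \<open>i\<close>: too many classes for its dimension.
\<close>

lemma square_root_of_minus_one:
  assumes u: "u \<in> W" "u [^] (4::nat) \<in> k" "u [^] (2::nat) \<notin> k"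
    and i: "i \<in> carrier L" "i \<otimes> i = \<ominus> \<one>"
  shows "i \<in> k"
proof (rule ccontr)
  assume ik: "i \<notin> k"
  have uU: "u \<in> Units L" using W_Units u by simp
  have i0: "i \<noteq> \<zero>" using ik by auto
  have iU: "i \<in> Units L" using i i0 field_Units by simp
  \<comment> \<open>In characteristic 2 the equation i^2 = -1 means (i - 1)^2 = 0, and i = 1 would
    be in \<open>k\<close>.\<close>
  have two: "\<one> \<oplus> \<one> \<noteq> \<zero>"
  proof
    assume two: "\<one> \<oplus> \<one> = \<zero>"
    have m1: "\<ominus> \<one> = \<one>" using minus_equality[OF two] by simp
    moreover have "i \<oplus> i = \<zero>" using l_distr[of \<one> \<one> i] two i(1) by simp
    ultimately have "(i \<ominus> \<one>) \<otimes> (i \<oplus> \<one>) = \<zero>"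
      using i by (simp add: minus_eq l_distr r_distr a_assoc two l_neg a_ac(3) r_neg2 r_neg1 r_neg)
    moreover have "i \<oplus> \<one> = i \<ominus> \<one>" using m1 by (simp add: minus_eq)
    ultimately have "i \<ominus> \<one> = \<zero>" using integral[of "i \<ominus> \<one>" "i \<oplus> \<one>"] i by auto
    then have "i = \<one>" using i r_right_minus_eq by simp
    then show False using ik by simp
  qed
  have nprop: "\<not> proportional k (a [^] j) (a [^] l)"
    if "a \<in> W" "j \<noteq> l" "j < n" "l < n" "\<And>e. 0 < e \<Longrightarrow> e < n \<Longrightarrow> a [^] e \<notin> k" for a and j l n :: nat
  proof
    assume "proportional k (a [^] j) (a [^] l)"
    then obtain e :: nat where "e > 0" "a [^] e \<in> k" "e = l - j \<or> e = j - l"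
      by (rule proportional_powers[OF \<open>a \<in> W\<close> _ \<open>j \<noteq> l\<close>])
    then show False using that(3-5) by auto
  qed
  have uk: "u \<notin> k"
    using u(3) by auto
  have upow: "u [^] e \<notin> k" if "0 < e" "e < 4" for e :: nat
  proof -
    have "u [^] (3::nat) \<notin> k"
    proof
      assume "u [^] (3::nat) \<in> k"
      moreover have "coprime (3::nat) 4" using coprime_Suc_right_nat[of 3] by simp
      ultimately show False using pow_coprime_mem[OF uU _ u(2)] uk by blast
    qed
    moreover have "e = 1 \<or> e = 2 \<or> e = 3" using that by auto
    ultimately show ?thesis using u(3) uk uU by auto
  qed
  have i2: "i [^] (2::nat) = \<ominus> \<one>" using i by (simp add: numeral_2_eq_2)
  obtain E1 where E1: "subfield E1 L" "k \<subseteq> E1" "i \<in> E1"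
    and dim1: "\<And>(m::nat) f. (\<And>j. j < m \<Longrightarrow> f j \<in> W \<and> f j \<in> E1) \<Longrightarrow>
      (\<And>j l. j < m \<Longrightarrow> l < m \<Longrightarrow> j \<noteq> l \<Longrightarrow> \<not> proportional k (f j) (f l)) \<Longrightarrow> m \<le> 2"
    by (rule graded_simple[OF i(1) lin_span_scalar_power[OF i(1), of 2]]) (auto simp: i2)
  interpret E1: cring_subfield L E1 by (rule subfield_cring_subfield[OF E1(1)])
  obtain S where S: "finite S" "S \<subseteq> W" "i = (\<Oplus>s\<in>S. s)"
    "\<And>s t. s \<in> S \<Longrightarrow> t \<in> S \<Longrightarrow> s \<noteq> t \<Longrightarrow> \<not> proportional k s t"
    using W_generate[OF i(1)] by auto
  have SE1: "S \<subseteq> E1"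
    by (rule graded[OF E1(1,2) S(1,2,4)]) (use S(3) E1(3) in auto)
  have "\<exists>s\<in>S. s \<notin> k"
  proof (rule ccontr)
    assume "\<not> ?thesis"
    then have "i \<in> k" unfolding S(3) by (intro finsum_in_F) auto
    with ik show False by simp
  qed
  then obtain s where s: "s \<in> S" "s \<notin> k" by auto
  have sW: "s \<in> W" "s \<in> E1" using s S SE1 by auto
  have sU: "s \<in> Units L" using W_Units sW by auto
  \<comment> \<open>The field k(i) has dimension at most 2, and the classes of 1 and
    \<open>s\<close> already exhaust it.\<close>
  have three: False if "a \<in> W" "a \<in> E1" "a \<notin> k" "\<not> proportional k s a" for a
  proof -
    have ac: "a \<in> carrier L" using that W_carrier by auto
    define f where "f j = (if j = 0 then \<one> else if j = 1 then s else a)" for j :: nat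
    have p1: "\<not> proportional k \<one> b" if "b \<in> carrier L" "b \<notin> k" for b
      using that by (auto simp: proportional_def)
    have p2: "\<not> proportional k b \<one>" if "b \<in> carrier L" "b \<notin> k" for b
      using p1[OF that] proportional_sym[OF that(1)] by blast
    have "3 \<le> (2::nat)"
    proof (rule dim1[of 3 f])
      show "f j \<in> W \<and> f j \<in> E1" for j using that sW k_W[of \<one>] by (auto simp: f_def)
      fix j l :: nat assume "j < 3" "l < 3" "j \<noteq> l"
      then show "\<not> proportional k (f j) (f l)"
        using p1 p2 s(2) sU that(3,4) ac proportional_sym[of a s] by (auto simp: f_def)
    qed
    then show False by simp
  qed
  have s2: "s \<otimes> s \<in> k"
  proof (rule ccontr)
    assume n: "s \<otimes> s \<notin> k"
    have "\<not> proportional k s (s \<otimes> s)"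
    proof
      assume "proportional k s (s \<otimes> s)"
      then have "proportional k (s \<otimes> \<one>) (s \<otimes> s)" using sU by simp
      from W_cancel[OF sW(1) _ _ this] sU have "proportional k \<one> s" by simp
      then show False using s(2) by (auto simp: proportional_def)
    qed
    then show False using three[of "s \<otimes> s"] W_mult sW n by simp
  qed
  have Sc: "x \<in> carrier L" if "x \<in> S" for x using that S W_carrier by auto
  define a where "a = (\<Oplus>x\<in>S - {s}. x)"
  have ak: "a \<in> k"
    unfolding a_def
  proof (rule finsum_in_F)
    fix x assume x: "x \<in> S - {s}"
    show "x \<in> k"
    proof (rule ccontr)
      assume "x \<notin> k"
      then show False using three[of x] x S(2,4) SE1 s by auto
    qed
  qed
  have "(\<Oplus>x\<in>insert s (S - {s}). x) = s \<oplus> a"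
    unfolding a_def by (rule finsum_insert) (use S Sc sU in auto)
  then have isa: "i = s \<oplus> a" using S(3) s insert_Diff[of s S] by simp
  \<comment> \<open>Squaring i = s + a shows that the cross term 2 a s is in \<open>k\<close>, since
    s^2 and a^2 are; so a nonzero \<open>a\<close> would put \<open>s\<close> into
    \<open>k\<close>.\<close>
  have "a = \<zero>"
  proof (rule ccontr)
    assume a0: "a \<noteq> \<zero>"
    have "\<ominus> \<one> = s \<otimes> s \<oplus> (a \<otimes> s \<oplus> a \<otimes> s) \<oplus> a \<otimes> a"
      unfolding i(2)[symmetric] isa using sU ak by (simp add: l_distr r_distr m_comm a_assoc)
    then have "\<ominus> \<one> = (s \<otimes> s \<oplus> a \<otimes> a) \<oplus> (a \<otimes> s \<oplus> a \<otimes> s)"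
      using sU ak by (simp add: a_ac)
    then have "a \<otimes> s \<oplus> a \<otimes> s = \<ominus> (s \<otimes> s \<oplus> a \<otimes> a) \<oplus> \<ominus> \<one>"
      using sU ak r_neg1[of "s \<otimes> s \<oplus> a \<otimes> a" "a \<otimes> s \<oplus> a \<otimes> s"] by simp
    moreover have "(a \<otimes> (\<one> \<oplus> \<one>)) \<otimes> s = a \<otimes> s \<oplus> a \<otimes> s"
      using sU ak by (simp add: l_distr r_distr)
    ultimately have "(a \<otimes> (\<one> \<oplus> \<one>)) \<otimes> s \<in> k" using s2 ak by simp
    moreover have "a \<otimes> (\<one> \<oplus> \<one>) \<in> k - {\<zero>}" using F_mult_nz[OF ak _ a0 two] ak by simp
    ultimately have "s \<in> k"
      using subfield_m_inv_simprule[OF F, of "a \<otimes> (\<one> \<oplus> \<one>)" s] sU by blast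
    then show False using s by simp
  qed
  then have iW: "i \<in> W" using isa sW sU by simp
  \<comment> \<open>As (1 + i)^2 = 2 i, one has t^2 = 2 i u^2 and t^4 = -4 u^4. The two summands of
    \<open>t\<close> are its homogeneous components, so any intermediate field containing
    \<open>t\<close> contains \<open>u\<close> and \<open>i u\<close>.\<close>
  define t where "t = u \<oplus> i \<otimes> u"
  have tc: "t \<in> carrier L" using uU i by (simp add: t_def)
  let ?i2 = "i \<oplus> i"
  have t2: "t \<otimes> t = ?i2 \<otimes> (u \<otimes> u)"
  proof -
    have "t = (\<one> \<oplus> i) \<otimes> u" using uU i by (simp add: t_def l_distr)
    then have "t \<otimes> t = ((\<one> \<oplus> i) \<otimes> (\<one> \<oplus> i)) \<otimes> (u \<otimes> u)" using uU i by (simp add: m_ac)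
    also have "(\<one> \<oplus> i) \<otimes> (\<one> \<oplus> i) = (\<one> \<oplus> \<ominus> \<one>) \<oplus> (i \<oplus> i)"
      using i by (simp add: l_distr r_distr a_ac del: r_neg)
    also have "\<dots> = ?i2" using i by (simp add: r_neg)
    finally show ?thesis .
  qed
  have ii4: "?i2 \<otimes> ?i2 \<in> k"
    using i by (simp add: l_distr r_distr)
  have t4: "t [^] (4::nat) \<in> k"
  proof -
    have "t [^] (4::nat) = (t \<otimes> t) \<otimes> (t \<otimes> t)" using tc by (simp add: numeral_eq_Suc m_assoc)
    also have "\<dots> = (?i2 \<otimes> ?i2) \<otimes> u [^] (4::nat)"
      unfolding t2 using uU i(1) by (simp add: numeral_eq_Suc m_ac del: l_distr)
    finally show ?thesis using ii4 u(2) by simp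
  qed
  have np_u: "\<not> proportional k u (i \<otimes> u)"
  proof
    assume "proportional k u (i \<otimes> u)"
    then have "proportional k (u \<otimes> \<one>) (u \<otimes> i)" using uU i by (simp add: m_comm)
    from W_cancel[OF u(1) _ i(1) this] have "proportional k \<one> i" by simp
    then show False using ik i by (auto simp: proportional_def)
  qed
  have in_E: "u \<in> E \<and> i \<in> E" if E: "subfield E L" "k \<subseteq> E" "t \<in> E" for E
  proof -
    interpret E: cring_subfield L E by (rule subfield_cring_subfield[OF E(1)])
    have ne: "u \<noteq> i \<otimes> u" using np_u proportional_refl[of u] uU by auto
    have "{u, i \<otimes> u} \<subseteq> E"
    proof (rule graded[OF E(1,2)])
      show "{u, i \<otimes> u} \<subseteq> W" using u iW W_mult by simp
      show "\<not> proportional k a b" if "a \<in> {u, i \<otimes> u}" "b \<in> {u, i \<otimes> u}" "a \<noteq> b" for a b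
        using that np_u proportional_sym[of "i \<otimes> u" u] uU i by auto
      show "(\<Oplus>s\<in>{u, i \<otimes> u}. s) \<in> E" using E(3) ne uU i by (simp add: t_def)
    qed simp
    then have "u \<in> E" "i \<otimes> u \<in> E" by auto
    moreover have "i \<otimes> u \<otimes> inv u = i" using uU i by (simp add: m_assoc)
    moreover have "u \<noteq> \<zero>" using uk by auto
    ultimately show ?thesis using E.F_inv E.F_simps by metis
  qed
  have np4: "\<not> proportional k (u [^] j) (u [^] l)" if "j < 4" "l < 4" "j \<noteq> l" for j l :: nat
    by (rule nprop[OF u(1) that(3,1,2) upow])
  show False
  \<comment> \<open>If i is a scalar times u^2, then t^2 is already in \<open>k\<close>, and 1, u,
    u^2 are three classes in dimension 2. Otherwise 1, u, u^2, u^3, i are five classes in dimension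
    4.\<close>
  proof (cases "proportional k (u [^] (2::nat)) i")
    case True
    then obtain c where c: "c \<in> k - {\<zero>}" "i = c \<otimes> (u \<otimes> u)"
      using uU by (auto simp: proportional_def numeral_2_eq_2)
    have "c \<otimes> t [^] (2::nat) = ?i2 \<otimes> i"
      using t2 tc c(1) uU i by (simp add: numeral_2_eq_2 c(2)[symmetric] m_lcomm[of c])
    also have "\<dots> \<in> k" using i by (simp add: l_distr)
    finally have "t [^] (2::nat) \<in> k"
      using subfield_m_inv_simprule[OF F c(1)] tc by simp
    then obtain E where E: "subfield E L" "k \<subseteq> E" "t \<in> E"
      and dim: "\<And>(m::nat) f. (\<And>j. j < m \<Longrightarrow> f j \<in> W \<and> f j \<in> E) \<Longrightarrow>
        (\<And>j l. j < m \<Longrightarrow> l < m \<Longrightarrow> j \<noteq> l \<Longrightarrow> \<not> proportional k (f j) (f l)) \<Longrightarrow> m \<le> 2"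
      using graded_simple[OF tc lin_span_scalar_power[OF tc, of 2]] by (metis zero_less_numeral)
    interpret E: cring_subfield L E by (rule subfield_cring_subfield[OF E(1)])
    have "3 \<le> (2::nat)"
      by (rule dim[of 3 "\<lambda>j. u [^] j"]) (use W_pow[OF u(1)] in_E[OF E] np4 in auto)
    then show False by simp
  next
    case False
    obtain E where E: "subfield E L" "k \<subseteq> E" "t \<in> E"
      and dim: "\<And>(m::nat) f. (\<And>j. j < m \<Longrightarrow> f j \<in> W \<and> f j \<in> E) \<Longrightarrow>
        (\<And>j l. j < m \<Longrightarrow> l < m \<Longrightarrow> j \<noteq> l \<Longrightarrow> \<not> proportional k (f j) (f l)) \<Longrightarrow> m \<le> 4"
      using graded_simple[OF tc lin_span_scalar_power[OF tc t4]] by (metis zero_less_numeral)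
    interpret E: cring_subfield L E by (rule subfield_cring_subfield[OF E(1)])
    \<comment> \<open>Since i^2 = -1, proportionality of u^j and i puts u^(2 j) into
      \<open>k\<close>, which excludes j = 1 and j = 3; j = 0 and j = 2 are ruled out by
      \<open>ik\<close> and by the case at hand.\<close>
    have np_i: "\<not> proportional k (u [^] j) i" if "j < 4" for j :: nat
    proof
      assume "proportional k (u [^] j) i"
      then obtain c where c: "c \<in> k - {\<zero>}" "i = c \<otimes> u [^] j" by (auto simp: proportional_def)
      have "(c \<otimes> c) \<otimes> u [^] (j + j) = i \<otimes> i"
        unfolding c(2) using c(1) uU by (simp add: m_ac flip: nat_pow_mult)
      then have "(c \<otimes> c) \<otimes> u [^] (j + j) \<in> k" using i by simp
      then have jj: "u [^] (j + j) \<in> k"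
        using subfield_m_inv_simprule[OF F, of "c \<otimes> c" "u [^] (j + j)"] c(1) F_mult_nz[of c c] uU
        by simp
      have "j \<noteq> 0"
      proof
        assume "j = 0"
        then have "i \<in> k" using c by simp
        with ik show False by simp
      qed
      moreover have "j \<noteq> 1"
      proof
        assume "j = 1"
        then show False using jj u(3) by (simp add: numeral_2_eq_2)
      qed
      moreover have "j \<noteq> 2"
      proof
        assume "j = 2"
        then have "proportional k (u [^] (2::nat)) i" using c by (auto simp: proportional_def)
        with False show False by simp
      qed
      moreover have "j \<noteq> 3"
      proof
        assume "j = 3"
        then have "u [^] (6::nat) \<in> k" using jj by simp
        moreover have "u [^] (4::nat) \<otimes> u [^] (2::nat) = u [^] (6::nat)"
          using uU by (simp add: nat_pow_mult)
        moreover have "u [^] (4::nat) \<noteq> \<zero>"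
        proof
          assume "u [^] (4::nat) = \<zero>"
          moreover have "u [^] (4::nat) \<otimes> inv u [^] (4::nat) = \<one>"
            using uU by (simp flip: nat_pow_distrib)
          ultimately show False using uU by simp
        qed
        ultimately have "u [^] (2::nat) \<in> k"
          using subfield_m_inv_simprule[OF F, of "u [^] (4::nat)" "u [^] (2::nat)"] u(2) uU by simp
        then show False using u(3) by simp
      qed
      ultimately show False using that by auto
    qed
    define f where "f j = (if j = 4 then i else u [^] j)" for j :: nat
    have "5 \<le> (4::nat)"
    proof (rule dim[of 5 f])
      show "f j \<in> W \<and> f j \<in> E" for j using W_pow[OF u(1)] in_E[OF E] iW by (simp add: f_def)
      fix j l :: nat assume jl: "j < 5" "l < 5" "j \<noteq> l"
      show "\<not> proportional k (f j) (f l)"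
      proof (cases "l = 4")
        case True
        then show ?thesis using np_i[of j] jl by (simp add: f_def)
      next
        case l: False
        show ?thesis
        proof (cases "j = 4")
          case True
          then show ?thesis
            using np_i[of l] jl l proportional_sym[OF i(1), of "u [^] l"] by (auto simp: f_def)
        next
          case False
          then show ?thesis using np4[of j l] jl l by (simp add: f_def)
        qed
      qed
    qed
    then show False by simp
  qed
qed

end

subsection \<open>The universal algebra\<close>


locale unit_extension = field K + U: comm_group U
  for K :: "('a, 'm) ring_scheme" (structure) and U :: "('u, 'n) monoid_scheme" +
  fixes \<iota> :: "'a \<Rightarrow> 'u" and x :: "'u set \<Rightarrow> 'u"
  assumes \<iota>_hom: "\<iota> \<in> hom (units_of K) U"
    and \<iota>_inj: "inj_on \<iota> (carrier (units_of K))"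
    and x_mem: "d \<in> carrier (ext_quot K U \<iota>) \<Longrightarrow> x d \<in> d"
begin

abbreviation D where "D \<equiv> ext_quot K U \<iota>"
abbreviation L where "L \<equiv> universal_algebra K U \<iota> x"
abbreviation cls where "cls \<equiv> ext_class K U \<iota>"
abbreviation cf where "cf \<equiv> ext_coord K U \<iota> x"
abbreviation hm where "hm \<equiv> ualg_homog K U \<iota> x"
abbreviation supp where "supp f \<equiv> {d \<in> carrier D. f d \<noteq> \<zero>}"

declare Units_closed [simp]

lemma K_Units: "a \<in> Units K \<longleftrightarrow> a \<in> carrier K \<and> a \<noteq> \<zero>"
  using field_Units by auto

lemma \<iota>_closed [simp]: "a \<in> Units K \<Longrightarrow> \<iota> a \<in> carrier U"
  using \<iota>_hom by (auto simp: hom_def units_of_carrier)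

lemma \<iota>_mult: "a \<in> Units K \<Longrightarrow> b \<in> Units K \<Longrightarrow> \<iota> (a \<otimes> b) = \<iota> a \<otimes>\<^bsub>U\<^esub> \<iota> b"
  using \<iota>_hom by (auto simp: hom_def units_of_carrier units_of_mult)

lemma \<iota>_eq: "a \<in> Units K \<Longrightarrow> b \<in> Units K \<Longrightarrow> \<iota> a = \<iota> b \<longleftrightarrow> a = b"
  using \<iota>_inj by (auto simp: inj_on_def units_of_carrier)

lemma \<iota>_one: "\<iota> \<one> = \<one>\<^bsub>U\<^esub>"
  using \<iota>_mult[of \<one> \<one>] U.l_cancel_one[of "\<iota> \<one>" "\<iota> \<one>"] by simp

lemma \<iota>_subgroup: "subgroup (\<iota> ` Units K) U"
proof (rule U.subgroupI)
  fix a assume "a \<in> \<iota> ` Units K"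
  then obtain c where c: "c \<in> Units K" "a = \<iota> c" by auto
  have "\<iota> (inv c) \<otimes>\<^bsub>U\<^esub> \<iota> c = \<one>\<^bsub>U\<^esub>" using c \<iota>_mult[of "inv c" c] \<iota>_one by simp
  then have "inv\<^bsub>U\<^esub> a = \<iota> (inv c)" using c U.inv_equality by simp
  then show "inv\<^bsub>U\<^esub> a \<in> \<iota> ` Units K" using c by auto
next
  fix a b assume "a \<in> \<iota> ` Units K" "b \<in> \<iota> ` Units K"
  then show "a \<otimes>\<^bsub>U\<^esub> b \<in> \<iota> ` Units K" by (auto simp flip: \<iota>_mult)
qed auto

lemma \<iota>_normal: "\<iota> ` Units K \<lhd> U"
  by (rule U.subgroup_imp_normal[OF \<iota>_subgroup])

lemma D_group: "comm_group D"
  unfolding ext_quot_def by (rule U.abelian_FactGroup[OF \<iota>_subgroup])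

lemma D_carrier: "d \<in> carrier D \<longleftrightarrow> (\<exists>u\<in>carrier U. d = cls u)"
  by (auto simp: ext_quot_def FactGroup_def RCOSETS_def ext_class_def)

lemma cls_closed [simp]: "u \<in> carrier U \<Longrightarrow> cls u \<in> carrier D"
  by (auto simp: D_carrier)

lemma cls_mult: "u \<in> carrier U \<Longrightarrow> v \<in> carrier U \<Longrightarrow> cls u \<otimes>\<^bsub>D\<^esub> cls v = cls (u \<otimes>\<^bsub>U\<^esub> v)"
  using normal.rcos_sum[OF \<iota>_normal, of u v] by (simp add: ext_quot_def FactGroup_def ext_class_def)

lemma cls_one: "cls \<one>\<^bsub>U\<^esub> = \<one>\<^bsub>D\<^esub>"
  using U.coset_join2[OF _ \<iota>_subgroup, of "\<one>\<^bsub>U\<^esub>"] subgroup.one_closed[OF \<iota>_subgroup]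
  by (simp add: ext_quot_def FactGroup_def ext_class_def)

lemma cls_mem: "v \<in> cls u \<longleftrightarrow> (\<exists>a\<in>Units K. v = \<iota> a \<otimes>\<^bsub>U\<^esub> u)"
  by (auto simp: ext_class_def r_coset_def)

lemma cls_eq:
  assumes "u \<in> carrier U" "v \<in> carrier U"
  shows "cls u = cls v \<longleftrightarrow> (\<exists>a\<in>Units K. v = \<iota> a \<otimes>\<^bsub>U\<^esub> u)"
proof -
  have "cls u = cls v \<longleftrightarrow> v \<in> cls u"
    using U.repr_independence[OF _ assms(1) \<iota>_subgroup, of v]
      U.repr_independenceD[OF \<iota>_subgroup assms(2), of u] by (auto simp: ext_class_def)
  then show ?thesis by (simp add: cls_mem)
qed

lemma x_closed [simp]: "d \<in> carrier D \<Longrightarrow> x d \<in> carrier U"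
  using x_mem[of d] by (auto simp: D_carrier cls_mem)

lemma cls_\<iota>: "a \<in> Units K \<Longrightarrow> u \<in> carrier U \<Longrightarrow> cls (\<iota> a \<otimes>\<^bsub>U\<^esub> u) = cls u"
  using cls_eq[of u "\<iota> a \<otimes>\<^bsub>U\<^esub> u"] by auto

lemma cls_x [simp]:
  assumes "d \<in> carrier D"
  shows "cls (x d) = d"
proof -
  obtain u where u: "u \<in> carrier U" "d = cls u" using assms by (auto simp: D_carrier)
  then obtain a where "a \<in> Units K" "x d = \<iota> a \<otimes>\<^bsub>U\<^esub> u"
    using x_mem[OF assms] cls_mem by auto
  then show ?thesis using u cls_\<iota> by simp
qed

lemma cf_eqI:
  assumes "u \<in> carrier U" "a \<in> Units K" "u = \<iota> a \<otimes>\<^bsub>U\<^esub> x (cls u)"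
  shows "cf u = a"
  unfolding ext_coord_def
proof (rule the_equality)
  show "a \<in> Units K \<and> u = \<iota> a \<otimes>\<^bsub>U\<^esub> x (cls u)" using assms by simp
  fix b assume b: "b \<in> Units K \<and> u = \<iota> b \<otimes>\<^bsub>U\<^esub> x (cls u)"
  have "\<iota> b \<otimes>\<^bsub>U\<^esub> x (cls u) = \<iota> a \<otimes>\<^bsub>U\<^esub> x (cls u)"
    by (rule trans[OF sym[OF conjunct2[OF b]] assms(3)])
  then have "\<iota> b = \<iota> a"
    using U.right_cancel[of "x (cls u)" "\<iota> b" "\<iota> a"] assms(1,2) conjunct1[OF b] by simp
  with b assms(2) show "b = a" by (simp add: \<iota>_eq)
qed

lemma cf:
  assumes "u \<in> carrier U"
  shows "cf u \<in> Units K" "u = \<iota> (cf u) \<otimes>\<^bsub>U\<^esub> x (cls u)"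
proof -
  have "cls (x (cls u)) = cls u" using assms by simp
  then obtain a where a: "a \<in> Units K" "u = \<iota> a \<otimes>\<^bsub>U\<^esub> x (cls u)"
    using assms cls_eq[of "x (cls u)" u] by auto
  from cf_eqI[OF assms this] a show "cf u \<in> Units K" "u = \<iota> (cf u) \<otimes>\<^bsub>U\<^esub> x (cls u)" by auto
qed

lemma cf_closed [simp]: "u \<in> carrier U \<Longrightarrow> cf u \<in> carrier K"
  using cf(1) by simp

lemma cf_\<iota>:
  assumes "a \<in> Units K" "u \<in> carrier U"
  shows "cf (\<iota> a \<otimes>\<^bsub>U\<^esub> u) = a \<otimes> cf u"
proof (rule cf_eqI)
  have "\<iota> a \<otimes>\<^bsub>U\<^esub> u = \<iota> a \<otimes>\<^bsub>U\<^esub> (\<iota> (cf u) \<otimes>\<^bsub>U\<^esub> x (cls u))"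
    using cf(2)[OF assms(2)] by simp
  also have "\<dots> = \<iota> (a \<otimes> cf u) \<otimes>\<^bsub>U\<^esub> x (cls (\<iota> a \<otimes>\<^bsub>U\<^esub> u))"
    using assms cf(1)[OF assms(2)] by (simp add: cls_\<iota> \<iota>_mult U.m_assoc)
  finally show "\<iota> a \<otimes>\<^bsub>U\<^esub> u = \<dots>" .
qed (use assms cf(1) in auto)

text \<open>The last factor is the structure constant of the two classes; the identity is what makes
  \<open>hm\<close> multiplicative.\<close>

lemma cf_mult:
  assumes "u \<in> carrier U" "v \<in> carrier U"
  shows "cf (u \<otimes>\<^bsub>U\<^esub> v) = cf u \<otimes> cf v \<otimes> cf (x (cls u) \<otimes>\<^bsub>U\<^esub> x (cls v))"
proof -
  let ?w = "x (cls u) \<otimes>\<^bsub>U\<^esub> x (cls v)"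
  have "u \<otimes>\<^bsub>U\<^esub> v = (\<iota> (cf u) \<otimes>\<^bsub>U\<^esub> x (cls u)) \<otimes>\<^bsub>U\<^esub> (\<iota> (cf v) \<otimes>\<^bsub>U\<^esub> x (cls v))"
    using cf(2)[OF assms(1)] cf(2)[OF assms(2)] by simp
  also have "\<dots> = \<iota> (cf u \<otimes> cf v) \<otimes>\<^bsub>U\<^esub> ?w"
    using assms cf(1) by (simp add: \<iota>_mult U.m_ac)
  finally show ?thesis using assms cf(1) cf_\<iota>[of "cf u \<otimes> cf v" ?w] by simp
qed

lemma L_simps:
  "carrier L = {f \<in> carrier D \<rightarrow>\<^sub>E carrier K. finite (supp f)}"
  "\<one>\<^bsub>L\<^esub> = hm \<one>\<^bsub>U\<^esub>"
  "\<zero>\<^bsub>L\<^esub> = (\<lambda>d\<in>carrier D. \<zero>)"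
  "f \<oplus>\<^bsub>L\<^esub> g = (\<lambda>d\<in>carrier D. f d \<oplus> g d)"
  "f \<otimes>\<^bsub>L\<^esub> g = (\<lambda>c\<in>carrier D. \<Oplus>i\<in>{(d, e). d \<in> supp f \<and> e \<in> supp g \<and> d \<otimes>\<^bsub>D\<^esub> e = c}. case i of (d, e) \<Rightarrow> f d \<otimes> g e \<otimes> cf (x d \<otimes>\<^bsub>U\<^esub> x e))"
  by (simp_all add: universal_algebra_def Let_def)

lemma L_ext: "f \<in> carrier L \<Longrightarrow> g \<in> carrier L \<Longrightarrow> (\<And>d. d \<in> carrier D \<Longrightarrow> f d = g d) \<Longrightarrow> f = g"
  by (auto simp: L_simps(1) intro: PiE_ext)

lemma L_memI:
  assumes "f \<in> extensional (carrier D)" "\<And>d. d \<in> carrier D \<Longrightarrow> f d \<in> carrier K" "finite (supp f)"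
  shows "f \<in> carrier L"
  unfolding L_simps(1) using assms by (simp add: PiE_def)

lemma L_ext_mem: "f \<in> carrier L \<Longrightarrow> f \<in> extensional (carrier D)"
  unfolding L_simps(1) by (simp add: PiE_def)

lemma L_app [simp]: "f \<in> carrier L \<Longrightarrow> d \<in> carrier D \<Longrightarrow> f d \<in> carrier K"
  by (auto simp: L_simps(1))

lemma L_supp [simp]: "f \<in> carrier L \<Longrightarrow> finite (supp f)"
  by (auto simp: L_simps(1))

lemma L_zero [simp]: "\<zero>\<^bsub>L\<^esub> \<in> carrier L"
proof -
  have "supp \<zero>\<^bsub>L\<^esub> = {}" by (simp add: L_simps(3))
  then show ?thesis unfolding L_simps(1) by (simp add: L_simps(3))
qed

lemma L_add_closed [simp]: "f \<in> carrier L \<Longrightarrow> g \<in> carrier L \<Longrightarrow> f \<oplus>\<^bsub>L\<^esub> g \<in> carrier L"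
proof -
  assume fg: "f \<in> carrier L" "g \<in> carrier L"
  have "supp (f \<oplus>\<^bsub>L\<^esub> g) \<subseteq> supp f \<union> supp g" by (auto simp: L_simps(4))
  then have "finite (supp (f \<oplus>\<^bsub>L\<^esub> g))" by (rule finite_subset) (use fg in simp)
  then show ?thesis
    by (rule L_memI[rotated 2]) (use fg in \<open>simp_all add: L_simps(4) extensional_def\<close>)
qed

lemma zero_app [simp]: "d \<in> carrier D \<Longrightarrow> \<zero>\<^bsub>L\<^esub> d = \<zero>"
  by (simp add: L_simps(3))

lemma hm_app: "d \<in> carrier D \<Longrightarrow> hm u d = (if d = cls u then cf u else \<zero>)"
  by (simp add: ualg_homog_def)

lemma supp_hm: "u \<in> carrier U \<Longrightarrow> supp (hm u) = {cls u}"
proof (rule Set.set_eqI)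
  fix d assume u: "u \<in> carrier U"
  then have "cf u \<noteq> \<zero>" using cf(1) K_Units by simp
  then show "d \<in> supp (hm u) \<longleftrightarrow> d \<in> {cls u}"
    using u by (cases "d = cls u") (simp_all add: hm_app cong: conj_cong)
qed

lemma hm_closed [simp]: "u \<in> carrier U \<Longrightarrow> hm u \<in> carrier L"
  by (rule L_memI) (simp_all add: supp_hm hm_app, simp add: ualg_homog_def extensional_def)

text \<open>Enlarging the index sets beyond the supports adds only zero terms. Products of elements
  with different supports can then be compared over a common index set, as distributivity
  requires.\<close>

lemma mult_app:
  assumes fg: "f \<in> carrier L" "g \<in> carrier L" and A: "finite A" "A \<subseteq> carrier D" "supp f \<subseteq> A"
    and B: "finite B" "B \<subseteq> carrier D" "supp g \<subseteq> B" and c: "c \<in> carrier D"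
  shows "(f \<otimes>\<^bsub>L\<^esub> g) c = (\<Oplus>i\<in>{(d, e). d \<in> A \<and> e \<in> B \<and> d \<otimes>\<^bsub>D\<^esub> e = c}. case i of (d, e) \<Rightarrow> f d \<otimes> g e \<otimes> cf (x d \<otimes>\<^bsub>U\<^esub> x e))"
proof -
  let ?P = "\<lambda>A B. {(d, e). d \<in> A \<and> e \<in> B \<and> d \<otimes>\<^bsub>D\<^esub> e = c}"
  have "finite (?P A B)"
    by (rule finite_subset[of _ "A \<times> B"]) (use A B in auto)
  then have "(\<Oplus>i\<in>?P (supp f) (supp g). case i of (d, e) \<Rightarrow> f d \<otimes> g e \<otimes> cf (x d \<otimes>\<^bsub>U\<^esub> x e)) =
     (\<Oplus>i\<in>?P A B. case i of (d, e) \<Rightarrow> f d \<otimes> g e \<otimes> cf (x d \<otimes>\<^bsub>U\<^esub> x e))"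
  proof (rule add.finprod_mono_neutral_cong_left)
    show "?P (supp f) (supp g) \<subseteq> ?P A B" using A B by auto
    fix i assume i: "i \<in> ?P A B - ?P (supp f) (supp g)"
    obtain d e where de: "i = (d, e)" by (cases i)
    have m: "d \<in> carrier D" "e \<in> carrier D" using i de A B by auto
    have "f d = \<zero> \<or> g e = \<zero>" using i de m by auto
    then have "f d \<otimes> g e \<otimes> cf (x d \<otimes>\<^bsub>U\<^esub> x e) = \<zero>" using m fg by auto
    then show "(case i of (d, e) \<Rightarrow> f d \<otimes> g e \<otimes> cf (x d \<otimes>\<^bsub>U\<^esub> x e)) = \<zero>" using de by simp
  next
    show "(\<lambda>i. case i of (d, e) \<Rightarrow> f d \<otimes> g e \<otimes> cf (x d \<otimes>\<^bsub>U\<^esub> x e)) \<in> ?P A B \<rightarrow> carrier K"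
    proof
      fix i assume i: "i \<in> ?P A B"
      obtain d e where de: "i = (d, e)" by (cases i)
      have "d \<in> carrier D" "e \<in> carrier D" using i de A B by auto
      then show "(case i of (d, e) \<Rightarrow> f d \<otimes> g e \<otimes> cf (x d \<otimes>\<^bsub>U\<^esub> x e)) \<in> carrier K"
        using de fg by simp
    qed
  qed auto
  then show ?thesis using c by (simp add: L_simps(5))
qed

lemma L_mult_ext: "f \<otimes>\<^bsub>L\<^esub> g \<in> extensional (carrier D)"
  by (simp add: L_simps(5) extensional_def)

lemma add_app: "d \<in> carrier D \<Longrightarrow> (f \<oplus>\<^bsub>L\<^esub> g) d = f d \<oplus> g d"
  by (simp add: L_simps(4))

lemma hm_mult:
  assumes u: "u \<in> carrier U" and v: "v \<in> carrier U"
  shows "hm u \<otimes>\<^bsub>L\<^esub> hm v = hm (u \<otimes>\<^bsub>U\<^esub> v)"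
proof (rule extensionalityI[where A = "carrier D"])
  show "hm (u \<otimes>\<^bsub>U\<^esub> v) \<in> extensional (carrier D)" by (simp add: ualg_homog_def extensional_def)
  fix c assume c: "c \<in> carrier D"
  have "(hm u \<otimes>\<^bsub>L\<^esub> hm v) c = (\<Oplus>i\<in>{(d, e). d \<in> {cls u} \<and> e \<in> {cls v} \<and> d \<otimes>\<^bsub>D\<^esub> e = c}. case i of (d, e) \<Rightarrow> hm u d \<otimes> hm v e \<otimes> cf (x d \<otimes>\<^bsub>U\<^esub> x e))"
    by (rule mult_app) (use u v c supp_hm in auto)
  also have "{(d, e). d \<in> {cls u} \<and> e \<in> {cls v} \<and> d \<otimes>\<^bsub>D\<^esub> e = c} =
      (if c = cls (u \<otimes>\<^bsub>U\<^esub> v) then {(cls u, cls v)} else {})"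
    using u v by (auto simp: cls_mult)
  also have "(\<Oplus>i\<in>\<dots>. case i of (d, e) \<Rightarrow> hm u d \<otimes> hm v e \<otimes> cf (x d \<otimes>\<^bsub>U\<^esub> x e)) = hm (u \<otimes>\<^bsub>U\<^esub> v) c"
    using u v c by (simp add: hm_app cf_mult[OF u v])
  finally show "(hm u \<otimes>\<^bsub>L\<^esub> hm v) c = hm (u \<otimes>\<^bsub>U\<^esub> v) c" .
qed (rule L_mult_ext)

lemma L_l_distr:
  assumes f: "f \<in> carrier L" and g: "g \<in> carrier L" and l: "l \<in> carrier L"
  shows "(f \<oplus>\<^bsub>L\<^esub> g) \<otimes>\<^bsub>L\<^esub> l = f \<otimes>\<^bsub>L\<^esub> l \<oplus>\<^bsub>L\<^esub> g \<otimes>\<^bsub>L\<^esub> l"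
proof (rule extensionalityI[where A = "carrier D"])
  show "f \<otimes>\<^bsub>L\<^esub> l \<oplus>\<^bsub>L\<^esub> g \<otimes>\<^bsub>L\<^esub> l \<in> extensional (carrier D)" by (simp add: L_simps(4) extensional_def)
  fix c assume c: "c \<in> carrier D"
  let ?A = "supp f \<union> supp g" and ?B = "supp l"
  let ?S = "{(d, e). d \<in> ?A \<and> e \<in> ?B \<and> d \<otimes>\<^bsub>D\<^esub> e = c}"
  have fin: "finite ?A" "finite ?B" using f g l by auto
  have sub: "supp (f \<oplus>\<^bsub>L\<^esub> g) \<subseteq> ?A" by (auto simp: add_app)
  have "((f \<oplus>\<^bsub>L\<^esub> g) \<otimes>\<^bsub>L\<^esub> l) c = (\<Oplus>i\<in>?S. case i of (d, e) \<Rightarrow> (f \<oplus>\<^bsub>L\<^esub> g) d \<otimes> l e \<otimes> cf (x d \<otimes>\<^bsub>U\<^esub> x e))"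
    by (rule mult_app[OF L_add_closed[OF f g] l fin(1) _ sub fin(2) _ _ c]) auto
  also have "\<dots> = (\<Oplus>i\<in>?S. (case i of (d, e) \<Rightarrow> f d \<otimes> l e \<otimes> cf (x d \<otimes>\<^bsub>U\<^esub> x e)) \<oplus>
      (case i of (d, e) \<Rightarrow> g d \<otimes> l e \<otimes> cf (x d \<otimes>\<^bsub>U\<^esub> x e)))"
    by (rule finsum_cong') (use f g l in \<open>auto simp: add_app l_distr\<close>)
  also have "\<dots> = (\<Oplus>i\<in>?S. case i of (d, e) \<Rightarrow> f d \<otimes> l e \<otimes> cf (x d \<otimes>\<^bsub>U\<^esub> x e)) \<oplus>
      (\<Oplus>i\<in>?S. case i of (d, e) \<Rightarrow> g d \<otimes> l e \<otimes> cf (x d \<otimes>\<^bsub>U\<^esub> x e))"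
    by (rule finsum_addf) (use f g l in auto)
  also have "(\<Oplus>i\<in>?S. case i of (d, e) \<Rightarrow> f d \<otimes> l e \<otimes> cf (x d \<otimes>\<^bsub>U\<^esub> x e)) = (f \<otimes>\<^bsub>L\<^esub> l) c"
    by (rule mult_app[OF f l fin(1) _ _ fin(2) _ _ c, symmetric]) auto
  also have "(\<Oplus>i\<in>?S. case i of (d, e) \<Rightarrow> g d \<otimes> l e \<otimes> cf (x d \<otimes>\<^bsub>U\<^esub> x e)) = (g \<otimes>\<^bsub>L\<^esub> l) c"
    by (rule mult_app[OF g l fin(1) _ _ fin(2) _ _ c, symmetric]) auto
  finally show "((f \<oplus>\<^bsub>L\<^esub> g) \<otimes>\<^bsub>L\<^esub> l) c = (f \<otimes>\<^bsub>L\<^esub> l \<oplus>\<^bsub>L\<^esub> g \<otimes>\<^bsub>L\<^esub> l) c"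
    using c by (simp add: add_app)
qed (rule L_mult_ext)

lemma L_m_comm:
  assumes f: "f \<in> carrier L" and g: "g \<in> carrier L"
  shows "f \<otimes>\<^bsub>L\<^esub> g = g \<otimes>\<^bsub>L\<^esub> f"
proof (rule extensionalityI[where A = "carrier D"])
  interpret D: comm_group D by (rule D_group)
  fix c assume c: "c \<in> carrier D"
  let ?S = "{(d, e). d \<in> supp f \<and> e \<in> supp g \<and> d \<otimes>\<^bsub>D\<^esub> e = c}"
  let ?T = "{(d, e). d \<in> supp g \<and> e \<in> supp f \<and> d \<otimes>\<^bsub>D\<^esub> e = c}"
  have "?T = prod.swap ` ?S" by (auto simp: D.m_comm image_def)
  then have "(g \<otimes>\<^bsub>L\<^esub> f) c = (\<Oplus>i\<in>prod.swap ` ?S. case i of (d, e) \<Rightarrow> g d \<otimes> f e \<otimes> cf (x d \<otimes>\<^bsub>U\<^esub> x e))"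
    using c by (simp add: L_simps(5))
  also have "\<dots> = (\<Oplus>i\<in>?S. case prod.swap i of (d, e) \<Rightarrow> g d \<otimes> f e \<otimes> cf (x d \<otimes>\<^bsub>U\<^esub> x e))"
    by (rule finsum_reindex) (use f g in auto)
  also have "\<dots> = (\<Oplus>i\<in>?S. case i of (d, e) \<Rightarrow> f d \<otimes> g e \<otimes> cf (x d \<otimes>\<^bsub>U\<^esub> x e))"
    by (rule finsum_cong') (use f g in \<open>auto simp: m_comm U.m_comm\<close>)
  finally show "(f \<otimes>\<^bsub>L\<^esub> g) c = (g \<otimes>\<^bsub>L\<^esub> f) c" using c by (simp add: L_simps(5))
qed (rule L_mult_ext)+

text \<open>Splits off one homogeneous component at a time. With it the multiplicative ring laws
  reduce to homogeneous elements, where they are laws of \<open>U\<close>.\<close>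

lemma L_induct [consumes 1, case_names zero homog add]:
  assumes f: "f \<in> carrier L"
    and zero: "P \<zero>\<^bsub>L\<^esub>" and homog: "\<And>u. u \<in> carrier U \<Longrightarrow> P (hm u)"
    and add: "\<And>f g. f \<in> carrier L \<Longrightarrow> g \<in> carrier L \<Longrightarrow> P f \<Longrightarrow> P g \<Longrightarrow> P (f \<oplus>\<^bsub>L\<^esub> g)"
  shows "P f"
  using f
proof (induct "card (supp f)" arbitrary: f)
  case 0
  then have "supp f = {}" by simp
  then have "f = \<zero>\<^bsub>L\<^esub>" using 0 by (intro L_ext) auto
  then show ?case using zero by simp
next
  case (Suc n)
  then obtain d where d: "d \<in> supp f" by (metis card.empty ex_in_conv nat.distinct(1))
  define u where "u = \<iota> (f d) \<otimes>\<^bsub>U\<^esub> x d"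
  have fd: "f d \<in> Units K" using d Suc(3) by (simp add: K_Units)
  have u: "u \<in> carrier U" "cls u = d" using d fd by (auto simp: u_def cls_\<iota>)
  have cu: "cf u = f d" by (rule cf_eqI) (use u fd in \<open>auto simp: u_def\<close>)
  define g where "g = f(d := \<zero>)"
  have sg: "supp g = supp f - {d}" by (auto simp: g_def)
  have g: "g \<in> carrier L"
  proof (rule L_memI)
    show "g \<in> extensional (carrier D)"
      using L_ext_mem[OF Suc(3)] d by (auto simp: g_def extensional_def)
    show "finite (supp g)" unfolding sg using Suc(3) by simp
  qed (use Suc(3) in \<open>simp add: g_def\<close>)
  have "card (supp g) = n" using sg Suc(2) d Suc(3) by simp
  then have "P g" using Suc(1) g by simp
  moreover have "hm u \<oplus>\<^bsub>L\<^esub> g = f"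
    by (rule L_ext) (use u g Suc(3) cu in \<open>auto simp: add_app hm_app g_def\<close>)
  ultimately show ?case using add[OF hm_closed[OF u(1)] g homog[OF u(1)]] by simp
qed

lemma L_mult_zero: "f \<in> carrier L \<Longrightarrow> \<zero>\<^bsub>L\<^esub> \<otimes>\<^bsub>L\<^esub> f = \<zero>\<^bsub>L\<^esub>"
proof (rule extensionalityI[OF L_mult_ext L_ext_mem[OF L_zero]])
  fix c assume f: "f \<in> carrier L" and c: "c \<in> carrier D"
  show "(\<zero>\<^bsub>L\<^esub> \<otimes>\<^bsub>L\<^esub> f) c = \<zero>\<^bsub>L\<^esub> c"
    using mult_app[OF L_zero f, of "{}" "supp f" c] f c by simp
qed

lemma L_mult_closed [simp]:
  assumes "f \<in> carrier L" "g \<in> carrier L"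
  shows "f \<otimes>\<^bsub>L\<^esub> g \<in> carrier L"
  using assms
proof (induct f rule: L_induct)
  case (homog u)
  from homog(2) show ?case
  proof (induct g rule: L_induct)
    case zero
    then show ?case using L_mult_zero homog(1) L_m_comm by simp
  next
    case (homog v)
    then show ?case using \<open>u \<in> carrier U\<close> by (simp add: hm_mult)
  next
    case (add f g)
    then have "hm u \<otimes>\<^bsub>L\<^esub> (f \<oplus>\<^bsub>L\<^esub> g) = hm u \<otimes>\<^bsub>L\<^esub> f \<oplus>\<^bsub>L\<^esub> hm u \<otimes>\<^bsub>L\<^esub> g"
      using L_l_distr[of f g "hm u"] L_m_comm[of "hm u"] homog(1) by simp
    then show ?case using add by simp
  qed
qed (simp_all add: L_mult_zero L_l_distr)

lemma L_r_distr:
  assumes "f \<in> carrier L" "g \<in> carrier L" "l \<in> carrier L"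
  shows "l \<otimes>\<^bsub>L\<^esub> (f \<oplus>\<^bsub>L\<^esub> g) = l \<otimes>\<^bsub>L\<^esub> f \<oplus>\<^bsub>L\<^esub> l \<otimes>\<^bsub>L\<^esub> g"
  using L_l_distr[OF assms] L_m_comm[of l] assms by simp

lemma L_m_assoc:
  assumes "f \<in> carrier L" "g \<in> carrier L" "l \<in> carrier L"
  shows "f \<otimes>\<^bsub>L\<^esub> g \<otimes>\<^bsub>L\<^esub> l = f \<otimes>\<^bsub>L\<^esub> (g \<otimes>\<^bsub>L\<^esub> l)"
  using assms
proof (induct f rule: L_induct)
  case zero
  then show ?case by (simp add: L_mult_zero)
next
  case (add f1 f2)
  then show ?case by (simp add: L_l_distr)
next
  case (homog u)
  from homog(2,3) show ?case
  proof (induct g rule: L_induct)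
    case zero
    then show ?case using homog(1) L_m_comm[of "hm u" "\<zero>\<^bsub>L\<^esub>"] by (simp add: L_mult_zero)
  next
    case (add g1 g2)
    then show ?case using homog(1) by (simp add: L_l_distr L_r_distr)
  next
    case (homog v)
    from homog(2) show ?case
    proof (induct l rule: L_induct)
      case zero
      then show ?case
        using \<open>u \<in> carrier U\<close> \<open>v \<in> carrier U\<close> L_m_comm[of _ "\<zero>\<^bsub>L\<^esub>"] by (simp add: L_mult_zero)
    next
      case (add l1 l2)
      then show ?case using \<open>u \<in> carrier U\<close> \<open>v \<in> carrier U\<close> by (simp add: L_r_distr)
    next
      case (homog w)
      then show ?case
        using \<open>u \<in> carrier U\<close> \<open>v \<in> carrier U\<close> by (simp add: hm_mult U.m_assoc)
    qed
  qed
qed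

lemma L_l_one: "f \<in> carrier L \<Longrightarrow> \<one>\<^bsub>L\<^esub> \<otimes>\<^bsub>L\<^esub> f = f"
proof (induct f rule: L_induct)
  case zero
  then show ?case using L_m_comm[of "\<one>\<^bsub>L\<^esub>" "\<zero>\<^bsub>L\<^esub>"] by (simp add: L_mult_zero L_simps(2))
next
  case (homog u)
  then show ?case by (simp add: L_simps(2) hm_mult)
next
  case (add f g)
  then show ?case by (simp add: L_r_distr L_simps(2))
qed

lemma L_cring: "cring L"
proof (rule cringI)
  show "abelian_group L"
  proof (rule abelian_groupI)
    fix f g l assume fgl: "f \<in> carrier L" "g \<in> carrier L" "l \<in> carrier L"
    show "f \<oplus>\<^bsub>L\<^esub> g \<oplus>\<^bsub>L\<^esub> l = f \<oplus>\<^bsub>L\<^esub> (g \<oplus>\<^bsub>L\<^esub> l)"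
      by (rule L_ext) (use fgl in \<open>auto simp: add_app a_assoc\<close>)
  next
    fix f g assume fg: "f \<in> carrier L" "g \<in> carrier L"
    show "f \<oplus>\<^bsub>L\<^esub> g = g \<oplus>\<^bsub>L\<^esub> f"
      by (rule L_ext) (use fg in \<open>auto simp: add_app a_comm\<close>)
  next
    fix f assume f: "f \<in> carrier L"
    show "\<zero>\<^bsub>L\<^esub> \<oplus>\<^bsub>L\<^esub> f = f"
      by (rule L_ext) (use f in \<open>auto simp: add_app\<close>)
    let ?g = "\<lambda>d\<in>carrier D. \<ominus> f d"
    have "supp ?g \<subseteq> supp f" by auto
    then have "finite (supp ?g)" by (rule finite_subset) (use f in simp)
    then have g: "?g \<in> carrier L" by (rule L_memI[rotated 2]) (use f in \<open>simp_all add: extensional_def\<close>)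
    have "?g \<oplus>\<^bsub>L\<^esub> f = \<zero>\<^bsub>L\<^esub>"
      by (rule L_ext) (use f g in \<open>auto simp: add_app l_neg\<close>)
    with g show "\<exists>y\<in>carrier L. y \<oplus>\<^bsub>L\<^esub> f = \<zero>\<^bsub>L\<^esub>" by blast
  qed auto
  show "comm_monoid L"
    by (rule comm_monoidI) (auto simp: L_m_assoc L_l_one intro: L_m_comm, simp add: L_simps(2))
qed (rule L_l_distr)

end


section \<open>Scalars, homogeneous components and the grading of the universal algebra\<close>

context unit_extension
begin

abbreviation sc where "sc \<equiv> ualg_scalar K U \<iota> x"
abbreviation k where "k \<equiv> sc ` carrier K"
abbreviation W where "W \<equiv> hm ` carrier U"

lemma sc_app: "d \<in> carrier D \<Longrightarrow> sc a d = a \<otimes> hm \<one>\<^bsub>U\<^esub> d"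
  by (simp add: ualg_scalar_def L_simps(2))

lemma sc_ext: "sc a \<in> extensional (carrier D)"
  by (simp add: ualg_scalar_def extensional_def)

lemma sc_unit: "a \<in> Units K \<Longrightarrow> sc a = hm (\<iota> a)"
proof (rule extensionalityI[OF sc_ext L_ext_mem])
  fix d assume a: "a \<in> Units K" and d: "d \<in> carrier D"
  have "cls (\<iota> a) = cls \<one>\<^bsub>U\<^esub>" "cf (\<iota> a) = a \<otimes> cf \<one>\<^bsub>U\<^esub>"
    using cls_\<iota>[OF a, of "\<one>\<^bsub>U\<^esub>"] cf_\<iota>[OF a, of "\<one>\<^bsub>U\<^esub>"] a by simp_all
  then show "sc a d = hm (\<iota> a) d" using a d by (simp add: sc_app hm_app)
qed simp

lemma sc_zero: "sc \<zero> = \<zero>\<^bsub>L\<^esub>"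
  by (rule extensionalityI[OF sc_ext L_ext_mem[OF L_zero]]) (simp add: sc_app hm_app)

lemma sc_closed [simp]: "a \<in> carrier K \<Longrightarrow> sc a \<in> carrier L"
  using sc_unit[of a] sc_zero by (cases "a = \<zero>") (simp_all add: K_Units)

lemma hm_inj:
  assumes "u \<in> carrier U" "v \<in> carrier U" "hm u = hm v"
  shows "u = v"
proof -
  have "{cls u} = {cls v}"
    using supp_hm[OF assms(1)] supp_hm[OF assms(2)] unfolding assms(3) by simp
  then have c: "cls u = cls v" by simp
  have "cf u = hm u (cls u)" using assms(1) by (simp add: hm_app)
  also have "\<dots> = hm v (cls v)" unfolding assms(3) c ..
  also have "\<dots> = cf v" using assms(2) by (simp add: hm_app)
  finally have "cf u = cf v" .
  then show ?thesis using cf(2)[OF assms(1)] cf(2)[OF assms(2)] c by simp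
qed

lemma hm_nonzero: "u \<in> carrier U \<Longrightarrow> hm u \<noteq> \<zero>\<^bsub>L\<^esub>"
proof
  assume u: "u \<in> carrier U" "hm u = \<zero>\<^bsub>L\<^esub>"
  then have "hm u (cls u) = \<zero>" by simp
  then show False using cf(1)[OF u(1)] u(1) K_Units by (simp add: hm_app)
qed

lemma sc_hom: "ring_hom_ring K L sc"
proof (rule ring_hom_ringI)
  show "ring K" by (rule ring_axioms)
  show "ring L" using L_cring by (rule cring.axioms)
  fix a b assume ab: "a \<in> carrier K" "b \<in> carrier K"
  show "sc (a \<oplus> b) = sc a \<oplus>\<^bsub>L\<^esub> sc b"
    by (rule L_ext) (use ab in \<open>simp_all add: sc_app add_app hm_app l_distr\<close>)
  show "sc (a \<otimes> b) = sc a \<otimes>\<^bsub>L\<^esub> sc b"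
  proof (cases "a = \<zero> \<or> b = \<zero>")
    case True
    then show ?thesis
      using ab L_mult_zero[of "sc b"] L_mult_zero[of "sc a"] L_m_comm[of "sc a" "\<zero>\<^bsub>L\<^esub>"]
      by (auto simp: sc_zero)
  next
    case False
    then have "a \<in> Units K" "b \<in> Units K" using ab K_Units by auto
    then show ?thesis by (simp add: sc_unit \<iota>_mult hm_mult)
  qed
next
  show "sc \<one> = \<one>\<^bsub>L\<^esub>" by (simp add: sc_unit \<iota>_one L_simps(2))
qed simp

lemma L_one_nz: "\<one>\<^bsub>L\<^esub> \<noteq> \<zero>\<^bsub>L\<^esub>"
  using hm_nonzero[of "\<one>\<^bsub>U\<^esub>"] by (simp add: L_simps(2))

lemma k_subfield: "subfield k L"
  using ring_hom_ring.img_is_subfield(2)[OF sc_hom carrier_is_subfield L_one_nz] .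

lemma sc_inj: "inj_on sc (carrier K)"
  using ring_hom_ring.img_is_subfield(1)[OF sc_hom carrier_is_subfield L_one_nz] .

lemma sc_nz: "a \<in> carrier K \<Longrightarrow> sc a = \<zero>\<^bsub>L\<^esub> \<longleftrightarrow> a = \<zero>"
  using inj_on_eq_iff[OF sc_inj, of a \<zero>] sc_zero by simp

lemma k_nz: "k - {\<zero>\<^bsub>L\<^esub>} = hm ` \<iota> ` Units K"
proof -
  have "k - {\<zero>\<^bsub>L\<^esub>} = sc ` Units K" using sc_nz by (auto simp: K_Units)
  also have "\<dots> = (\<lambda>a. hm (\<iota> a)) ` Units K" by (rule image_cong) (simp_all add: sc_unit)
  finally show ?thesis by (simp add: image_image)
qed

lemma proportional_hm:
  assumes "u \<in> carrier U" "v \<in> carrier U"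
  shows "ring.proportional L k (hm u) (hm v) \<longleftrightarrow> cls u = cls v"
proof -
  interpret L: cring L by (rule L_cring)
  have "ring.proportional L k (hm u) (hm v) \<longleftrightarrow> (\<exists>a\<in>Units K. hm v = hm (\<iota> a \<otimes>\<^bsub>U\<^esub> u))"
    unfolding L.proportional_def k_nz using assms by (simp add: hm_mult)
  also have "\<dots> \<longleftrightarrow> (\<exists>a\<in>Units K. v = \<iota> a \<otimes>\<^bsub>U\<^esub> u)"
    using hm_inj assms by (metis U.m_closed \<iota>_closed)
  finally show ?thesis using cls_eq assms by simp
qed

lemma finsum_app:
  assumes "finite I" "\<And>i. i \<in> I \<Longrightarrow> g i \<in> carrier L" "d \<in> carrier D"
  shows "(\<Oplus>\<^bsub>L\<^esub>i\<in>I. g i) d = (\<Oplus>i\<in>I. g i d)"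
  using assms(1,2)
proof (induct I rule: finite_induct)
  case empty
  interpret L: cring L by (rule L_cring)
  show ?case using assms(3) by simp
next
  case (insert i I)
  interpret L: cring L by (rule L_cring)
  have "(\<Oplus>\<^bsub>L\<^esub>i\<in>insert i I. g i) = g i \<oplus>\<^bsub>L\<^esub> (\<Oplus>\<^bsub>L\<^esub>i\<in>I. g i)"
    by (rule L.finsum_insert) (use insert in auto)
  moreover have "(\<Oplus>i\<in>insert i I. g i d) = g i d \<oplus> (\<Oplus>i\<in>I. g i d)"
    by (rule finsum_insert) (use insert assms(3) in auto)
  ultimately show ?case using insert assms(3) by (simp add: add_app)
qed

text \<open>The homogeneous component \<open>f d \<cdot> x\<^sub>d\<close>, as an element of \<open>U\<close>.\<close>

definition part_of :: "('u set \<Rightarrow> 'a) \<Rightarrow> 'u set \<Rightarrow> 'u" where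
  "part_of f d = \<iota> (f d) \<otimes>\<^bsub>U\<^esub> x d"

lemma part_of:
  assumes "f \<in> carrier L" "d \<in> supp f"
  shows "part_of f d \<in> carrier U" "cls (part_of f d) = d" "cf (part_of f d) = f d"
proof -
  have fd: "f d \<in> Units K" using assms by (simp add: K_Units)
  show u: "part_of f d \<in> carrier U" "cls (part_of f d) = d"
    using assms fd by (auto simp: part_of_def cls_\<iota>)
  show "cf (part_of f d) = f d" by (rule cf_eqI) (use u fd in \<open>auto simp: part_of_def\<close>)
qed

lemma decomposition:
  assumes f: "f \<in> carrier L"
  shows "f = (\<Oplus>\<^bsub>L\<^esub>d\<in>supp f. hm (part_of f d))"
proof (rule L_ext[OF f])
  interpret L: cring L by (rule L_cring)
  show "(\<Oplus>\<^bsub>L\<^esub>d\<in>supp f. hm (part_of f d)) \<in> carrier L"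
    by (rule L.finsum_closed) (use part_of[OF f] in auto)
  fix c assume c: "c \<in> carrier D"
  have "(\<Oplus>\<^bsub>L\<^esub>d\<in>supp f. hm (part_of f d)) c = (\<Oplus>d\<in>supp f. hm (part_of f d) c)"
    by (rule finsum_app) (use f c part_of[OF f] in auto)
  also have "\<dots> = (\<Oplus>d\<in>supp f. if c = d then f d else \<zero>)"
    by (rule finsum_cong') (use f c part_of[OF f] in \<open>auto simp: hm_app\<close>)
  also have "\<dots> = f c"
  proof (cases "c \<in> supp f")
    case True
    then show ?thesis using add.finprod_singleton[of c "supp f" f] f by (simp add: Pi_def)
  next
    case False
    have "(\<Oplus>d\<in>supp f. if c = d then f d else \<zero>) = (\<Oplus>d\<in>supp f. \<zero>)"
      by (rule finsum_cong') (use False in auto)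
    then show ?thesis using False c by simp
  qed
  finally show "f c = (\<Oplus>\<^bsub>L\<^esub>d\<in>supp f. hm (part_of f d)) c" by simp
qed

text \<open>The form demanded by \<open>W_generate\<close>: the sum runs over the set of components
  itself, which repeats nothing because components of different degree are different.\<close>

lemma decomposition_image:
  assumes f: "f \<in> carrier L"
  shows "f = (\<Oplus>\<^bsub>L\<^esub>s\<in>(\<lambda>d. hm (part_of f d)) ` supp f. s)"
    and "s \<in> (\<lambda>d. hm (part_of f d)) ` supp f \<Longrightarrow> t \<in> (\<lambda>d. hm (part_of f d)) ` supp f \<Longrightarrow> s \<noteq> t \<Longrightarrow>
      \<not> ring.proportional L k s t"
proof -
  interpret L: cring L by (rule L_cring)
  let ?S = "(\<lambda>d. hm (part_of f d)) ` supp f"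
  have cl: "d = e" if "d \<in> supp f" "e \<in> supp f" "cls (part_of f d) = cls (part_of f e)" for d e
    using that part_of(2)[OF f] by metis
  have inj: "inj_on (\<lambda>d. hm (part_of f d)) (supp f)"
  proof (rule inj_onI)
    fix d e assume de: "d \<in> supp f" "e \<in> supp f" "hm (part_of f d) = hm (part_of f e)"
    then have "part_of f d = part_of f e" using hm_inj part_of(1)[OF f] by metis
    then show "d = e" using cl de by simp
  qed
  have "(\<Oplus>\<^bsub>L\<^esub>s\<in>?S. s) = (\<Oplus>\<^bsub>L\<^esub>d\<in>supp f. hm (part_of f d))"
    by (rule L.finsum_reindex[OF _ inj]) (use part_of(1)[OF f] in auto)
  then show "f = (\<Oplus>\<^bsub>L\<^esub>s\<in>?S. s)" using decomposition[OF f] by simp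
  show "\<not> L.proportional k s t" if st: "s \<in> ?S" "t \<in> ?S" "s \<noteq> t"
  proof -
    obtain d e where de: "d \<in> supp f" "s = hm (part_of f d)" "e \<in> supp f" "t = hm (part_of f e)"
      using st by auto
    then show ?thesis using proportional_hm[OF part_of(1)[OF f de(1)] part_of(1)[OF f de(3)]] cl st(3)
      by auto
  qed
qed

lemma L_graded_algebra: "graded_algebra L k W"
proof -
  interpret L: cring_subfield L k
    by (intro cring_subfield.intro cring_subfield_axioms.intro L_cring k_subfield)
  have inv: "hm u \<otimes>\<^bsub>L\<^esub> hm (inv\<^bsub>U\<^esub> u) = \<one>\<^bsub>L\<^esub>" if "u \<in> carrier U" for u
    using that by (simp add: hm_mult L_simps(2))
  show ?thesis
  proof
    fix w assume "w \<in> W"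
    then obtain u where u: "u \<in> carrier U" "w = hm u" by auto
    have i: "hm u \<otimes>\<^bsub>L\<^esub> hm (inv\<^bsub>U\<^esub> u) = \<one>\<^bsub>L\<^esub>" "hm (inv\<^bsub>U\<^esub> u) \<otimes>\<^bsub>L\<^esub> hm u = \<one>\<^bsub>L\<^esub>"
      using inv[OF u(1)] L_m_comm[of "hm u" "hm (inv\<^bsub>U\<^esub> u)"] u by simp_all
    have c: "hm u \<in> carrier L" "hm (inv\<^bsub>U\<^esub> u) \<in> carrier L" using u by simp_all
    show "w \<in> Units L" unfolding Units_def using i c u by blast
    have "inv\<^bsub>L\<^esub> w = hm (inv\<^bsub>U\<^esub> u)" using L.comm_inv_char[OF c i(1)] u by simp
    then show "inv\<^bsub>L\<^esub> w \<in> W" using u by simp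
    \<comment> \<open>The projection to the line of degree \<open>cls u\<close>.\<close>
    let ?\<phi> = "\<lambda>f. \<lambda>d\<in>carrier D. if d = cls u then f d else \<zero>"
    have eq: "?\<phi> (hm u) = hm u"
      by (rule extensionalityI[OF _ L_ext_mem[OF c(1)]]) (use u in \<open>simp_all add: extensional_def hm_app\<close>)
    have z: "?\<phi> \<zero>\<^bsub>L\<^esub> = \<zero>\<^bsub>L\<^esub>"
      by (rule extensionalityI[OF _ L_ext_mem[OF L_zero]])
        (use u in \<open>simp_all add: extensional_def\<close>)
    have add: "?\<phi> (f \<oplus>\<^bsub>L\<^esub> g) = ?\<phi> f \<oplus>\<^bsub>L\<^esub> ?\<phi> g" if "f \<in> carrier L" "g \<in> carrier L" for f g
      by (rule extensionalityI[of _ "carrier D"])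
        (use u in \<open>simp_all add: extensional_def L_simps(4)\<close>)
    have other: "?\<phi> v = \<zero>\<^bsub>L\<^esub>" if v: "v \<in> W" "\<not> L.proportional k w v" for v
    proof (rule extensionalityI[OF _ L_ext_mem[OF L_zero]])
      obtain u' where u': "u' \<in> carrier U" "v = hm u'" using v by auto
      then have "cls u \<noteq> cls u'" using v(2) u proportional_hm by simp
      then show "?\<phi> v d = \<zero>\<^bsub>L\<^esub> d" if "d \<in> carrier D" for d
        using that u' u(1) by (simp add: hm_app)
    qed (simp add: extensional_def)
    show "\<exists>\<phi>. \<phi> w \<in> carrier L \<and> \<phi> w \<noteq> \<zero>\<^bsub>L\<^esub> \<and> \<phi> \<zero>\<^bsub>L\<^esub> = \<zero>\<^bsub>L\<^esub> \<and>
      (\<forall>f\<in>carrier L. \<forall>g\<in>carrier L. \<phi> (f \<oplus>\<^bsub>L\<^esub> g) = \<phi> f \<oplus>\<^bsub>L\<^esub> \<phi> g) \<and>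
      (\<forall>v\<in>W. \<not> L.proportional k w v \<longrightarrow> \<phi> v = \<zero>\<^bsub>L\<^esub>)"
    proof (intro exI[of _ ?\<phi>] conjI ballI impI)
      show "?\<phi> w \<in> carrier L" "?\<phi> w \<noteq> \<zero>\<^bsub>L\<^esub>"
        unfolding u(2) eq using c(1) hm_nonzero[OF u(1)] .
    qed (rule z add other; assumption)+
  next
    fix v w assume "v \<in> W" "w \<in> W"
    then show "v \<otimes>\<^bsub>L\<^esub> w \<in> W" by (auto simp: hm_mult)
  next
    fix c assume "c \<in> k" "c \<noteq> \<zero>\<^bsub>L\<^esub>"
    then have "c \<in> hm ` \<iota> ` Units K" using k_nz by blast
    then show "c \<in> W" by auto
  next
    fix f assume f: "f \<in> carrier L"
    let ?S = "(\<lambda>d. hm (part_of f d)) ` supp f"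
    have "finite ?S" "?S \<subseteq> W" using f part_of(1)[OF f] by auto
    with decomposition_image[OF f] show "\<exists>S. finite S \<and> S \<subseteq> W \<and>
      (\<forall>s\<in>S. \<forall>t\<in>S. s \<noteq> t \<longrightarrow> \<not> L.proportional k s t) \<and> f = (\<Oplus>\<^bsub>L\<^esub>s\<in>S. s)"
      by (intro exI[of _ ?S] conjI ballI impI)
  qed
qed

end


section \<open>Translation between the conditions on \<open>D\<close>, \<open>K\<close> and
  \<open>L\<close> and the abstract settings\<close>

lemma (in domain) square_eq_minus_one:
  assumes z: "z \<in> carrier R" "z [^] (4::nat) = \<one>" "z [^] (2::nat) \<noteq> \<one>"
  shows "z \<otimes> z = \<ominus> \<one>"
proof -
  define w where "w = z \<otimes> z"
  have w: "w \<in> carrier R" "w \<otimes> w = \<one>" "w \<noteq> \<one>"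
    using z by (simp_all add: w_def numeral_eq_Suc m_assoc)
  have "(w \<oplus> \<ominus> \<one>) \<otimes> (w \<oplus> \<one>) = (w \<otimes> w \<oplus> \<ominus> w) \<oplus> (w \<oplus> \<ominus> \<one>)"
    using w(1) by (simp add: l_distr r_distr l_minus)
  also have "\<dots> = (w \<otimes> w \<oplus> \<ominus> \<one>) \<oplus> (w \<oplus> \<ominus> w)"
    using w(1) by (simp only: a_ac m_closed one_closed a_inv_closed a_closed)
  also have "\<dots> = \<zero>" using w by (simp add: r_neg)
  finally have "w \<oplus> \<ominus> \<one> = \<zero> \<or> w \<oplus> \<one> = \<zero>"
    using integral[of "w \<oplus> \<ominus> \<one>" "w \<oplus> \<one>"] w(1) by simp
  moreover have "w \<oplus> \<ominus> \<one> \<noteq> \<zero>"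
    using w r_right_minus_eq[of w \<one>] by (simp add: minus_eq)
  ultimately have "\<ominus> \<one> = w" using minus_equality[of w \<one>] w(1) by simp
  then show ?thesis by (simp add: w_def)
qed

lemma (in monoid) units_ord_dvd:
  assumes "z \<in> Units G"
  shows "z [^] (n::nat) = \<one> \<longleftrightarrow> group.ord (units_of G) z dvd n"
  using group.pow_eq_id[OF units_group, of z n] assms
  by (simp add: units_of_carrier units_of_pow units_of_one)

lemma dvd_four: "n = 4" if "n dvd 4" "\<not> n dvd 2" for n :: nat
proof -
  have "n \<le> 4" using that(1) by (simp add: dvd_imp_le)
  then consider "n = 0" | "n = 1" | "n = 2" | "n = 3" | "n = 4" by linarith
  then show ?thesis using that by cases auto
qed

text \<open>The characteristic is defined as a least number m. If m were different from the prime r,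
  it would be smaller and prime to r, and Bezout would give 1 = 0.\<close>

lemma (in ring) ring_char_prime:
  assumes r: "Factorial_Ring.prime r" "add_pow R r \<one> = \<zero>" "\<one> \<noteq> \<zero>"
  shows "ring_char R = r"
proof -
  let ?P = "\<lambda>n::nat. n > 0 \<and> add_pow R n \<one> = \<zero>"
  have P: "?P r" using r prime_gt_0_nat by simp
  define m where "m = (LEAST n. ?P n)"
  have m: "?P m" "m \<le> r" unfolding m_def by (rule LeastI[of ?P, OF P]) (rule Least_le[of ?P, OF P])
  have "m = r"
  proof (rule ccontr)
    assume "m \<noteq> r"
    then have "coprime m r"
      using m r(1) by (metis coprime_commute le_neq_implies_less nat_dvd_not_less prime_imp_coprime_nat)
    then obtain s t where st: "m * s = r * t + 1"
      using bezout_nat[of m r] m by (auto simp: coprime_iff_gcd_eq_1)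
    have "add_pow R (m * s) \<one> = add_pow R s (add_pow R m \<one>)"
      using add.nat_pow_pow[of \<one> s m] by simp
    then have "add_pow R (m * s) \<one> = \<zero>" using m(1) add.nat_pow_one by simp
    moreover have "add_pow R (r * t) \<one> = add_pow R t (add_pow R r \<one>)"
      using add.nat_pow_pow[of \<one> t r] by simp
    then have "add_pow R (r * t) \<one> = \<zero>" using r(2) add.nat_pow_one by simp
    then have "add_pow R (r * t + 1) \<one> = \<one>" by simp
    ultimately show False using st r(3) by simp
  qed
  then show ?thesis using P unfolding ring_char_def m_def by auto
qed

context unit_extension
begin

lemma cls_pow: "u \<in> carrier U \<Longrightarrow> cls u [^]\<^bsub>D\<^esub> (n::nat) = cls (u [^]\<^bsub>U\<^esub> n)"
  by (induct n) (simp_all add: cls_one cls_mult)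

lemma hm_pow: "u \<in> carrier U \<Longrightarrow> hm u [^]\<^bsub>L\<^esub> (n::nat) = hm (u [^]\<^bsub>U\<^esub> n)"
  by (induct n) (simp_all add: hm_mult L_simps(2))

lemma hm_in_k:
  assumes u: "u \<in> carrier U"
  shows "hm u \<in> k \<longleftrightarrow> cls u = \<one>\<^bsub>D\<^esub>"
proof -
  have "hm u \<in> k \<longleftrightarrow> hm u \<in> k - {\<zero>\<^bsub>L\<^esub>}" using hm_nonzero[OF u] by simp
  also have "\<dots> \<longleftrightarrow> (\<exists>a\<in>Units K. hm u = hm (\<iota> a))" unfolding k_nz by auto
  also have "\<dots> \<longleftrightarrow> (\<exists>a\<in>Units K. u = \<iota> a \<otimes>\<^bsub>U\<^esub> \<one>\<^bsub>U\<^esub>)"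
    by (rule bex_cong[OF refl]) (use hm_inj[OF u] in auto)
  also have "\<dots> \<longleftrightarrow> cls \<one>\<^bsub>U\<^esub> = cls u" using cls_eq[of "\<one>\<^bsub>U\<^esub>" u] u by simp
  finally show ?thesis by (auto simp: cls_one)
qed

lemma hm_pow_in_k: "u \<in> carrier U \<Longrightarrow> hm u [^]\<^bsub>L\<^esub> (n::nat) \<in> k \<longleftrightarrow> cls u [^]\<^bsub>D\<^esub> n = \<one>\<^bsub>D\<^esub>"
  by (simp add: hm_pow hm_in_k cls_pow)

text \<open>The last nontrivial element among g, g^p, g^(p^2), ... is killed by p.\<close>

lemma primary_component_nontrivial:
  "primary_component D p \<noteq> {\<one>\<^bsub>D\<^esub>} \<longleftrightarrow> (\<exists>g\<in>carrier D. g [^]\<^bsub>D\<^esub> p = \<one>\<^bsub>D\<^esub> \<and> g \<noteq> \<one>\<^bsub>D\<^esub>)"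
proof
  interpret D: comm_group D by (rule D_group)
  have 1: "\<one>\<^bsub>D\<^esub> \<in> primary_component D p" by (simp add: primary_component_def)
  assume "primary_component D p \<noteq> {\<one>\<^bsub>D\<^esub>}"
  then obtain g where "g \<in> primary_component D p" "g \<noteq> \<one>\<^bsub>D\<^esub>" using 1 by blast
  then obtain m :: nat where g: "g \<in> carrier D" "g \<noteq> \<one>\<^bsub>D\<^esub>" and m: "g [^]\<^bsub>D\<^esub> (p ^ m) = \<one>\<^bsub>D\<^esub>"
    unfolding primary_component_def by blast
  from m show "\<exists>g\<in>carrier D. g [^]\<^bsub>D\<^esub> p = \<one>\<^bsub>D\<^esub> \<and> g \<noteq> \<one>\<^bsub>D\<^esub>"
  proof (induct m)
    case 0
    then show ?case using g by simp
  next
    case (Suc m)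
    show ?case
    proof (cases "g [^]\<^bsub>D\<^esub> (p ^ m) = \<one>\<^bsub>D\<^esub>")
      case False
      have "(g [^]\<^bsub>D\<^esub> (p ^ m)) [^]\<^bsub>D\<^esub> p = \<one>\<^bsub>D\<^esub>"
        using Suc(2) g by (simp add: D.nat_pow_pow mult.commute)
      then show ?thesis using False g by (intro bexI[of _ "g [^]\<^bsub>D\<^esub> (p ^ m)"]) auto
    qed (rule Suc(1))
  qed
next
  assume "\<exists>g\<in>carrier D. g [^]\<^bsub>D\<^esub> p = \<one>\<^bsub>D\<^esub> \<and> g \<noteq> \<one>\<^bsub>D\<^esub>"
  then obtain g where g: "g \<in> carrier D" "g [^]\<^bsub>D\<^esub> p = \<one>\<^bsub>D\<^esub>" "g \<noteq> \<one>\<^bsub>D\<^esub>" by auto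
  have "g [^]\<^bsub>D\<^esub> (p ^ 1) = \<one>\<^bsub>D\<^esub>" using g(2) by (simp only: power_one_right)
  then have "g \<in> primary_component D p"
    unfolding primary_component_def using g(1) by blast
  then show "primary_component D p \<noteq> {\<one>\<^bsub>D\<^esub>}" using g(3) by blast
qed

lemma lincomb_ones_L: "ring.lincomb L n (\<lambda>_. \<one>\<^bsub>L\<^esub>) (\<lambda>_. \<one>\<^bsub>L\<^esub>) = sc (add_pow K n \<one>)"
proof -
  interpret L: cring L by (rule L_cring)
  interpret sc: ring_hom_ring K L sc by (rule sc_hom)
  show ?thesis
  proof (induct n)
    case 0
    then show ?case by (simp add: sc_zero)
  next
    case (Suc n)
    then show ?case by simp
  qed
qed

text \<open>\<open>D'\<close> consists of the degrees in which \<open>E\<close> has a homogeneous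
  unit. Whether \<open>x d\<close> or another unit of degree d is tested makes no difference,
  because \<open>E\<close> contains the scalars.\<close>

lemma graded_subgroup:
  assumes E: "subfield E L" "k \<subseteq> E"
    and gr: "\<And>S. finite S \<Longrightarrow> S \<subseteq> W \<Longrightarrow>
      (\<And>s t. s \<in> S \<Longrightarrow> t \<in> S \<Longrightarrow> s \<noteq> t \<Longrightarrow> \<not> ring.proportional L k s t) \<Longrightarrow> (\<Oplus>\<^bsub>L\<^esub>s\<in>S. s) \<in> E \<Longrightarrow> S \<subseteq> E"
  shows "\<exists>D'. subgroup D' D \<and> E = ualg_part K U \<iota> x D'"
proof -
  interpret D: comm_group D by (rule D_group)
  interpret E: cring_subfield L E
    by (intro cring_subfield.intro cring_subfield_axioms.intro L_cring E)
  interpret G: graded_algebra L k W by (rule L_graded_algebra)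
  define D' where "D' = {d \<in> carrier D. hm (x d) \<in> E}"
  have hmE: "hm u \<in> E \<longleftrightarrow> cls u \<in> D'" if u: "u \<in> carrier U" for u
  proof -
    have c: "sc (cf u) \<in> E - {\<zero>\<^bsub>L\<^esub>}" using cf(1)[OF u] E(2) sc_nz[of "cf u"] K_Units by auto
    have "hm u = sc (cf u) \<otimes>\<^bsub>L\<^esub> hm (x (cls u))"
      using cf[OF u] u sc_unit[OF cf(1)[OF u]] hm_mult[of "\<iota> (cf u)" "x (cls u)"] by simp
    then have "hm u \<in> E \<longleftrightarrow> hm (x (cls u)) \<in> E"
      using E.subfield_m_inv_simprule[OF E(1) c, of "hm (x (cls u))"] c u by auto
    then show ?thesis using u by (simp add: D'_def)
  qed
  have "subgroup D' D"
  proof (rule D.subgroupI)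
    show "D' \<subseteq> carrier D" by (auto simp: D'_def)
    have "hm \<one>\<^bsub>U\<^esub> \<in> E" using E.F_simps(2) by (simp add: L_simps(2))
    then show "D' \<noteq> {}" using hmE[of "\<one>\<^bsub>U\<^esub>"] by auto
  next
    fix d assume d: "d \<in> D'"
    then obtain u where u: "u \<in> carrier U" "d = cls u" using D_carrier by (auto simp: D'_def)
    have "hm u \<in> E" using hmE u d by simp
    then have "inv\<^bsub>L\<^esub> hm u \<in> E" by (rule E.F_inv[OF _ hm_nonzero[OF u(1)]])
    moreover have "hm u \<otimes>\<^bsub>L\<^esub> hm (inv\<^bsub>U\<^esub> u) = \<one>\<^bsub>L\<^esub>" using u by (simp add: hm_mult L_simps(2))
    then have "inv\<^bsub>L\<^esub> hm u = hm (inv\<^bsub>U\<^esub> u)" using u by (intro E.comm_inv_char) simp_all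
    ultimately have "cls (inv\<^bsub>U\<^esub> u) \<in> D'" using hmE u by simp
    moreover have "inv\<^bsub>D\<^esub> d = cls (inv\<^bsub>U\<^esub> u)"
      by (rule D.inv_equality) (use u in \<open>simp_all add: cls_mult cls_one\<close>)
    ultimately show "inv\<^bsub>D\<^esub> d \<in> D'" by simp
  next
    fix d e assume de: "d \<in> D'" "e \<in> D'"
    then obtain u v where u: "u \<in> carrier U" "d = cls u" "v \<in> carrier U" "e = cls v"
      using D_carrier by (auto simp: D'_def)
    then have "hm u \<in> E" "hm v \<in> E" using hmE de by auto
    then have "hm u \<otimes>\<^bsub>L\<^esub> hm v \<in> E" by simp
    then show "d \<otimes>\<^bsub>D\<^esub> e \<in> D'" using u hmE[of "u \<otimes>\<^bsub>U\<^esub> v"] by (simp add: hm_mult cls_mult)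
  qed
  moreover have "E = ualg_part K U \<iota> x D'"
  proof
    show "E \<subseteq> ualg_part K U \<iota> x D'"
    proof
      fix f assume fE: "f \<in> E"
      then have f: "f \<in> carrier L" by simp
      let ?S = "(\<lambda>d. hm (part_of f d)) ` supp f"
      have "?S \<subseteq> E"
      proof (rule gr)
        show "finite ?S" using f by simp
        show "?S \<subseteq> W" using part_of(1)[OF f] by auto
        show "(\<Oplus>\<^bsub>L\<^esub>s\<in>?S. s) \<in> E" using decomposition_image(1)[OF f] fE by simp
      qed (rule decomposition_image(2)[OF f])
      have "d \<in> D'" if d: "d \<in> supp f" for d
      proof -
        have "hm (part_of f d) \<in> E" using \<open>?S \<subseteq> E\<close> d by blast
        then show ?thesis using hmE[OF part_of(1)[OF f d]] part_of(2)[OF f d] by simp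
      qed
      then show "f \<in> ualg_part K U \<iota> x D'" using f by (auto simp: ualg_part_def)
    qed
    show "ualg_part K U \<iota> x D' \<subseteq> E"
    proof
      fix f assume "f \<in> ualg_part K U \<iota> x D'"
      then have f: "f \<in> carrier L" and 0: "\<And>d. d \<in> carrier D - D' \<Longrightarrow> f d = \<zero>"
        by (auto simp: ualg_part_def)
      have "hm (part_of f d) \<in> E" if d: "d \<in> supp f" for d
        using hmE[OF part_of(1)[OF f d]] part_of(2)[OF f d] 0[of d] d by auto
      then have "(\<Oplus>\<^bsub>L\<^esub>d\<in>supp f. hm (part_of f d)) \<in> E" by (rule E.finsum_in_F)
      then show "f \<in> E" using decomposition[OF f] by simp
    qed
  qed
  ultimately show ?thesis by blast
qed

text \<open>The coefficient of the sum at the degree of \<open>s\<close> comes from \<open>s\<close>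
  alone, as the other terms have other degrees; being nonzero, it forces that degree into
  \<open>D'\<close>.\<close>

lemma graded_part:
  assumes S: "finite S" "S \<subseteq> W"
    "\<And>s t. s \<in> S \<Longrightarrow> t \<in> S \<Longrightarrow> s \<noteq> t \<Longrightarrow> \<not> ring.proportional L k s t"
    and sum: "(\<Oplus>\<^bsub>L\<^esub>s\<in>S. s) \<in> ualg_part K U \<iota> x D'"
  shows "S \<subseteq> ualg_part K U \<iota> x D'"
proof
  fix s assume s: "s \<in> S"
  then obtain u where u: "u \<in> carrier U" "s = hm u" using S by auto
  have Sc: "t \<in> carrier L" if "t \<in> S" for t using that S(2) by auto
  have tu: "t (cls u) = \<zero>" if t: "t \<in> S" "t \<noteq> s" for t
  proof -
    obtain v where v: "v \<in> carrier U" "t = hm v" using t S by auto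
    have "cls u \<noteq> cls v" using S(3)[OF s t(1)] t(2) u v proportional_hm by auto
    then show ?thesis using u v by (simp add: hm_app)
  qed
  have "(\<Oplus>\<^bsub>L\<^esub>s\<in>S. s) (cls u) = (\<Oplus>t\<in>S. t (cls u))"
    by (rule finsum_app) (use S(1) Sc u in auto)
  also have "\<dots> = (\<Oplus>t\<in>S. if s = t then t (cls u) else \<zero>)"
    by (rule finsum_cong') (use tu Sc u in auto)
  also have "\<dots> = s (cls u)"
    by (rule add.finprod_singleton) (use s S(1) Sc u in auto)
  also have "\<dots> = cf u" using u by (simp add: hm_app)
  finally have "(\<Oplus>\<^bsub>L\<^esub>s\<in>S. s) (cls u) \<noteq> \<zero>" using cf(1)[OF u(1)] K_Units by simp
  then have "cls u \<in> D'" using sum u by (auto simp: ualg_part_def)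
  then show "s \<in> ualg_part K U \<iota> x D'" using u by (auto simp: ualg_part_def hm_app)
qed

lemma sc_pow: "a \<in> carrier K \<Longrightarrow> sc (a [^] (n::nat)) = sc a [^]\<^bsub>L\<^esub> n"
  using ring_hom_ring.hom_nat_pow[OF sc_hom] ring_hom_ring.homh[OF sc_hom]
  by (induct n) (simp_all add: ring_hom_mult ring_hom_one)

lemma sc_mem_Units: "z \<in> Units L \<Longrightarrow> z \<in> k \<Longrightarrow> z \<in> sc ` Units K"
proof -
  assume z: "z \<in> Units L" "z \<in> k"
  interpret L: cring L by (rule L_cring)
  obtain a where a: "a \<in> carrier K" "z = sc a" using z by auto
  have "z \<noteq> \<zero>\<^bsub>L\<^esub>"
    using L.Units_r_inv[OF z(1)] L.l_null[OF L.Units_inv_closed[OF z(1)]] L_one_nz by metis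
  then have "a \<noteq> \<zero>" using a sc_nz by simp
  then show ?thesis using a K_Units by auto
qed

definition nontrivial_primes :: "nat set" where
  "nontrivial_primes = {p. Factorial_Ring.prime p \<and> primary_component D p \<noteq> {\<one>\<^bsub>D\<^esub>}}"

lemma conditions_imp_co_galois:
  assumes tors: "torsion_group D"
    and char: "ring_char K > 0 \<longrightarrow> primary_component D (ring_char K) = {\<one>\<^bsub>D\<^esub>}"
    and roots: "\<And>p z. Factorial_Ring.prime p \<Longrightarrow> primary_component D p \<noteq> {\<one>\<^bsub>D\<^esub>} \<Longrightarrow>
      z \<in> Units L \<Longrightarrow> group.ord (units_of L) z = p \<Longrightarrow> z \<in> sc ` Units K"
    and four: "\<And>d z. d \<in> carrier D \<Longrightarrow> group.ord D d = 4 \<Longrightarrow> z \<in> Units L \<Longrightarrow>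
      group.ord (units_of L) z = 4 \<Longrightarrow> \<exists>a\<in>Units K. group.ord (units_of K) a = 4"
  shows "co_galois K U \<iota> x"
proof -
  interpret D: comm_group D by (rule D_group)
  interpret G: graded_algebra L k W by (rule L_graded_algebra)
  interpret sc: ring_hom_ring K L sc by (rule sc_hom)
  let ?Q = nontrivial_primes
  have Q_root: "z \<in> k" if r: "r \<in> ?Q" "z \<in> carrier L" "z [^]\<^bsub>L\<^esub> r = \<one>\<^bsub>L\<^esub>" for r z
  proof -
    have p: "Factorial_Ring.prime r" using r by (simp add: nontrivial_primes_def)
    then obtain r' where r': "r = Suc r'" using prime_gt_0_nat by (metis Suc_pred)
    have "z \<otimes>\<^bsub>L\<^esub> z [^]\<^bsub>L\<^esub> r' = \<one>\<^bsub>L\<^esub>" "z [^]\<^bsub>L\<^esub> r' \<otimes>\<^bsub>L\<^esub> z = \<one>\<^bsub>L\<^esub>"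
      using r r' by (simp_all add: G.m_comm)
    moreover have "z [^]\<^bsub>L\<^esub> r' \<in> carrier L" using r by simp
    ultimately have zU: "z \<in> Units L" unfolding Units_def using r by blast
    have "group.ord (units_of L) z dvd r" using G.units_ord_dvd[OF zU] r by simp
    then have "group.ord (units_of L) z = 1 \<or> group.ord (units_of L) z = r"
      using p by (simp add: prime_nat_iff)
    then show ?thesis
    proof
      assume "group.ord (units_of L) z = 1"
      then have "z [^]\<^bsub>L\<^esub> (1::nat) = \<one>\<^bsub>L\<^esub>" using G.units_ord_dvd[OF zU, of 1] by simp
      then have "z = \<one>\<^bsub>L\<^esub>" using r by simp
      then show ?thesis by simp
    next
      assume "group.ord (units_of L) z = r"
      then have "z \<in> sc ` Units K" using roots[OF p _ zU] r by (simp add: nontrivial_primes_def)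
      then show ?thesis by auto
    qed
  qed
  have Q_char: "G.lincomb r (\<lambda>_. \<one>\<^bsub>L\<^esub>) (\<lambda>_. \<one>\<^bsub>L\<^esub>) \<noteq> \<zero>\<^bsub>L\<^esub>" if r: "r \<in> ?Q" for r
  proof
    assume "G.lincomb r (\<lambda>_. \<one>\<^bsub>L\<^esub>) (\<lambda>_. \<one>\<^bsub>L\<^esub>) = \<zero>\<^bsub>L\<^esub>"
    then have "add_pow K r \<one> = \<zero>" using sc_nz[of "add_pow K r \<one>"] by (simp add: lincomb_ones_L)
    then have "ring_char K = r" using ring_char_prime[of r] r by (simp add: nontrivial_primes_def)
    then show False using char r prime_gt_0_nat by (simp add: nontrivial_primes_def)
  qed
  have tW: "\<exists>n>0. w [^]\<^bsub>L\<^esub> n \<in> k \<and> (\<forall>r. Factorial_Ring.prime r \<longrightarrow> r dvd n \<longrightarrow> r \<in> ?Q) \<and>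
      (4 dvd n \<longrightarrow> (\<forall>i\<in>carrier L. i \<otimes>\<^bsub>L\<^esub> i = \<ominus>\<^bsub>L\<^esub> \<one>\<^bsub>L\<^esub> \<longrightarrow> i \<in> k))" if "w \<in> W" for w
  proof -
    obtain u where u: "u \<in> carrier U" "w = hm u" using \<open>w \<in> W\<close> by auto
    define n where "n = D.ord (cls u)"
    have cu: "cls u \<in> carrier D" using u by simp
    obtain m :: nat where "m > 0" "cls u [^]\<^bsub>D\<^esub> m = \<one>\<^bsub>D\<^esub>"
      using tors cu unfolding torsion_group_def by blast
    then have n0: "n > 0" using D.pow_eq_id[OF cu, of m] by (auto simp: n_def intro!: Nat.gr0I)
    have n1: "cls u [^]\<^bsub>D\<^esub> n = \<one>\<^bsub>D\<^esub>" unfolding n_def by (rule D.pow_ord_eq_1[OF cu])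
    have nk: "w [^]\<^bsub>L\<^esub> n \<in> k" using u(2) hm_pow_in_k[OF u(1)] n1 by simp
    \<comment> \<open>Here n is the exact order of the class, so its power with exponent n / r is a
      nontrivial element killed by r.\<close>
    have rQ: "r \<in> ?Q" if r: "Factorial_Ring.prime r" "r dvd n" for r
    proof -
      obtain l where l: "n = r * l" using r by auto
      have l0: "l > 0" "l < n" using n0 l prime_gt_1_nat[OF r(1)] by auto
      let ?g = "cls u [^]\<^bsub>D\<^esub> l"
      have "?g \<noteq> \<one>\<^bsub>D\<^esub>" using D.pow_eq_id[OF cu, of l] l0 by (auto simp: n_def dest: dvd_imp_le)
      moreover have "?g [^]\<^bsub>D\<^esub> r = \<one>\<^bsub>D\<^esub>"
        using n1 cu by (simp add: D.nat_pow_pow l mult.commute)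
      ultimately have "primary_component D r \<noteq> {\<one>\<^bsub>D\<^esub>}"
        unfolding primary_component_nontrivial using cu by blast
      then show ?thesis using r by (simp add: nontrivial_primes_def)
    qed
    have "i \<in> k" if n4: "4 dvd n" and i: "i \<in> carrier L" "i \<otimes>\<^bsub>L\<^esub> i = \<ominus>\<^bsub>L\<^esub> \<one>\<^bsub>L\<^esub>" for i
    proof -
      have "2 dvd n" using n4 by (rule dvd_trans[rotated]) simp
      then have Q2: "2 \<in> ?Q" using rQ two_is_prime_nat by blast
      \<comment> \<open>The prime 2 divides n and so belongs to \<open>?Q\<close>, hence 2 is
        nonzero in \<open>L\<close> and i has order 4 rather than 2.\<close>
      have m1: "\<ominus>\<^bsub>L\<^esub> \<one>\<^bsub>L\<^esub> \<noteq> \<one>\<^bsub>L\<^esub>"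
      proof
        assume "\<ominus>\<^bsub>L\<^esub> \<one>\<^bsub>L\<^esub> = \<one>\<^bsub>L\<^esub>"
        then have "\<one>\<^bsub>L\<^esub> \<oplus>\<^bsub>L\<^esub> \<one>\<^bsub>L\<^esub> = \<zero>\<^bsub>L\<^esub>" using G.r_neg[of "\<one>\<^bsub>L\<^esub>"] by simp
        then show False using Q_char[OF Q2] by (simp add: numeral_2_eq_2)
      qed
      obtain l where l: "n = 4 * l" using n4 by auto
      have l0: "l > 0" using n0 l by simp
      have ord_d: "D.ord (cls u [^]\<^bsub>D\<^esub> l) = 4"
        using D.ord_pow[OF cu, of l] l l0 by (simp add: n_def[symmetric])
      have i2: "i [^]\<^bsub>L\<^esub> (2::nat) = \<ominus>\<^bsub>L\<^esub> \<one>\<^bsub>L\<^esub>" using i by (simp add: numeral_2_eq_2)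
      have "i [^]\<^bsub>L\<^esub> (4::nat) = i [^]\<^bsub>L\<^esub> (2::nat) \<otimes>\<^bsub>L\<^esub> i [^]\<^bsub>L\<^esub> (2::nat)"
        using i(1) by (simp add: G.nat_pow_mult)
      then have i4: "i [^]\<^bsub>L\<^esub> (4::nat) = \<one>\<^bsub>L\<^esub>" unfolding i2 by (simp add: G.l_minus)
      have "i \<otimes>\<^bsub>L\<^esub> (\<ominus>\<^bsub>L\<^esub> i) = \<one>\<^bsub>L\<^esub>" "(\<ominus>\<^bsub>L\<^esub> i) \<otimes>\<^bsub>L\<^esub> i = \<one>\<^bsub>L\<^esub>"
        using i by (simp_all add: G.r_minus G.l_minus)
      moreover have "\<ominus>\<^bsub>L\<^esub> i \<in> carrier L" using i by simp
      ultimately have iU: "i \<in> Units L" unfolding Units_def using i(1) by blast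
      have "group.ord (units_of L) i = 4"
        using G.units_ord_dvd[OF iU, of 4] G.units_ord_dvd[OF iU, of 2] i2 i4 m1
        by (intro dvd_four) simp_all
      then obtain a where a: "a \<in> Units K" "group.ord (units_of K) a = 4"
        using four[OF _ ord_d iU] cu by auto
      have "a \<otimes> a = \<ominus> \<one>"
        using units_ord_dvd[OF a(1), of 4] units_ord_dvd[OF a(1), of 2] a
        by (intro square_eq_minus_one) simp_all
      define b where "b = sc a"
      have b: "b \<in> k" "b \<in> carrier L" using a by (simp_all add: b_def)
      have "b \<otimes>\<^bsub>L\<^esub> b = sc (a \<otimes> a)" using a by (simp add: b_def)
      also have "\<dots> = \<ominus>\<^bsub>L\<^esub> \<one>\<^bsub>L\<^esub>" unfolding \<open>a \<otimes> a = \<ominus> \<one>\<close> by simp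
      finally have bb: "b \<otimes>\<^bsub>L\<^esub> b = \<ominus>\<^bsub>L\<^esub> \<one>\<^bsub>L\<^esub>" .
      \<comment> \<open>The condition supplies only some element of order 4 in \<open>K\<close>,
        with image \<open>b\<close>. As (i b)^2 = 1, the product is in \<open>k\<close> by
        \<open>Q_root\<close> for the prime 2, and multiplying by -b recovers i.\<close>
      let ?j = "i \<otimes>\<^bsub>L\<^esub> b"
      have "?j [^]\<^bsub>L\<^esub> (2::nat) = (i \<otimes>\<^bsub>L\<^esub> i) \<otimes>\<^bsub>L\<^esub> (b \<otimes>\<^bsub>L\<^esub> b)"
        using i(1) b(2) by (simp add: numeral_2_eq_2 G.m_ac)
      also have "\<dots> = \<one>\<^bsub>L\<^esub>" unfolding i(2) bb by (simp add: G.l_minus)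
      finally have "?j \<in> k" using Q_root[OF Q2, of ?j] i(1) b(2) by simp
      then have jk: "?j \<otimes>\<^bsub>L\<^esub> (\<ominus>\<^bsub>L\<^esub> b) \<in> k" by (rule G.F_simps(4)[OF _ G.F_simps(3)[OF b(1)]])
      have j: "?j \<otimes>\<^bsub>L\<^esub> (\<ominus>\<^bsub>L\<^esub> b) = i"
        using i(1) b(2) bb by (simp add: G.m_assoc G.r_minus)
      show ?thesis using jk unfolding j .
    qed
    then show ?thesis using n0 nk rQ by blast
  qed
  have "radical_extension L k W ?Q"
    by (intro radical_extension.intro radical_extension_axioms.intro L_graded_algebra Q_root Q_char tW)
  then interpret R: radical_extension L k W ?Q .
  have "\<exists>D'. subgroup D' D \<and> E = ualg_part K U \<iota> x D'" if "subfield E L" "k \<subseteq> E" for E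
    by (rule graded_subgroup[OF that]) (rule R.intermediate_graded[OF that])
  then show ?thesis
    using R.is_field char unfolding co_galois_def Let_def by blast
qed

lemma co_galois_imp_conditions:
  assumes cg: "co_galois K U \<iota> x"
  shows "torsion_group D"
    and "ring_char K > 0 \<longrightarrow> primary_component D (ring_char K) = {\<one>\<^bsub>D\<^esub>}"
    and "Factorial_Ring.prime p \<Longrightarrow> primary_component D p \<noteq> {\<one>\<^bsub>D\<^esub>} \<Longrightarrow>
      z \<in> Units L \<Longrightarrow> group.ord (units_of L) z = p \<Longrightarrow> z \<in> sc ` Units K"
    and "d \<in> carrier D \<Longrightarrow> group.ord D d = 4 \<Longrightarrow> z \<in> Units L \<Longrightarrow>
      group.ord (units_of L) z = 4 \<Longrightarrow> \<exists>a\<in>Units K. group.ord (units_of K) a = 4"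
proof -
  interpret D: comm_group D by (rule D_group)
  have fL: "field L" and gr: "\<And>E. subfield E L \<Longrightarrow> k \<subseteq> E \<Longrightarrow> \<exists>D'. subgroup D' D \<and> E = ualg_part K U \<iota> x D'"
    using cg unfolding co_galois_def Let_def by blast+
  interpret L: field L by (rule fL)
  have "graded_field L k W"
  proof (intro graded_field.intro graded_field_axioms.intro L_graded_algebra fL)
    fix E S
    assume E: "subfield E L" "k \<subseteq> E" and S: "finite S" "S \<subseteq> W"
      "\<And>s t. s \<in> S \<Longrightarrow> t \<in> S \<Longrightarrow> s \<noteq> t \<Longrightarrow> \<not> L.proportional k s t" "(\<Oplus>\<^bsub>L\<^esub>s\<in>S. s) \<in> E"
    obtain D' where "E = ualg_part K U \<iota> x D'" using gr[OF E] by blast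
    then show "S \<subseteq> E" using graded_part[OF S(1-3), of D'] S(4) by simp
  qed
  then interpret G: graded_field L k W .
  show "torsion_group D"
    unfolding torsion_group_def
  proof
    fix g assume "g \<in> carrier D"
    then obtain u where u: "u \<in> carrier U" "g = cls u" using D_carrier by auto
    then obtain n :: nat where "n > 0" "hm u [^]\<^bsub>L\<^esub> n \<in> k" using G.W_torsion[of "hm u"] by auto
    then show "\<exists>n::nat. n > 0 \<and> g [^]\<^bsub>D\<^esub> n = \<one>\<^bsub>D\<^esub>" using hm_pow_in_k[OF u(1)] u by auto
  qed
  show "ring_char K > 0 \<longrightarrow> primary_component D (ring_char K) = {\<one>\<^bsub>D\<^esub>}"
    using cg unfolding co_galois_def Let_def by blast
  show "z \<in> sc ` Units K" if p: "Factorial_Ring.prime p" "primary_component D p \<noteq> {\<one>\<^bsub>D\<^esub>}"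
    and z: "z \<in> Units L" "group.ord (units_of L) z = p"
  proof -
    obtain g where "g \<in> carrier D" "g [^]\<^bsub>D\<^esub> p = \<one>\<^bsub>D\<^esub>" "g \<noteq> \<one>\<^bsub>D\<^esub>"
      using p(2) unfolding primary_component_nontrivial by blast
    then obtain u where u: "u \<in> carrier U" "cls u [^]\<^bsub>D\<^esub> p = \<one>\<^bsub>D\<^esub>" "cls u \<noteq> \<one>\<^bsub>D\<^esub>"
      using D_carrier by auto
    have "z [^]\<^bsub>L\<^esub> p = \<one>\<^bsub>L\<^esub>" using L.units_ord_dvd[OF z(1), of p] z(2) by simp
    then have "z \<in> k"
      using G.prime_root_of_unity[OF p(1), of "hm u" z] u hm_pow_in_k[OF u(1)] hm_in_k[OF u(1)] z(1) by auto
    then show ?thesis by (rule sc_mem_Units[OF z(1)])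
  qed
  show "\<exists>a\<in>Units K. group.ord (units_of K) a = 4"
    if d: "d \<in> carrier D" "group.ord D d = 4" and z: "z \<in> Units L" "group.ord (units_of L) z = 4"
  proof -
    obtain u where u: "u \<in> carrier U" "d = cls u" using d D_carrier by auto
    have "d [^]\<^bsub>D\<^esub> (4::nat) = \<one>\<^bsub>D\<^esub>" "d [^]\<^bsub>D\<^esub> (2::nat) \<noteq> \<one>\<^bsub>D\<^esub>"
      using D.pow_eq_id[OF d(1), of 4] D.pow_eq_id[OF d(1), of 2] d(2) by simp_all
    then have u4: "hm u [^]\<^bsub>L\<^esub> (4::nat) \<in> k" "hm u [^]\<^bsub>L\<^esub> (2::nat) \<notin> k"
      using hm_pow_in_k[OF u(1)] u(2) by simp_all
    have z4: "z [^]\<^bsub>L\<^esub> (4::nat) = \<one>\<^bsub>L\<^esub>" "z [^]\<^bsub>L\<^esub> (2::nat) \<noteq> \<one>\<^bsub>L\<^esub>"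
      using L.units_ord_dvd[OF z(1), of 4] L.units_ord_dvd[OF z(1), of 2] z(2) by simp_all
    have zc: "z \<in> carrier L" using z(1) by (rule L.Units_closed)
    have "z \<in> k"
      by (rule G.square_root_of_minus_one[OF _ u4 zc L.square_eq_minus_one[OF zc z4]]) (use u in simp)
    then obtain a where a: "a \<in> Units K" "z = sc a" using sc_mem_Units[OF z(1)] by auto
    have ac: "a \<in> carrier K" using a by simp
    \<comment> \<open>The scalar embedding is injective, so \<open>a\<close> inherits the order of
      \<open>z\<close>.\<close>
    have pow: "a [^] n = \<one> \<longleftrightarrow> z [^]\<^bsub>L\<^esub> n = \<one>\<^bsub>L\<^esub>" for n :: nat
    proof -
      have "a [^] n = \<one> \<longleftrightarrow> sc (a [^] n) = sc \<one>"
        by (rule inj_on_eq_iff[OF sc_inj, symmetric]) (use ac in simp_all)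
      then show ?thesis using a ac sc_pow[OF ac, of n] by (simp add: sc_unit \<iota>_one L_simps(2))
    qed
    have "group.ord (units_of K) a dvd 4" "\<not> group.ord (units_of K) a dvd 2"
      using z4 units_ord_dvd[OF a(1), of 4] units_ord_dvd[OF a(1), of 2] by (simp_all add: pow)
    then show ?thesis using dvd_four a(1) by blast
  qed
qed

end

theorem theorem3p3:
  fixes K :: "('a, 'm) ring_scheme"
    and U :: "('u, 'n) monoid_scheme"
    and \<iota> :: "'a \<Rightarrow> 'u"
    and x :: "'u set \<Rightarrow> 'u"
  defines "D \<equiv> ext_quot K U \<iota>"
    and "L \<equiv> universal_algebra K U \<iota> x"
  assumes "field K"
    and "comm_group U"
    and "\<iota> \<in> hom (units_of K) U"
    and "inj_on \<iota> (carrier (units_of K))"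
    and "\<And>d. d \<in> carrier D \<Longrightarrow> x d \<in> d"
  shows "co_galois K U \<iota> x \<longleftrightarrow>
      (torsion_group D \<and>
       (ring_char K > 0 \<longrightarrow> primary_component D (ring_char K) = {\<one>\<^bsub>D\<^esub>})) \<and>
      (\<forall>p::nat. Factorial_Ring.prime p \<and> primary_component D p \<noteq> {\<one>\<^bsub>D\<^esub>} \<longrightarrow>
         (\<forall>z \<in> carrier (units_of L). group.ord (units_of L) z = p \<longrightarrow>
            z \<in> ualg_scalar K U \<iota> x ` carrier (units_of K))) \<and>
      ((\<exists>d \<in> carrier D. group.ord D d = 4) \<and>
       (\<exists>z \<in> carrier (units_of L). group.ord (units_of L) z = 4) \<longrightarrow>
         (\<exists>a \<in> carrier (units_of K). group.ord (units_of K) a = 4))"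
proof -
  interpret unit_extension K U \<iota> x
  proof (intro unit_extension.intro unit_extension_axioms.intro)
    show "x d \<in> d" if "d \<in> carrier (ext_quot K U \<iota>)" for d
      using assms(7)[of d] that unfolding D_def by simp
  qed (fact assms(3-6))+
  let ?D = "ext_quot K U \<iota>" and ?L = "universal_algebra K U \<iota> x"
  show ?thesis
    unfolding D_def L_def units_of_carrier
  proof (rule iffI)
    assume cg: "co_galois K U \<iota> x"
    note c = co_galois_imp_conditions[OF cg]
    have 3: "\<forall>p::nat. Factorial_Ring.prime p \<and> primary_component ?D p \<noteq> {\<one>\<^bsub>?D\<^esub>} \<longrightarrow>
      (\<forall>z \<in> Units ?L. group.ord (units_of ?L) z = p \<longrightarrow> z \<in> ualg_scalar K U \<iota> x ` Units K)"
      by (intro allI impI ballI, elim conjE) (rule c(3))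
    have 4: "(\<exists>d \<in> carrier ?D. group.ord ?D d = 4) \<and>
      (\<exists>z \<in> Units ?L. group.ord (units_of ?L) z = 4) \<longrightarrow> (\<exists>a \<in> Units K. group.ord (units_of K) a = 4)"
      by (intro impI, elim conjE bexE) (rule c(4))
    show "(torsion_group ?D \<and>
       (ring_char K > 0 \<longrightarrow> primary_component ?D (ring_char K) = {\<one>\<^bsub>?D\<^esub>})) \<and>
      (\<forall>p::nat. Factorial_Ring.prime p \<and> primary_component ?D p \<noteq> {\<one>\<^bsub>?D\<^esub>} \<longrightarrow>
         (\<forall>z \<in> Units ?L. group.ord (units_of ?L) z = p \<longrightarrow> z \<in> ualg_scalar K U \<iota> x ` Units K)) \<and>
      ((\<exists>d \<in> carrier ?D. group.ord ?D d = 4) \<and>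
       (\<exists>z \<in> Units ?L. group.ord (units_of ?L) z = 4) \<longrightarrow> (\<exists>a \<in> Units K. group.ord (units_of K) a = 4))"
      by (rule conjI[OF conjI[OF c(1,2)] conjI[OF 3 4]])
  next
    assume a: "(torsion_group ?D \<and>
       (ring_char K > 0 \<longrightarrow> primary_component ?D (ring_char K) = {\<one>\<^bsub>?D\<^esub>})) \<and>
      (\<forall>p::nat. Factorial_Ring.prime p \<and> primary_component ?D p \<noteq> {\<one>\<^bsub>?D\<^esub>} \<longrightarrow>
         (\<forall>z \<in> Units ?L. group.ord (units_of ?L) z = p \<longrightarrow> z \<in> ualg_scalar K U \<iota> x ` Units K)) \<and>
      ((\<exists>d \<in> carrier ?D. group.ord ?D d = 4) \<and>
       (\<exists>z \<in> Units ?L. group.ord (units_of ?L) z = 4) \<longrightarrow> (\<exists>a \<in> Units K. group.ord (units_of K) a = 4))"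
    show "co_galois K U \<iota> x"
    proof (rule conditions_imp_co_galois)
      show "torsion_group ?D" "ring_char K > 0 \<longrightarrow> primary_component ?D (ring_char K) = {\<one>\<^bsub>?D\<^esub>}"
        by (fact conjunct1[OF conjunct1[OF a]] conjunct2[OF conjunct1[OF a]])+
      show "z \<in> ualg_scalar K U \<iota> x ` Units K"
        if "Factorial_Ring.prime p" "primary_component ?D p \<noteq> {\<one>\<^bsub>?D\<^esub>}" "z \<in> Units ?L"
          "group.ord (units_of ?L) z = p" for p z
        by (rule mp[OF bspec[OF mp[OF spec[OF conjunct1[OF conjunct2[OF a]]] conjI[OF that(1,2)]] that(3)] that(4)])
      show "\<exists>a\<in>Units K. group.ord (units_of K) a = 4"
        if "d \<in> carrier ?D" "group.ord ?D d = 4" "z \<in> Units ?L" "group.ord (units_of ?L) z = 4" for d z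
        by (rule mp[OF conjunct2[OF conjunct2[OF a]]]) (intro conjI bexI[of _ d] bexI[of _ z] that)
    qed
  qed
qed

end
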